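(* Let $K_1,\dots,K_n$ be convex bodies in $\mathbb{R}^n$ of class $C^2_+$ with centroid at the origin. For all real $p\ge0$, $$as_p(K_1,\dots,K_n)^n\,as_p(K_1^\circ,\dots,K_n^\circ)^n\le n^{2n}\,|K_1||K_1^\circ|\cdots|K_n||K_n^\circ|.$$ Furthermore, $$as_p(K_1,\dots,K_n)\,as_p(K_1^\circ,\dots,K_n^\circ)\le as_p(B_2^n)^2,$$ with equality if the $K_i$ are ellipsoids that are dilates of one another.
   Context: $K\in C^2_+$ means that $\partial K$ is of class $C^2$ with everywhere strictly positive Gauss curvature. $K^\circ=\{y\in\mathbb{R}^n:\langle x,y\rangle\le1\ \forall x\in K\}$ is the polar body (which is again of class $C^2_+$ with the origin in its interior). For convex bodies $L_1,\dots,L_n\in C^2_+$ with the origin in their interiors and real $p\ne-n$, $$as_p(L_1,\dots,L_n)=\int_{S^{n-1}}\big[h_{L_1}(u)^{1-p}f_{L_1}(u)\cdots h_{L_n}(u)^{1-p}f_{L_n}(u)\big]^{\frac1{n+p}}\,d\sigma(u),$$ where $h_L$ is the support function, $f_L(u)$ is the reciprocal of the Gauss curvature of $\partial L$ at the unique boundary point with outer unit normal $u$, and $\sigma$ is the surface area measure on $S^{n-1}$; $as_p(L)=as_p(L,\dots,L)$. $B_2^n$ is the Euclidean unit ball, $|\cdot|$ is volume. Bodies with centroid at the origin are dilates of one another if they are positive multiples of one another. *)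

theory Defs
  imports "HOL-Analysis.Analysis"
begin

section \<open>Convex bodies\<close>

definition convex_body :: "'a::euclidean_space set \<Rightarrow> bool" where
  "convex_body K \<longleftrightarrow> compact K \<and> convex K \<and> interior K \<noteq> {}"

definition vol :: "'a::euclidean_space set \<Rightarrow> real" where
  "vol K = measure lebesgue K"

definition centroid :: "'a::euclidean_space set \<Rightarrow> 'a" where
  "centroid K = (1 / vol K) *\<^sub>R integral K (\<lambda>x. x)"

definition polar :: "'a::euclidean_space set \<Rightarrow> 'a set" where
  "polar K = {y. \<forall>x\<in>K. x \<bullet> y \<le> 1}"

definition support_function :: "'a::euclidean_space set \<Rightarrow> 'a \<Rightarrow> real" where
  "support_function K u = (SUP x\<in>K. x \<bullet> u)"

definition ellipsoid :: "'a::euclidean_space set \<Rightarrow> bool" where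
  "ellipsoid E \<longleftrightarrow> (\<exists>(T :: 'a \<Rightarrow> 'a) c. linear T \<and> bij T \<and> E = (\<lambda>x. c + T x) ` cball 0 1)"

text \<open>For bodies with centroid at the origin: dilates are positive multiples.\<close>

definition dilates :: "'a::euclidean_space set \<Rightarrow> 'a set \<Rightarrow> bool" where
  "dilates K L \<longleftrightarrow> (\<exists>c>0. L = (\<lambda>x. c *\<^sub>R x) ` K)"

section \<open>Bodies of class $C^2_+$\<close>

definition outer_unit_normal :: "'a::euclidean_space set \<Rightarrow> 'a \<Rightarrow> 'a \<Rightarrow> bool" where
  "outer_unit_normal K x u \<longleftrightarrow> norm u = 1 \<and> (\<forall>y\<in>K. (y - x) \<bullet> u \<le> 0)"

text \<open>The embedded hypersurfaces of class $C^2$: locally the zero set of a $C^2$ function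
  \<open>\<phi>\<close>, with gradient \<open>G\<close> and Hessian \<open>H\<close>, whose gradient does not vanish there.\<close>

definition C2_hypersurface :: "(real^'n) set \<Rightarrow> bool" where
  "C2_hypersurface S \<longleftrightarrow>
     (\<forall>x\<in>S. \<exists>U \<phi> G (H :: real^'n \<Rightarrow> real^'n^'n). open U \<and> x \<in> U \<and>
        (\<forall>y\<in>U. (\<phi> has_derivative (\<lambda>v. G y \<bullet> v)) (at y)) \<and>
        (\<forall>y\<in>U. (G has_derivative (\<lambda>v. H y *v v)) (at y)) \<and>
        continuous_on U H \<and>
        S \<inter> U = {y \<in> U. \<phi> y = 0} \<and>
        (\<forall>y\<in>S \<inter> U. G y \<noteq> 0))"

text \<open>The definite descriptions below are meant for convex bodies with \<open>C2_hypersurface (frontier K)\<close>: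
  the outer unit normal at a boundary point is then unique, and \<open>gauss_map K\<close> is
  differentiable along the boundary.\<close>

definition gauss_map :: "'a::euclidean_space set \<Rightarrow> 'a \<Rightarrow> 'a" where
  "gauss_map K x = (THE u. outer_unit_normal K x u)"

text \<open>The Gauss curvature at \<open>x\<close> is the determinant of the Weingarten map, i.e. of the derivative
  \<open>W\<close> of the Gauss map along the boundary, an endomorphism of the tangent space \<open>u\<^sup>\<bottom>\<close>
  at \<open>x\<close>, where \<open>u\<close> is the normal. To take the determinant in the ambient space, it is extended by
  \<open>u \<mapsto> u\<close>. A derivative within the boundary is determined only on tangent vectors,
  whence the orthogonal projection \<open>v - (v \<bullet> u) *\<^sub>R u\<close>.\<close>

definition gauss_curvature :: "(real^'n) set \<Rightarrow> real^'n \<Rightarrow> real" where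
  "gauss_curvature K x =
     (THE k. \<exists>W. (gauss_map K has_derivative W) (at x within frontier K) \<and>
        (let u = gauss_map K x
         in k = det (matrix (\<lambda>v. W (v - (v \<bullet> u) *\<^sub>R u) + (v \<bullet> u) *\<^sub>R u))))"

definition C2_plus :: "(real^'n) set \<Rightarrow> bool" where
  "C2_plus K \<longleftrightarrow>
     convex_body K \<and> C2_hypersurface (frontier K) \<and> (\<forall>x\<in>frontier K. gauss_curvature K x > 0)"

text \<open>For \<open>C2_plus K\<close> and a unit vector \<open>u\<close>, exactly one boundary point has outer unit normal \<open>u\<close>.\<close>

definition curvature_function :: "(real^'n) set \<Rightarrow> real^'n \<Rightarrow> real" where
  "curvature_function K u =
     1 / gauss_curvature K (THE x. x \<in> frontier K \<and> outer_unit_normal K x u)"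

section \<open>Mixed $p$-affine surface area\<close>

text \<open>Surface area measure on the unit sphere, as in integration in polar coordinates: the measure of
  \<open>A\<close> is \<open>n\<close> times the volume of the cone \<open>{r *\<^sub>R u | r u. 0 < r \<and> r < 1 \<and> u \<in> A}\<close>.\<close>

definition sphere_measure :: "'a::euclidean_space measure" where
  "sphere_measure =
     distr (scale_measure (of_nat DIM('a)) (restrict_space lborel (ball 0 1 - {0})))
       (restrict_space borel (sphere 0 1)) (\<lambda>x. x /\<^sub>R norm x)"

text \<open>The \<open>n\<close> bodies are indexed by the same type \<open>'n\<close> as the coordinates.\<close>

definition mixed_as :: "real \<Rightarrow> ('n \<Rightarrow> (real^'n) set) \<Rightarrow> real" where
  "mixed_as p L =
     (LINT u|sphere_measure.
        (\<Prod>i\<in>UNIV. support_function (L i) u powr (1 - p) * curvature_function (L i) u)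
          powr (1 / (real CARD('n) + p)))"

definition affine_surface_area :: "real \<Rightarrow> (real^'n) set \<Rightarrow> real" where
  "affine_surface_area p L = mixed_as p (\<lambda>_. L)"

end

theory Submission
  imports
    Defs
    "HOL-Combinatorics.Permutations"
    "HOL-Probability.Distributions"
    "HOL-Probability.Distribution_Functions"
begin

text \<open>Write \<open>h\<close> and \<open>f\<close> for the support and curvature functions of \<open>K\<close>. Since the inverse Gauss map
  parametrises the boundary, the map \<open>r u \<mapsto> r x(u)\<close> from the unit ball onto \<open>K\<close> has Jacobian \<open>h f\<close>, so
  \<open>\<integral> h f = n |K|\<close>, and likewise \<open>\<integral> h\<^sup>-\<^sup>n = n |K\<degree>|\<close>. The integrand of the mixed affine surface area is a
  product of powers of the functions \<open>h\<^sub>i f\<^sub>i\<close> and \<open>h\<^sub>i\<^sup>-\<^sup>n\<close> with exponents of sum 1, so Hoelder's inequality, in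
  the form of the weighted arithmetic-geometric mean inequality, gives the first bound. The same applies to the
  polar bodies, because Gauss map and inverse Gauss map, radially rescaled, exchange their roles under
  polarity. The second bound then is the Blaschke--Santalo inequality. It follows from its functional version for
  \<open>f(x) g(y) \<le> exp(-\<langle>x,y\<rangle>)\<close>, which Lehec derives by induction on the dimension: bisect \<open>g\<close> by a hyperplane,
  project both halves along the line joining their barycentres, and apply the one-dimensional
  Prekopa--Leindler inequality on the half-lines. For an ellipsoid \<open>h f\<close> is a constant multiple of \<open>h\<^sup>-\<^sup>n\<close>, which makes
  the integrals explicit.\<close>


section \<open>The one-dimensional Prekopa--Leindler inequality\<close>

text \<open>The Gauss curvature of the definitions is a determinant of a derivative within the
  boundary, and it is not immediate that a polar body satisfies \<open>C2_plus\<close> in this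
  sense. Both difficulties are met by the locale \<open>gauss_pair\<close>: it extends the Gauss map
  and its inverse to functions of degree 0 on the punctured space, asks for differentiability there,
  and is stable under polarity. Measurability of the derivative comes from difference quotients. As
  the sphere carries the measure of cones, all changes of variables take place between open subsets
  of the space.

  The exponents are forced: \<open>h powr (1 - p) * f\<close> to the power \<alpha> = 1/(n+p) has to
  be \<open>h * f\<close> to the power \<alpha> times \<open>1 / h ^ n\<close> to the power \<beta>,
  whence \<beta> = p/(n(n+p)); here p \<ge> 0 makes \<beta> nonnegative, and n(\<alpha>+\<beta>) =
  1. For the polar bodies the exponents n/(n+p) and p/(n+p) of the two volumes are exchanged, so
  that in the product every volume has exponent 1.\<close>

lemma emeasure_eq_SUP_atMost:
  fixes A :: "real set"
  assumes A: "A \<in> sets borel" "A \<noteq> {}"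
  shows "emeasure lborel A = (SUP a\<in>A. emeasure lborel (A \<inter> {..a}))"
proof (rule antisym)
  \<comment> \<open>A countable cofinal subset of \<open>A\<close>: its maximum if there is one;
    otherwise every rational below some point of \<open>A\<close> gets a point of \<open>A\<close>
    above it. The cuts have to be at points of \<open>A\<close> itself, because in
    \<open>brunn_minkowski_real\<close> the cutting point serves as a summand.\<close>
  obtain D where D: "countable D" "D \<subseteq> A" "D \<noteq> {}" "\<And>a. a \<in> A \<Longrightarrow> \<exists>d\<in>D. a \<le> d"
  proof (cases "\<exists>m\<in>A. \<forall>a\<in>A. a \<le> m")
    case True
    then obtain m where "m \<in> A" "\<forall>a\<in>A. a \<le> m" by blast
    then show ?thesis by (intro that[of "{m}"]) auto
  next
    case False
    then have F: "\<exists>b\<in>A. a < b" if "a \<in> A" for a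
      using that by (meson not_le)
    define Q where "Q = {q\<in>\<rat>. \<exists>a\<in>A. q \<le> a}"
    define s where "s q = (SOME a. a \<in> A \<and> q \<le> a)" for q :: real
    have s: "s q \<in> A \<and> q \<le> s q" if "q \<in> Q" for q
      unfolding s_def using that someI_ex[of "\<lambda>a. a \<in> A \<and> q \<le> a"] by (auto simp: Q_def)
    have ex: "\<exists>d\<in>s ` Q. a \<le> d" if a: "a \<in> A" for a
    proof -
      obtain b where b: "b \<in> A" "a < b" using F[OF a] by blast
      obtain q where q: "q \<in> \<rat>" "a < q" "q < b"
        using Rats_dense_in_real[OF b(2)] by blast
      then have "q \<in> Q" using b unfolding Q_def by (intro CollectI conjI bexI[of _ b]) auto
      then have "s q \<in> s ` Q" "a \<le> s q" using s[of q] q by auto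
      then show ?thesis by blast
    qed
    show ?thesis
    proof (rule that[of "s ` Q"])
      show "countable (s ` Q)"
        unfolding Q_def by (intro countable_image countable_subset[OF _ countable_rat]) auto
      show "s ` Q \<noteq> {}" using ex A(2) by blast
    qed (use s ex in auto)
  qed
  \<comment> \<open>Running maxima of an enumeration of \<open>D\<close>: increasing, still in
    \<open>A\<close>, and cofinal.\<close>
  define d where "d n = Max (from_nat_into D ` {..n})" for n :: nat
  have dA: "d n \<in> A" for n
  proof -
    have "d n \<in> from_nat_into D ` {..n}" unfolding d_def by (rule Max_in) auto
    then obtain k where "d n = from_nat_into D k" by blast
    then show ?thesis using D(2) from_nat_into[OF D(3), of k] by auto
  qed
  have "incseq d" unfolding incseq_def d_def by (intro allI impI Max_mono) auto
  have "A = (\<Union>n. A \<inter> {..d n})"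
  proof -
    have "\<exists>n. a \<le> d n" if a: "a \<in> A" for a
    proof -
      obtain c where c: "c \<in> D" "a \<le> c" using D(4)[OF a] by blast
      obtain n where "from_nat_into D n = c"
        using from_nat_into_surj[OF D(1) c(1)] by blast
      then have "c \<le> d n" unfolding d_def by (intro Max_ge) auto
      with c show ?thesis by (intro exI[of _ n]) linarith
    qed
    then show ?thesis by auto
  qed
  then have "emeasure lborel A = emeasure lborel (\<Union>n. A \<inter> {..d n})" by (rule arg_cong)
  also have "\<dots> = (SUP n. emeasure lborel (A \<inter> {..d n}))"
  proof (rule SUP_emeasure_incseq[symmetric])
    show "incseq (\<lambda>n. A \<inter> {..d n})"
      using \<open>incseq d\<close> unfolding incseq_def by (fastforce dest: order_trans)
  qed (use A in auto)
  also have "\<dots> \<le> (SUP a\<in>A. emeasure lborel (A \<inter> {..a}))"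
    by (rule SUP_least) (rule SUP_upper[OF dA])
  finally show "emeasure lborel A \<le> (SUP a\<in>A. emeasure lborel (A \<inter> {..a}))" .
  show "(SUP a\<in>A. emeasure lborel (A \<inter> {..a})) \<le> emeasure lborel A"
    using A by (intro SUP_least emeasure_mono) auto
qed

lemma emeasure_lborel_translate:
  fixes A :: "real set"
  assumes "A \<in> sets borel"
  shows "emeasure lborel ((\<lambda>x. x - c) -` A) = emeasure lborel A"
proof -
  have "emeasure lborel A = emeasure (distr lborel borel ((+) (-c))) A"
    using lborel_distr_plus[of "-c"] by simp
  also have "\<dots> = emeasure lborel ((+) (-c) -` A)"
    using assms by (subst emeasure_distr) auto
  also have "(+) (-c) -` A = (\<lambda>x. x - c) -` A" by (auto simp: algebra_simps)
  finally show ?thesis by simp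
qed

lemma emeasure_lborel_uminus:
  fixes A :: "real set"
  assumes "A \<in> sets borel"
  shows "emeasure lborel (uminus -` A) = emeasure lborel A"
proof -
  have "emeasure lborel A = emeasure (distr lborel borel uminus) A"
    using lborel_distr_uminus by simp
  also have "\<dots> = emeasure lborel (uminus -` A)"
    using assms by (subst emeasure_distr) auto
  finally show ?thesis by simp
qed

lemma emeasure_lborel_scale2:
  fixes A :: "real set"
  assumes "A \<in> sets borel"
  shows "emeasure lborel ((\<lambda>x. x / 2) -` A) = 2 * emeasure lborel A"
proof -
  have [measurable]: "A \<in> sets borel" "((\<lambda>x. x / 2) -` A) \<in> sets borel"
    using assms measurable_sets[of "\<lambda>x. x/2" borel borel A] by auto
  have "emeasure lborel ((\<lambda>x. x / 2) -` A) = (\<integral>\<^sup>+x. indicator ((\<lambda>x. x / 2) -` A) x \<partial>lborel)"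
    by simp
  also have "\<dots> = 2 * (\<integral>\<^sup>+x. indicator ((\<lambda>x. x / 2) -` A) (0 + 2 * x) \<partial>lborel)"
    by (subst nn_integral_real_affine[where c=2 and t=0]) auto
  also have "(\<integral>\<^sup>+x. indicator ((\<lambda>x. x / 2) -` A) (0 + 2 * x) \<partial>lborel) = (\<integral>\<^sup>+x. indicator A x \<partial>lborel)"
    by (intro nn_integral_cong) (auto simp: indicator_def)
  finally show ?thesis by simp
qed

text \<open>For \<open>a \<in> A\<close> and \<open>b \<in> B\<close>, translate the part of
  \<open>A\<close> below \<open>a\<close> by \<open>b\<close> and the part of \<open>B\<close> above
  \<open>b\<close> by \<open>a\<close>. Both translates lie in twice \<open>C\<close>, one on each
  side of \<open>a + b\<close>, so they overlap at most in this point. Taking suprema over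
  \<open>a\<close> and \<open>b\<close> exhausts \<open>A\<close> and \<open>B\<close> without any
  compactness or regularity.\<close>

lemma brunn_minkowski_real:
  fixes A B C :: "real set"
  assumes [measurable]: "A \<in> sets borel" "B \<in> sets borel" "C \<in> sets borel"
    and ne: "A \<noteq> {}" "B \<noteq> {}"
    and sub: "\<And>a b. a \<in> A \<Longrightarrow> b \<in> B \<Longrightarrow> (a + b) / 2 \<in> C"
  shows "emeasure lborel A + emeasure lborel B \<le> 2 * emeasure lborel C"
proof -
  have meas: "(\<lambda>x. x - c) -` S \<in> sets borel" if "S \<in> sets borel" for S :: "real set" and c
    using measurable_sets[of "\<lambda>x. x-c" borel borel S] that by auto
  have B': "uminus -` B \<in> sets borel"
    using measurable_sets[of uminus borel borel B] by auto
  have 1: "emeasure lborel (A \<inter> {..a}) + emeasure lborel (B \<inter> {b..}) \<le> 2 * emeasure lborel C"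
    if ab: "a \<in> A" "b \<in> B" for a b
  proof -
    let ?A = "(\<lambda>x. x - b) -` (A \<inter> {..a})" and ?B = "(\<lambda>x. x - a) -` (B \<inter> {b..})"
    have "emeasure lborel (A \<inter> {..a}) + emeasure lborel (B \<inter> {b..}) = emeasure lborel ?A + emeasure lborel ?B"
      using emeasure_lborel_translate[of "A \<inter> {..a}" b] emeasure_lborel_translate[of "B \<inter> {b..}" a] by simp
    also have "\<dots> = emeasure lborel (?A - {a+b}) + emeasure lborel ?B"
      by (subst emeasure_Diff_null_set) (auto intro: meas)
    also have "\<dots> = emeasure lborel ((?A - {a+b}) \<union> ?B)"
      by (rule plus_emeasure) (auto intro!: meas)
    also have "\<dots> \<le> emeasure lborel ((\<lambda>x. x / 2) -` C)"
    proof (rule emeasure_mono)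
      show "(?A - {a+b}) \<union> ?B \<subseteq> (\<lambda>x. x / 2) -` C"
      proof
        fix x assume "x \<in> (?A - {a+b}) \<union> ?B"
        then consider "x - b \<in> A" | "x - a \<in> B" by auto
        then show "x \<in> (\<lambda>x. x / 2) -` C"
          using sub[of "x - b" b] sub[of a "x - a"] ab by cases auto
      qed
      show "(\<lambda>x. x / 2) -` C \<in> sets lborel"
        using measurable_sets[of "\<lambda>x. x/2" borel borel C] by auto
    qed
    finally show ?thesis by (simp add: emeasure_lborel_scale2)
  qed
  have 2: "emeasure lborel A + emeasure lborel (B \<inter> {b..}) \<le> 2 * emeasure lborel C" if "b \<in> B" for b
    unfolding emeasure_eq_SUP_atMost[OF assms(1) ne(1)]
    by (subst ennreal_SUP_add_left[symmetric]) (use ne 1 that in \<open>auto intro!: SUP_least\<close>)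
  \<comment> \<open>Exhausting \<open>B\<close> by its upper parts is the exhaustion of the
    reflected set by its lower parts.\<close>
  have "emeasure lborel B = emeasure lborel (uminus -` B)"
    by (simp add: emeasure_lborel_uminus)
  also have "\<dots> = (SUP b\<in>uminus -` B. emeasure lborel ((uminus -` B) \<inter> {..b}))"
  proof (intro emeasure_eq_SUP_atMost B')
    obtain b where "b \<in> B" using ne by blast
    then have "- b \<in> uminus -` B" by simp
    then show "uminus -` B \<noteq> {}" by blast
  qed
  also have "\<dots> = (SUP b\<in>B. emeasure lborel (B \<inter> {b..}))"
  proof -
    have e: "uminus -` B = uminus ` B" by (auto simp: image_iff) (metis minus_minus)
    have "emeasure lborel ((uminus -` B) \<inter> {..-b}) = emeasure lborel (B \<inter> {b..})" for b
    proof -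
      have "(uminus -` B) \<inter> {..-b} = uminus -` (B \<inter> {b..})" by auto
      then show ?thesis using emeasure_lborel_uminus[of "B \<inter> {b..}"] by simp
    qed
    then show ?thesis unfolding e by (simp add: image_image)
  qed
  finally have 3: "emeasure lborel B = (SUP b\<in>B. emeasure lborel (B \<inter> {b..}))" .
  show ?thesis
    unfolding 3 by (subst ennreal_SUP_add_right) (use ne 2 in \<open>auto intro!: SUP_least\<close>)
qed


section \<open>Layer cake formula and the functional inequality on the line\<close>

lemma nn_integral_layer_cake:
  assumes [measurable]: "sigma_finite_measure M" "f \<in> borel_measurable M"
  shows "(\<integral>\<^sup>+x. f x \<partial>M) = (\<integral>\<^sup>+u. emeasure M {x\<in>space M. ennreal u < f x} * indicator {0..} u \<partial>lborel)"
proof -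
  interpret sigma_finite_measure M by fact
  interpret P: pair_sigma_finite M "lborel :: real measure" ..
  have "(\<integral>\<^sup>+u. indicator {u. 0 \<le> u \<and> ennreal u < f x} u \<partial>lborel) = f x" for x
  proof (cases "f x")
    case (real r)
    then have "{u. 0 \<le> u \<and> ennreal u < f x} = {0..<r}"
      by (auto simp: ennreal_less_iff)
    then show ?thesis using real by simp
  next
    case top
    then have *: "{u. 0 \<le> u \<and> ennreal u < f x} = {0..}" by auto
    have "emeasure lborel {0::real..} = \<infinity>"
    proof (rule ccontr)
      assume "emeasure lborel {0::real..} \<noteq> \<infinity>"
      then obtain c where c: "emeasure lborel {0::real..} = ennreal c" "c \<ge> 0"
        by (metis infinity_ennreal_def ennreal_cases)
      have "emeasure lborel {0..c+1} \<le> emeasure lborel {0::real..}"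
        by (rule emeasure_mono) auto
      then show False using c by (simp del: ennreal_plus)
    qed
    then show ?thesis unfolding * using top by simp
  qed
  then have "(\<integral>\<^sup>+x. f x \<partial>M) = (\<integral>\<^sup>+x. (\<integral>\<^sup>+u. indicator {u. 0 \<le> u \<and> ennreal u < f x} u \<partial>lborel) \<partial>M)"
    by simp
  also have "\<dots> = (\<integral>\<^sup>+u. (\<integral>\<^sup>+x. indicator {u. 0 \<le> u \<and> ennreal u < f x} u \<partial>M) \<partial>lborel)"
  proof (rule P.Fubini'[symmetric])
    have "{z \<in> space (M \<Otimes>\<^sub>M (lborel :: real measure)). 0 \<le> snd z \<and> ennreal (snd z) < f (fst z)} \<in> sets (M \<Otimes>\<^sub>M lborel)"
      by measurable
    then have "(\<lambda>z. indicator {z \<in> space (M \<Otimes>\<^sub>M (lborel :: real measure)). 0 \<le> snd z \<and> ennreal (snd z) < f (fst z)} z :: ennreal)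
        \<in> borel_measurable (M \<Otimes>\<^sub>M lborel)"
      by measurable
    then show "(\<lambda>(x, u). indicator {u. 0 \<le> u \<and> ennreal u < f x} u :: ennreal) \<in> borel_measurable (M \<Otimes>\<^sub>M (lborel :: real measure))"
      by (rule measurable_cong[THEN iffD1, rotated]) (auto simp: indicator_def space_pair_measure)
  qed
  also have "\<dots> = (\<integral>\<^sup>+u. emeasure M {x\<in>space M. ennreal u < f x} * indicator {0..} u \<partial>lborel)"
  proof (rule nn_integral_cong)
    fix u :: real
    have "(\<integral>\<^sup>+x. indicator {u. 0 \<le> u \<and> ennreal u < f x} u \<partial>M) = (\<integral>\<^sup>+x. indicator {x\<in>space M. ennreal u < f x} x * indicator {0..} u \<partial>M)"
      by (intro nn_integral_cong) (auto simp: indicator_def)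
    also have "\<dots> = emeasure M {x\<in>space M. ennreal u < f x} * indicator {0..} u"
      by (subst nn_integral_multc) auto
    finally show "(\<integral>\<^sup>+x. indicator {u. 0 \<le> u \<and> ennreal u < f x} u \<partial>M) = emeasure M {x\<in>space M. ennreal u < f x} * indicator {0..} u" .
  qed
  finally show ?thesis .
qed

text \<open>Supremum 1 for both functions means that at every level \<open>u < 1\<close> both
  superlevel sets are nonempty, as the one-dimensional Brunn--Minkowski inequality requires, while
  at levels \<open>u \<ge> 1\<close> both are empty. The hypothesis sends midpoints of the two
  superlevel sets into that of \<kappa>, and integration over the levels gives the bound, even in
  additive form.\<close>

lemma prekopa_leindler_real_normalized:
  fixes \<phi> \<psi> \<kappa> :: "real \<Rightarrow> ennreal"
  assumes [measurable]: "\<phi> \<in> borel_measurable borel" "\<psi> \<in> borel_measurable borel" "\<kappa> \<in> borel_measurable borel"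
    and le: "\<And>a. \<phi> a \<le> 1" "\<And>a. \<psi> a \<le> 1"
    and sup: "\<And>u. u < 1 \<Longrightarrow> \<exists>a. u < \<phi> a" "\<And>u. u < 1 \<Longrightarrow> \<exists>a. u < \<psi> a"
    and PL: "\<And>a b. \<phi> a * \<psi> b \<le> (\<kappa> ((a + b) / 2))\<^sup>2"
  shows "(\<integral>\<^sup>+x. \<phi> x \<partial>lborel) + (\<integral>\<^sup>+x. \<psi> x \<partial>lborel) \<le> 2 * (\<integral>\<^sup>+x. \<kappa> x \<partial>lborel)"
proof -
  have LC: "(\<integral>\<^sup>+x. f x \<partial>lborel) = (\<integral>\<^sup>+u. emeasure lborel {x. ennreal u < f x} * indicator {0..} u \<partial>lborel)"
    if "f \<in> borel_measurable borel" for f :: "real \<Rightarrow> ennreal"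
    using nn_integral_layer_cake[OF lborel.sigma_finite_measure_axioms, of f] that by simp
  have [measurable]: "(\<lambda>u. emeasure lborel {x. ennreal u < f x}) \<in> borel_measurable lborel"
    if [measurable]: "f \<in> borel_measurable borel" for f :: "real \<Rightarrow> ennreal"
  proof -
    have "{z \<in> space (lborel \<Otimes>\<^sub>M lborel). ennreal (fst z) < f (snd z)} \<in> sets ((lborel::real measure) \<Otimes>\<^sub>M (lborel::real measure))"
      by measurable
    from lborel.measurable_emeasure_Pair[OF this]
    show ?thesis by (simp add: space_pair_measure vimage_def)
  qed
  have *: "emeasure lborel {x. ennreal u < \<phi> x} + emeasure lborel {x. ennreal u < \<psi> x} \<le> 2 * emeasure lborel {x. ennreal u < \<kappa> x}"
    if u: "u \<ge> 0" for u
  proof (cases "u < 1")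
    case True
    then have u1: "ennreal u < 1" using u by (simp add: ennreal_less_one_iff)
    show ?thesis
    proof (rule brunn_minkowski_real)
      show "{x. ennreal u < \<phi> x} \<noteq> {}" "{x. ennreal u < \<psi> x} \<noteq> {}"
        using sup u1 by auto
      fix a b assume ab: "a \<in> {x. ennreal u < \<phi> x}" "b \<in> {x. ennreal u < \<psi> x}"
      show "(a + b) / 2 \<in> {x. ennreal u < \<kappa> x}"
      proof (rule ccontr)
        assume "(a + b) / 2 \<notin> {x. ennreal u < \<kappa> x}"
        then have "\<kappa> ((a+b)/2) \<le> ennreal u" by (simp add: not_less)
        then have "(\<kappa> ((a+b)/2))\<^sup>2 \<le> (ennreal u)\<^sup>2" by (intro power_mono) auto
        then have 1: "\<phi> a * \<psi> b \<le> ennreal (u\<^sup>2)" using PL[of a b] u by (simp add: ennreal_power)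
        obtain x where x: "\<phi> a = ennreal x" "x \<ge> 0" using le(1)[of a] by (cases "\<phi> a") (auto simp: top_unique)
        obtain y where y: "\<psi> b = ennreal y" "y \<ge> 0" using le(2)[of b] by (cases "\<psi> b") (auto simp: top_unique)
        have xy: "u < x" "u < y" using ab x y u by (auto simp: ennreal_less_iff)
        have "x * y \<le> u\<^sup>2" using 1 x y u by (simp add: ennreal_mult[symmetric])
        moreover have "u * u < x * y" using xy u by (intro mult_strict_mono) auto
        ultimately show False by (simp add: power2_eq_square)
      qed
    qed measurable
  next
    case False
    then have "1 \<le> ennreal u" by (simp add: ennreal_1[symmetric] del: ennreal_1)
    then have "\<phi> x \<le> ennreal u" "\<psi> x \<le> ennreal u" for x
      using order_trans[OF le(1)] order_trans[OF le(2)] by blast+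
    then have "{x. ennreal u < \<phi> x} = {}" "{x. ennreal u < \<psi> x} = {}"
      by (auto simp: not_less)
    then show ?thesis by simp
  qed
  have "(\<integral>\<^sup>+x. \<phi> x \<partial>lborel) + (\<integral>\<^sup>+x. \<psi> x \<partial>lborel) =
      (\<integral>\<^sup>+u. emeasure lborel {x. ennreal u < \<phi> x} * indicator {0..} u + emeasure lborel {x. ennreal u < \<psi> x} * indicator {0..} u \<partial>lborel)"
    unfolding LC[OF assms(1)] LC[OF assms(2)] by (rule nn_integral_add[symmetric]) measurable
  also have "\<dots> \<le> (\<integral>\<^sup>+u. 2 * (emeasure lborel {x. ennreal u < \<kappa> x} * indicator {0..} u) \<partial>lborel)"
    using * by (intro nn_integral_mono) (auto simp: indicator_def)
  also have "\<dots> = 2 * (\<integral>\<^sup>+x. \<kappa> x \<partial>lborel)"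
    unfolding LC[OF assms(3)] by (rule nn_integral_cmult) measurable
  finally show ?thesis .
qed

lemma less_divide_ennreal:
  fixes a b c :: ennreal
  assumes "a * c < b" "c < \<infinity>" "c \<noteq> 0"
  shows "a < b / c"
proof (rule ccontr)
  assume "\<not> a < b / c"
  then have "b / c * c \<le> a * c" by (intro mult_right_mono) auto
  moreover have "b / c * c = b" using assms by (simp add: ennreal_divide_times ennreal_divide_self)
  ultimately show False using assms by simp
qed

text \<open>Divide \<phi> and \<psi> by their suprema \<open>M\<close> and \<open>N\<close>, and
  \<kappa> by the root of \<open>M * N\<close>, to reach the normalised case. The bound
  \<open>C\<close> on \<kappa> gives \<open>M * N \<le> C\<^sup>2\<close>, so both suprema are
  finite unless one of them is 0, in which case that function vanishes.\<close>

lemma prekopa_leindler_real: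
  fixes \<phi> \<psi> \<kappa> :: "real \<Rightarrow> ennreal"
  assumes [measurable]: "\<phi> \<in> borel_measurable borel" "\<psi> \<in> borel_measurable borel" "\<kappa> \<in> borel_measurable borel"
    and bdd: "C < \<infinity>" "\<And>a. \<kappa> a \<le> C"
    and PL: "\<And>a b. \<phi> a * \<psi> b \<le> (\<kappa> ((a + b) / 2))\<^sup>2"
  shows "(\<integral>\<^sup>+x. \<phi> x \<partial>lborel) * (\<integral>\<^sup>+x. \<psi> x \<partial>lborel) \<le> (\<integral>\<^sup>+x. \<kappa> x \<partial>lborel)\<^sup>2"
proof -
  define M where "M = (SUP a. \<phi> a)"
  define N where "N = (SUP a. \<psi> a)"
  have MN: "M * N \<le> C\<^sup>2"
    unfolding M_def N_def SUP_mult_right_ennreal SUP_mult_left_ennreal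
    by (intro SUP_least order_trans[OF PL] power_mono bdd) auto
  have "\<phi> a \<le> M" "\<psi> a \<le> N" for a unfolding M_def N_def by (auto intro: SUP_upper)
  note le = this
  show ?thesis
  proof (cases "M = 0 \<or> N = 0")
    case True
    then have "(\<forall>a. \<phi> a = 0) \<or> (\<forall>a. \<psi> a = 0)" using le by (metis le_zero_eq)
    then show ?thesis by auto
  next
    case False
    have "C\<^sup>2 < \<infinity>" using bdd by (simp add: power2_eq_square ennreal_mult_less_top)
    then have "M * N < \<infinity>" using MN by (rule le_less_trans[rotated])
    then have "M < \<infinity>" "N < \<infinity>" using False by (auto simp: ennreal_mult_less_top)
    then obtain m n where m: "M = ennreal m" "m > 0" and n: "N = ennreal n" "n > 0"
      using False by (cases M; cases N) (auto simp: less_le)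
    have *: "(\<integral>\<^sup>+x. \<phi> x / M \<partial>lborel) + (\<integral>\<^sup>+x. \<psi> x / N \<partial>lborel) \<le> 2 * (\<integral>\<^sup>+x. \<kappa> x / ennreal (sqrt (m * n)) \<partial>lborel)"
    proof (rule prekopa_leindler_real_normalized)
      show "\<phi> a / M \<le> 1" "\<psi> a / N \<le> 1" for a
        using le[of a] m n by (auto simp: divide_le_posI_ennreal)
      show "\<exists>a. u < \<phi> a / M" if "u < 1" for u
      proof -
        have "u * M < 1 * M" using that m by (subst ennreal_mult_strict_right_mono) auto
        then obtain a where "u * M < \<phi> a" unfolding M_def by (auto simp: less_SUP_iff)
        then show ?thesis using less_divide_ennreal m by (intro exI[of _ a]) auto
      qed
      show "\<exists>a. u < \<psi> a / N" if "u < 1" for u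
      proof -
        have "u * N < 1 * N" using that n by (subst ennreal_mult_strict_right_mono) auto
        then obtain a where "u * N < \<psi> a" unfolding N_def by (auto simp: less_SUP_iff)
        then show ?thesis using less_divide_ennreal n by (intro exI[of _ a]) auto
      qed
      fix a b
      have "\<phi> a / M * (\<psi> b / N) = (\<phi> a * \<psi> b) / ennreal (m * n)"
        using m n by (simp add: divide_ennreal_def ennreal_mult ennreal_inverse_mult mult_ac)
      also have "\<dots> \<le> (\<kappa> ((a + b) / 2))\<^sup>2 / ennreal (m * n)"
        by (intro divide_right_mono_ennreal PL)
      also have "\<dots> = (\<kappa> ((a + b) / 2) / ennreal (sqrt (m * n)))\<^sup>2"
        using m n by (simp add: divide_ennreal_def power_mult_distrib inverse_ennreal ennreal_power power_inverse)
      finally show "\<phi> a / M * (\<psi> b / N) \<le> (\<kappa> ((a + b) / 2) / ennreal (sqrt (m * n)))\<^sup>2" .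
    qed measurable
    define X where "X = (\<integral>\<^sup>+x. \<phi> x \<partial>lborel)"
    define Y where "Y = (\<integral>\<^sup>+x. \<psi> x \<partial>lborel)"
    define Z where "Z = (\<integral>\<^sup>+x. \<kappa> x \<partial>lborel)"
    have **: "X / ennreal m + Y / ennreal n \<le> 2 * (Z / ennreal (sqrt (m * n)))"
      using * unfolding X_def Y_def Z_def m(1) n(1) by (simp add: nn_integral_divide)
    show ?thesis
    proof (cases Z)
      case top
      then show ?thesis unfolding Z_def by (simp add: power2_eq_square)
    next
      case (real z)
      have "2 * (Z / ennreal (sqrt (m * n))) = ennreal (2 * z / sqrt (m*n))"
        using real m n by (simp add: divide_ennreal ennreal_mult[symmetric] numeral_mult_ennreal)
      note **[unfolded this]
      then have "X / ennreal m + Y / ennreal n < top"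
        using ennreal_less_top le_less_trans by blast
      then have "X \<noteq> top" "Y \<noteq> top" using m n by (auto simp: ennreal_top_divide)
      then obtain x y where x: "X = ennreal x" "x \<ge> 0" and y: "Y = ennreal y" "y \<ge> 0"
        by (metis ennreal_cases)
      have "x / m + y / n \<le> 2 * z / sqrt (m*n)"
        using ** real x y m n \<open>2 * (Z / ennreal (sqrt (m * n))) = ennreal (2 * z / sqrt (m*n))\<close>
        by (simp add: divide_ennreal ennreal_plus[symmetric] del: ennreal_plus)
      then have "(x / m + y / n)\<^sup>2 \<le> (2 * z / sqrt (m*n))\<^sup>2"
        using x y m n by (intro power_mono) auto
      also have "\<dots> = 4 * z\<^sup>2 / (m * n)" using m n by (simp add: power_divide power_mult_distrib)
      finally have 1: "(x / m + y / n)\<^sup>2 \<le> 4 * z\<^sup>2 / (m * n)" .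
      \<comment> \<open>The arithmetic-geometric mean inequality turns the additive bound into the
        product bound; the normalising constants cancel.\<close>
      have "4 * (x / m) * (y / n) \<le> (x / m + y / n)\<^sup>2"
        using zero_le_power2[of "x / m - y / n"] by (simp add: power2_sum power2_diff)
      then have "4 * (x * y) / (m * n) \<le> 4 * z\<^sup>2 / (m * n)" using 1 by simp
      then have "x * y \<le> z\<^sup>2" using m n by (simp add: divide_le_cancel)
      then show ?thesis unfolding X_def[symmetric] Y_def[symmetric] Z_def[symmetric] x y real
        using x y real by (simp add: ennreal_mult[symmetric] ennreal_power)
    qed
  qed
qed


section \<open>The multiplicative form on the half-line\<close>

lemma nn_integral_exp_substitution:
  fixes f :: "real \<Rightarrow> ennreal"
  assumes [measurable]: "f \<in> borel_measurable borel"
  shows "(\<integral>\<^sup>+x. f x * indicator {0<..} x \<partial>lborel) = (\<integral>\<^sup>+a. f (exp a) * ennreal (exp a) \<partial>lborel)"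
proof -
  have 1: "(\<integral>\<^sup>+x. f x * indicator {exp (- real (Suc n))..exp (real (Suc n))} x \<partial>lborel) =
        (\<integral>\<^sup>+a. f (exp a) * ennreal (exp a) * indicator {- real (Suc n)..real (Suc n)} a \<partial>lborel)" for n
    by (rule nn_integral_substitution_aux) (auto intro!: derivative_eq_intros continuous_intros)
  have ind1: "incseq (\<lambda>n x. f x * indicator {exp (- real (Suc n))..exp (real (Suc n))} x)"
  proof (intro incseq_SucI le_funI mult_left_mono)
    fix n x
    show "indicator {exp (- real (Suc n))..exp (real (Suc n))} x \<le> (indicator {exp (- real (Suc (Suc n)))..exp (real (Suc (Suc n)))} x :: ennreal)"
    proof (rule indicator_leI)
      assume "x \<in> {exp (- real (Suc n))..exp (real (Suc n))}"
      moreover have "exp (- real (Suc (Suc n))) \<le> exp (- real (Suc n))" "exp (real (Suc n)) \<le> exp (real (Suc (Suc n)))" by auto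
      ultimately show "x \<in> {exp (- real (Suc (Suc n)))..exp (real (Suc (Suc n)))}" unfolding atLeastAtMost_iff by linarith
    qed
  qed simp
  have ind2: "incseq (\<lambda>n a. f (exp a) * ennreal (exp a) * indicator {- real (Suc n)..real (Suc n)} a)"
    by (intro incseq_SucI le_funI mult_left_mono indicator_leI) auto
  have sup1: "(SUP n. f x * indicator {exp (- real (Suc n))..exp (real (Suc n))} x) = f x * indicator {0<..} x" for x
  proof (cases "x > 0")
    case True
    obtain n where n: "\<bar>ln x\<bar> \<le> real n" using real_arch_simple by blast
    then have "exp (- real (Suc n)) \<le> exp (ln x)" "exp (ln x) \<le> exp (real (Suc n))" unfolding exp_le_cancel_iff by auto
    then have "f x * indicator {0<..} x \<le> f x * indicator {exp (- real (Suc n))..exp (real (Suc n))} x" using True by simp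
    then show ?thesis using True
      by (intro antisym SUP_least) (auto simp: indicator_def intro: SUP_upper2[of n])
  next
    case False
    have "x \<notin> {exp (- real (Suc n))..exp (real (Suc n))}" for n
      using False exp_gt_zero[of "- real (Suc n)"] unfolding atLeastAtMost_iff by linarith
    then show ?thesis using False by simp
  qed
  have sup2: "(SUP n. f (exp a) * ennreal (exp a) * indicator {- real (Suc n)..real (Suc n)} a) = f (exp a) * ennreal (exp a)" for a
  proof -
    obtain n where n: "\<bar>a\<bar> \<le> real n" using real_arch_simple by blast
    then show ?thesis
      by (intro antisym SUP_least) (auto simp: indicator_def intro!: SUP_upper2[of n])
  qed
  have "(\<integral>\<^sup>+x. f x * indicator {0<..} x \<partial>lborel) = (\<integral>\<^sup>+x. (SUP n. f x * indicator {exp (- real (Suc n))..exp (real (Suc n))} x) \<partial>lborel)"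
    by (simp only: sup1)
  also have "\<dots> = (SUP n. (\<integral>\<^sup>+x. f x * indicator {exp (- real (Suc n))..exp (real (Suc n))} x \<partial>lborel))"
    by (rule nn_integral_monotone_convergence_SUP[OF ind1]) measurable
  also have "\<dots> = (SUP n. (\<integral>\<^sup>+a. f (exp a) * ennreal (exp a) * indicator {- real (Suc n)..real (Suc n)} a \<partial>lborel))"
    by (simp only: 1)
  also have "\<dots> = (\<integral>\<^sup>+a. (SUP n. f (exp a) * ennreal (exp a) * indicator {- real (Suc n)..real (Suc n)} a) \<partial>lborel)"
    by (rule nn_integral_monotone_convergence_SUP[OF ind2, symmetric]) measurable
  finally show ?thesis by (simp only: sup2)
qed

definition half_gaussian :: ennreal where
  "half_gaussian = (\<integral>\<^sup>+r. ennreal (exp (- r\<^sup>2 / 2)) * indicator {0<..} r \<partial>lborel)"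

text \<open>The substitution \<open>s = exp a\<close>, \<open>t = exp b\<close> turns the geometric
  mean of \<open>s\<close> and \<open>t\<close> into the exponential of the midpoint of
  \<open>a\<close> and \<open>b\<close>, and the Jacobians \<open>exp a * exp b\<close> form the
  square of the Jacobian at the midpoint. Hence Prekopa--Leindler applies with \<kappa> the Gaussian
  in the new variable, which is bounded by 1 because \<open>2 * c \<le> exp (2 * c)\<close>.\<close>

lemma polar_half_line:
  fixes \<phi> \<psi> :: "real \<Rightarrow> ennreal"
  assumes [measurable]: "\<phi> \<in> borel_measurable borel" "\<psi> \<in> borel_measurable borel"
    and le: "\<And>s t. s > 0 \<Longrightarrow> t > 0 \<Longrightarrow> \<phi> s * \<psi> t \<le> ennreal (exp (- (s * t)))"
  shows "(\<integral>\<^sup>+s. \<phi> s * indicator {0<..} s \<partial>lborel) * (\<integral>\<^sup>+t. \<psi> t * indicator {0<..} t \<partial>lborel) \<le> half_gaussian\<^sup>2"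
proof -
  define \<kappa> where "\<kappa> c = ennreal (exp (- (exp c)\<^sup>2 / 2)) * ennreal (exp c)" for c :: real
  have [measurable]: "\<kappa> \<in> borel_measurable borel" unfolding \<kappa>_def by measurable
  have half: "half_gaussian = (\<integral>\<^sup>+c. \<kappa> c \<partial>lborel)"
    unfolding half_gaussian_def \<kappa>_def by (rule nn_integral_exp_substitution) measurable
  show ?thesis
    unfolding half nn_integral_exp_substitution[OF assms(1)] nn_integral_exp_substitution[OF assms(2)]
  proof (rule prekopa_leindler_real[where C=1])
    fix c :: real
    have "exp c \<le> exp ((exp c)\<^sup>2 / 2)"
    proof -
      have "2 * c \<le> (exp c)\<^sup>2"
        using exp_ge_add_one_self[of "2 * c"] exp_double[of c] by linarith
      then show ?thesis by simp
    qed
    then have "exp (- (exp c)\<^sup>2 / 2) * exp c \<le> exp (- (exp c)\<^sup>2 / 2) * exp ((exp c)\<^sup>2 / 2)"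
      by (intro mult_left_mono) auto
    also have "\<dots> = 1" by (simp add: exp_minus field_simps flip: exp_add)
    finally have "exp (- (exp c)\<^sup>2 / 2) * exp c \<le> 1" .
    then show "\<kappa> c \<le> 1" unfolding \<kappa>_def by (simp add: ennreal_mult[symmetric])
  next
    fix a b :: real
    have 1: "exp a * exp b = (exp ((a + b) / 2))\<^sup>2"
      by (simp add: exp_double[symmetric] exp_add[symmetric])
    have "\<phi> (exp a) * ennreal (exp a) * (\<psi> (exp b) * ennreal (exp b)) = (\<phi> (exp a) * \<psi> (exp b)) * ennreal (exp a * exp b)"
      by (simp add: ennreal_mult mult_ac)
    also have "\<dots> \<le> ennreal (exp (- (exp a * exp b))) * ennreal (exp a * exp b)"
      by (intro mult_right_mono le) auto
    also have "\<dots> = ennreal (exp (- (exp ((a + b) / 2))\<^sup>2) * (exp ((a + b) / 2))\<^sup>2)"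
      unfolding 1 by (simp add: ennreal_mult)
    also have "\<dots> = (\<kappa> ((a + b) / 2))\<^sup>2"
      unfolding \<kappa>_def by (simp add: ennreal_mult[symmetric] ennreal_power power_mult_distrib flip: exp_double)
    finally show "\<phi> (exp a) * ennreal (exp a) * (\<psi> (exp b) * ennreal (exp b)) \<le> (\<kappa> ((a + b) / 2))\<^sup>2" .
  qed auto
qed

section \<open>Products of Lebesgue measure and hyperplane sections\<close>

abbreviation lborel_PiM :: "'i set \<Rightarrow> ('i \<Rightarrow> real) measure" where
  "lborel_PiM I \<equiv> PiM I (\<lambda>_. lborel)"

interpretation lborel_PiM: product_sigma_finite "\<lambda>_. lborel :: real measure" ..

lemma measurable_PiM_restrict [measurable]:
  assumes "\<And>i. i \<in> I \<Longrightarrow> (\<lambda>x. h x i) \<in> borel_measurable M"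
  shows "(\<lambda>x. \<lambda>i\<in>I. h x i) \<in> measurable M (lborel_PiM I)"
  using assms by (intro measurable_restrict) simp

lemma borel_measurable_PiM_component:
  "i \<in> I \<Longrightarrow> (\<lambda>x. x i) \<in> borel_measurable (lborel_PiM I)"
  using measurable_component_singleton[of i I "\<lambda>_. lborel :: real measure"] by simp

lemma nn_integral_lborel_translate:
  fixes f :: "real \<Rightarrow> ennreal"
  assumes "f \<in> borel_measurable borel"
  shows "(\<integral>\<^sup>+y. f (y + c) \<partial>lborel) = (\<integral>\<^sup>+y. f y \<partial>lborel)"
  using nn_integral_real_affine[OF assms, of 1 c] by (simp add: add.commute)

lemma nn_integral_PiM_translate:
  assumes "finite I" "f \<in> borel_measurable (lborel_PiM I)"
  shows "(\<integral>\<^sup>+x. f (\<lambda>i\<in>I. x i + c i) \<partial>lborel_PiM I) = (\<integral>\<^sup>+x. f x \<partial>lborel_PiM I)"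
  using assms
proof (induction I arbitrary: f rule: finite_induct)
  case empty
  then show ?case
    by (intro nn_integral_cong) (auto simp: space_PiM PiE_def extensional_def intro!: arg_cong[where f=f])
next
  case (insert j I)
  note [measurable] = insert.prems
  note [measurable] = borel_measurable_PiM_component
  have upd: "(\<lambda>p. (fst p)(j := snd p)) \<in> measurable (lborel_PiM I \<Otimes>\<^sub>M lborel) (lborel_PiM (insert j I))"
    using measurable_add_dim[of j I "\<lambda>_. lborel :: real measure"] by (simp add: case_prod_beta')
  have m1[measurable]: "(\<lambda>x. \<integral>\<^sup>+y. f (x(j := y)) \<partial>lborel) \<in> borel_measurable (lborel_PiM I)"
    using lborel.borel_measurable_nn_integral_fst[OF measurable_compose[OF upd insert.prems]] by simp
  have m2[measurable]: "(\<lambda>x. f (\<lambda>i\<in>insert j I. x i + c i)) \<in> borel_measurable (lborel_PiM (insert j I))"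
    by (rule measurable_compose[OF measurable_PiM_restrict insert.prems]) measurable
  have "(\<integral>\<^sup>+x. f (\<lambda>i\<in>insert j I. x i + c i) \<partial>lborel_PiM (insert j I)) =
     (\<integral>\<^sup>+x. \<integral>\<^sup>+y. f (\<lambda>i\<in>insert j I. (x(j := y)) i + c i) \<partial>lborel \<partial>lborel_PiM I)"
    using insert.hyps by (subst lborel_PiM.product_nn_integral_insert) auto
  also have "\<dots> = (\<integral>\<^sup>+x. \<integral>\<^sup>+y. f ((\<lambda>i\<in>I. x i + c i)(j := y + c j)) \<partial>lborel \<partial>lborel_PiM I)"
  proof -
    have "(\<lambda>i\<in>insert j I. (x(j := y)) i + c i) = (\<lambda>i\<in>I. x i + c i)(j := y + c j)" for x y
      using insert.hyps by (auto simp: fun_eq_iff)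
    then show ?thesis by (simp only:)
  qed
  also have "\<dots> = (\<integral>\<^sup>+x. \<integral>\<^sup>+y. f ((\<lambda>i\<in>I. x i + c i)(j := y)) \<partial>lborel \<partial>lborel_PiM I)"
  proof (rule nn_integral_cong)
    fix x assume "x \<in> space (lborel_PiM I)"
    have "(\<lambda>y. f ((\<lambda>i\<in>I. x i + c i)(j := y))) \<in> borel_measurable lborel"
      by (rule measurable_compose[OF measurable_component_update insert.prems])
        (use insert.hyps in \<open>auto simp: space_PiM\<close>)
    then show "(\<integral>\<^sup>+y. f ((\<lambda>i\<in>I. x i + c i)(j := y + c j)) \<partial>lborel) = (\<integral>\<^sup>+y. f ((\<lambda>i\<in>I. x i + c i)(j := y)) \<partial>lborel)"
      by (intro nn_integral_lborel_translate) simp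
  qed
  also have "\<dots> = (\<integral>\<^sup>+x. \<integral>\<^sup>+y. f (x(j := y)) \<partial>lborel \<partial>lborel_PiM I)"
    by (rule insert.IH[OF m1])
  also have "\<dots> = (\<integral>\<^sup>+x. f x \<partial>lborel_PiM (insert j I))"
    using insert.hyps by (subst lborel_PiM.product_nn_integral_insert) auto
  finally show ?case .
qed

text \<open>The affine coordinates \<open>(y, s)\<close> on a half space bounded by \<open>x n = a\<close> (which one is decided by
  \<open>\<epsilon> = 1\<close> or \<open>\<epsilon> = -1\<close>) that are adapted to the line through \<open>(z, a)\<close> with direction \<open>(w, 1)\<close>.\<close>

definition shear :: "'i set \<Rightarrow> 'i \<Rightarrow> ('i \<Rightarrow> real) \<Rightarrow> real \<Rightarrow> ('i \<Rightarrow> real) \<Rightarrow> real \<Rightarrow> ('i \<Rightarrow> real) \<Rightarrow> real \<Rightarrow> 'i \<Rightarrow> real" where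
  "shear I n z a w \<epsilon> y s = (\<lambda>i\<in>insert n I. if i = n then a + \<epsilon> * s else z i + y i + \<epsilon> * s * w i)"

lemma measurable_shear:
  assumes "n \<notin> I"
  shows "(\<lambda>p. shear I n z a w \<epsilon> (fst p) (snd p)) \<in> measurable (lborel_PiM I \<Otimes>\<^sub>M lborel) (lborel_PiM (insert n I))"
  unfolding shear_def
proof (rule measurable_PiM_restrict)
  fix i assume "i \<in> insert n I"
  show "(\<lambda>p. if i = n then a + \<epsilon> * snd p else z i + fst p i + \<epsilon> * snd p * w i) \<in> borel_measurable (lborel_PiM I \<Otimes>\<^sub>M lborel)"
  proof (cases "i = n")
    case False
    then have "i \<in> I" using \<open>i \<in> insert n I\<close> by simp
    then have [measurable]: "(\<lambda>p. fst p i) \<in> borel_measurable (lborel_PiM I \<Otimes>\<^sub>M (lborel :: real measure))"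
      by (rule measurable_compose[OF measurable_fst borel_measurable_PiM_component])
    show ?thesis using False by simp
  qed simp
qed

text \<open>The Jacobian is 1: for fixed \<open>s\<close> the map
  \<open>y \<mapsto> shear I n z a w \<epsilon> y s\<close> is a translation of the coordinates in
  \<open>I\<close>, and the coordinate \<open>n\<close> depends on \<open>s\<close> alone, by a
  translation or a reflection.\<close>

lemma nn_integral_shear:
  assumes I: "finite I" "n \<notin> I" and [measurable]: "U \<in> borel_measurable (lborel_PiM (insert n I))"
    and \<epsilon>: "\<bar>\<epsilon>\<bar> = 1"
  shows "(\<integral>\<^sup>+y. \<integral>\<^sup>+s. U (shear I n z a w \<epsilon> y s) * indicator {0<..} s \<partial>lborel \<partial>lborel_PiM I) =
    (\<integral>\<^sup>+x. U x * indicator {0<..} (\<epsilon> * (x n - a)) \<partial>lborel_PiM (insert n I))"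
proof -
  interpret P: pair_sigma_finite "lborel_PiM I" "lborel :: real measure"
    by (intro pair_sigma_finite.intro lborel_PiM.sigma_finite I lborel.sigma_finite_measure_axioms)
  note [measurable] = measurable_shear[OF I(2)] borel_measurable_PiM_component
  have upd[measurable]: "(\<lambda>p. (fst p)(n := snd p)) \<in> measurable (lborel_PiM I \<Otimes>\<^sub>M lborel) (lborel_PiM (insert n I))"
    using measurable_add_dim[of n I "\<lambda>_. lborel :: real measure"] by (simp add: case_prod_beta')
  have [measurable]: "(\<lambda>p. U ((fst p)(n := snd p))) \<in> borel_measurable (lborel_PiM I \<Otimes>\<^sub>M lborel)"
    by (rule measurable_compose[OF upd assms(3)])
  have ee: "\<epsilon> * \<epsilon> = 1" using \<epsilon> by (cases "\<epsilon> \<ge> 0") auto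
  have "(\<integral>\<^sup>+y. \<integral>\<^sup>+s. U (shear I n z a w \<epsilon> y s) * indicator {0<..} s \<partial>lborel \<partial>lborel_PiM I) =
      (\<integral>\<^sup>+s. \<integral>\<^sup>+y. U (shear I n z a w \<epsilon> y s) * indicator {0<..} s \<partial>lborel_PiM I \<partial>lborel)"
    by (rule P.Fubini'[symmetric]) (simp add: case_prod_beta')
  also have "\<dots> = (\<integral>\<^sup>+s. \<integral>\<^sup>+y. U (y(n := a + \<epsilon> * s)) * indicator {0<..} s \<partial>lborel_PiM I \<partial>lborel)"
  proof (rule nn_integral_cong)
    fix s :: real
    let ?V = "\<lambda>y. U (y(n := a + \<epsilon> * s)) * indicator {0<..} s"
    have "?V \<in> borel_measurable (lborel_PiM I)"
      by (intro borel_measurable_times_ennreal measurable_compose[OF measurable_fun_upd assms(3)])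
         auto
    from nn_integral_PiM_translate[OF I(1) this, of "\<lambda>i. z i + \<epsilon> * s * w i"]
    have "(\<integral>\<^sup>+x. ?V (\<lambda>i\<in>I. x i + (z i + \<epsilon> * s * w i)) \<partial>lborel_PiM I) = integral\<^sup>N (lborel_PiM I) ?V" .
    moreover have "(\<lambda>i\<in>I. x i + (z i + \<epsilon> * s * w i))(n := a + \<epsilon> * s) = shear I n z a w \<epsilon> x s" for x
      using I(2) by (auto simp: shear_def fun_eq_iff)
    ultimately show "(\<integral>\<^sup>+y. U (shear I n z a w \<epsilon> y s) * indicator {0<..} s \<partial>lborel_PiM I) = (\<integral>\<^sup>+y. ?V y \<partial>lborel_PiM I)"
      by simp
  qed
  also have "\<dots> = (\<integral>\<^sup>+s. \<integral>\<^sup>+y. U (y(n := s)) * indicator {0<..} (\<epsilon> * (s - a)) \<partial>lborel_PiM I \<partial>lborel)"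
  proof -
    let ?W = "\<lambda>s. \<integral>\<^sup>+y. U (y(n := s)) * indicator {0<..} (\<epsilon> * (s - a)) \<partial>lborel_PiM I"
    have [measurable]: "?W \<in> borel_measurable borel"
    proof (rule P.M1.borel_measurable_nn_integral)
      have "(\<lambda>q. (\<lambda>p. U ((fst p)(n := snd p)) * indicator {0<..} (\<epsilon> * (snd p - a))) (snd q, fst q)) \<in> borel_measurable (borel \<Otimes>\<^sub>M lborel_PiM I)"
        by (rule measurable_compose[of "\<lambda>q. (snd q, fst q)" _ "lborel_PiM I \<Otimes>\<^sub>M lborel"]) measurable
      then show "(\<lambda>(s, y). U (y(n := s)) * indicator {0<..} (\<epsilon> * (s - a))) \<in> borel_measurable (borel \<Otimes>\<^sub>M lborel_PiM I)"
        by (simp add: case_prod_beta')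
    qed
    have "(\<integral>\<^sup>+s. ?W s \<partial>lborel) = (\<integral>\<^sup>+s. ?W (a + \<epsilon> * s) \<partial>lborel)"
      using nn_integral_real_affine[of ?W \<epsilon> a] \<epsilon> by auto
    also have "\<dots> = (\<integral>\<^sup>+s. \<integral>\<^sup>+y. U (y(n := a + \<epsilon> * s)) * indicator {0<..} s \<partial>lborel_PiM I \<partial>lborel)"
      by (simp add: mult.assoc[symmetric] ee)
    finally show ?thesis by simp
  qed
  also have "\<dots> = (\<integral>\<^sup>+x. U x * indicator {0<..} (\<epsilon> * (x n - a)) \<partial>lborel_PiM (insert n I))"
    by (subst lborel_PiM.product_nn_integral_insert_rev[OF I]) simp_all
  finally show ?thesis .
qed

text \<open>The coordinates dual to \<open>shear\<close>: up to the sign \<epsilon>,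
  \<open>t\<close> is the pairing of \<open>x\<close> with the direction (w, 1) of the line. With
  these coordinates the pairing of a displacement \<open>(y, s)\<close> with \<open>(x, t)\<close>
  becomes \<open>s * t\<close> plus the pairing of \<open>y\<close> and \<open>x\<close> over
  \<open>I\<close>.\<close>

lemma nn_integral_dual_shear:
  assumes I: "finite I" "n \<notin> I" and [measurable]: "f \<in> borel_measurable (lborel_PiM (insert n I))"
    and \<epsilon>: "\<bar>\<epsilon>\<bar> = 1"
  shows "(\<integral>\<^sup>+x. \<integral>\<^sup>+t. f (x(n := \<epsilon> * t - (\<Sum>i\<in>I. w i * x i))) * indicator {0<..} t \<partial>lborel \<partial>lborel_PiM I) =
    (\<integral>\<^sup>+x. f x * indicator {0<..} (\<epsilon> * (x n + (\<Sum>i\<in>I. w i * x i))) \<partial>lborel_PiM (insert n I))"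
proof -
  have ee: "\<epsilon> * \<epsilon> = 1" using \<epsilon> by (cases "\<epsilon> \<ge> 0") auto
  have [measurable]: "(\<lambda>x. \<Sum>i\<in>I. w i * x i) \<in> borel_measurable (lborel_PiM (insert n I))"
    by (intro borel_measurable_sum borel_measurable_times borel_measurable_PiM_component) auto
  have [measurable]: "(\<lambda>x. x n) \<in> borel_measurable (lborel_PiM (insert n I))"
    by (intro borel_measurable_PiM_component) auto
  have "(\<integral>\<^sup>+x. f x * indicator {0<..} (\<epsilon> * (x n + (\<Sum>i\<in>I. w i * x i))) \<partial>lborel_PiM (insert n I)) =
     (\<integral>\<^sup>+x. \<integral>\<^sup>+t. f (x(n := t)) * indicator {0<..} (\<epsilon> * (t + (\<Sum>i\<in>I. w i * x i))) \<partial>lborel \<partial>lborel_PiM I)"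
  proof (subst lborel_PiM.product_nn_integral_insert[OF I])
    have "(\<Sum>i\<in>I. w i * (x(n := y)) i) = (\<Sum>i\<in>I. w i * x i)" for x y
      using I(2) by (intro sum.cong) auto
    then show "(\<integral>\<^sup>+x. \<integral>\<^sup>+y. f (x(n := y)) * indicator {0<..} (\<epsilon> * ((x(n := y)) n + (\<Sum>i\<in>I. w i * (x(n := y)) i))) \<partial>lborel \<partial>lborel_PiM I) =
       (\<integral>\<^sup>+x. \<integral>\<^sup>+t. f (x(n := t)) * indicator {0<..} (\<epsilon> * (t + (\<Sum>i\<in>I. w i * x i))) \<partial>lborel \<partial>lborel_PiM I)"
      by simp
  qed measurable
  also have "\<dots> = (\<integral>\<^sup>+x. \<integral>\<^sup>+t. f (x(n := \<epsilon> * t - (\<Sum>i\<in>I. w i * x i))) * indicator {0<..} t \<partial>lborel \<partial>lborel_PiM I)"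
  proof (rule nn_integral_cong)
    fix x assume x: "x \<in> space (lborel_PiM I)"
    let ?c = "\<Sum>i\<in>I. w i * x i"
    let ?W = "\<lambda>t. f (x(n := t)) * indicator {0<..} (\<epsilon> * (t + ?c))"
    have "(\<lambda>y. f (x(n := y))) \<in> borel_measurable lborel"
      by (rule measurable_compose[OF measurable_component_update assms(3)])
        (use I x in \<open>auto simp: space_PiM\<close>)
    then have [measurable]: "(\<lambda>y. f (x(n := y))) \<in> borel_measurable borel" by simp
    have "(\<integral>\<^sup>+t. ?W t \<partial>lborel) = (\<integral>\<^sup>+t. ?W (- ?c + \<epsilon> * t) \<partial>lborel)"
      using nn_integral_real_affine[of ?W \<epsilon> "- ?c"] \<epsilon> by auto
    also have "\<dots> = (\<integral>\<^sup>+t. f (x(n := \<epsilon> * t - ?c)) * indicator {0<..} t \<partial>lborel)"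
      by (simp add: mult.assoc[symmetric] ee)
    finally show "(\<integral>\<^sup>+t. ?W t \<partial>lborel) = (\<integral>\<^sup>+t. f (x(n := \<epsilon> * t - ?c)) * indicator {0<..} t \<partial>lborel)" .
  qed
  finally show ?thesis by simp
qed


section \<open>Moments, the Gaussian constant and the half-space estimate\<close>

text \<open>Vanishing first moments are expressed by the integrals of positive and negative parts,
  so that they can be carried through changes of variables for nonnegative integrals without
  separate integrability arguments.\<close>

lemma centred_iff_nn_integral:
  fixes u :: "'a \<Rightarrow> real"
  shows "integrable M u \<and> integral\<^sup>L M u = 0 \<longleftrightarrow>
    u \<in> borel_measurable M \<and> (\<integral>\<^sup>+x. ennreal (u x) \<partial>M) < \<infinity> \<and> (\<integral>\<^sup>+x. ennreal (- u x) \<partial>M) = (\<integral>\<^sup>+x. ennreal (u x) \<partial>M)"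
  (is "?L \<longleftrightarrow> ?R")
proof
  assume L: ?L
  then have "(\<integral>\<^sup>+x. ennreal (u x) \<partial>M) \<noteq> \<infinity>" "(\<integral>\<^sup>+x. ennreal (- u x) \<partial>M) \<noteq> \<infinity>"
    by (auto simp: real_integrable_def)
  moreover have "enn2real (\<integral>\<^sup>+x. ennreal (u x) \<partial>M) = enn2real (\<integral>\<^sup>+x. ennreal (- u x) \<partial>M)"
    using L real_lebesgue_integral_def[of M u] by simp
  ultimately show ?R using L
    by (metis borel_measurable_integrable ennreal_enn2real_if infinity_ennreal_def top.not_eq_extremum)
next
  assume R: ?R
  then have "integrable M u" by (auto simp: real_integrable_def)
  with R show ?L by (simp add: real_lebesgue_integral_def)
qed

lemma nn_integral_gaussian_real: "(\<integral>\<^sup>+r. ennreal (exp (- r\<^sup>2 / 2)) \<partial>lborel) = 2 * half_gaussian"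
proof -
  let ?e = "\<lambda>r::real. ennreal (exp (- r\<^sup>2 / 2))"
  have "(\<integral>\<^sup>+r. ?e r \<partial>lborel) = (\<integral>\<^sup>+r. ?e r * indicator {0<..} r + ?e r * indicator {..<0} r \<partial>lborel)"
    using AE_lborel_singleton[of "0::real"]
    by (intro nn_integral_cong_AE) (auto elim!: eventually_mono simp: indicator_def)
  also have "\<dots> = half_gaussian + (\<integral>\<^sup>+r. ?e r * indicator {..<0} r \<partial>lborel)"
    unfolding half_gaussian_def by (rule nn_integral_add) measurable
  also have "(\<integral>\<^sup>+r. ?e r * indicator {..<0} r \<partial>lborel) = (\<integral>\<^sup>+r. ?e (0 + -1 * r) * indicator {..<0} (0 + -1 * r) \<partial>lborel)"
    by (subst nn_integral_real_affine[where c="-1" and t=0]) auto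
  also have "\<dots> = half_gaussian"
    unfolding half_gaussian_def by (intro nn_integral_cong) (auto simp: indicator_def)
  finally show ?thesis by (simp add: mult_2)
qed

lemma half_gaussian_finite: "half_gaussian < \<infinity>"
proof -
  have "integrable lborel (\<lambda>x. sqrt (2 * pi) * std_normal_density x)"
    by (intro integrable_mult_right integrable_normal_density) simp
  then have "integrable lborel (\<lambda>r::real. exp (- r\<^sup>2 / 2))"
    by (simp add: std_normal_density_def)
  then have "(\<integral>\<^sup>+r. ennreal (exp (- r\<^sup>2 / 2)) \<partial>(lborel::real measure)) < \<infinity>"
    by (simp add: real_integrable_def less_top)
  then show ?thesis unfolding nn_integral_gaussian_real
    by (auto simp: ennreal_mult_less_top)
qed

lemma half_gaussian_pos: "half_gaussian > 0"
proof (rule ccontr)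
  assume "\<not> half_gaussian > 0"
  then have "half_gaussian = 0" by (simp add: zero_less_iff_neq_zero)
  then have "AE r in lborel. ennreal (exp (- r\<^sup>2 / 2)) * indicator {0<..} r = 0"
    unfolding half_gaussian_def by (subst (asm) nn_integral_0_iff_AE) auto
  then have "AE r in lborel. r \<notin> {0<..<1::real}"
    by (elim eventually_mono) (auto simp: indicator_def split: if_splits)
  then have "emeasure lborel {0<..<1::real} = 0"
    by (subst (asm) AE_iff_measurable[of "{0<..<1}"]) auto
  then show False by simp
qed

text \<open>The constant is written with \<open>half_gaussian\<close>, the Gaussian integral over the half-line: its value is never
  needed, since it cancels against the same integral for the Euclidean ball.\<close>

definition santalo_bound :: "'i set \<Rightarrow> bool" where
  "santalo_bound I \<longleftrightarrow> (\<forall>f\<in>borel_measurable (lborel_PiM I). \<forall>g\<in>borel_measurable (lborel_PiM I).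
     (\<integral>\<^sup>+x. f x \<partial>lborel_PiM I) < \<infinity> \<longrightarrow>
     (\<forall>i\<in>I. integrable (density (lborel_PiM I) f) (\<lambda>x. x i) \<and> (LINT x|density (lborel_PiM I) f. x i) = 0) \<longrightarrow>
     (\<forall>x\<in>space (lborel_PiM I). \<forall>y\<in>space (lborel_PiM I). f x * g y \<le> ennreal (exp (- (\<Sum>i\<in>I. x i * y i)))) \<longrightarrow>
     (\<integral>\<^sup>+x. f x \<partial>lborel_PiM I) * (\<integral>\<^sup>+x. g x \<partial>lborel_PiM I) \<le> (4 * half_gaussian\<^sup>2) ^ card I)"

text \<open>Integrate out the direction of the line first: \<open>F\<close> and \<open>G\<close> are
  the integrals of \<open>g\<close> and \<open>f\<close> over half-lines in the adapted and the dual
  coordinates. As the pairing splits into \<open>s * t\<close> and a pairing over \<open>I\<close>,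
  \<open>polar_half_line\<close> bounds \<open>F y * G x\<close> by
  \<open>half_gaussian\<^sup>2\<close> times the exponential of the remaining pairing, and the
  induction hypothesis applies to \<open>F\<close> and to \<open>G\<close> divided by this constant.
  The hypothesis \<open>centred\<close> says that the half of \<open>g\<close>, projected along the
  line, has its barycentre at \<open>z\<close>, which makes \<open>F\<close> centred.\<close>

lemma santalo_half_space:
  fixes f g :: "('i \<Rightarrow> real) \<Rightarrow> ennreal"
  assumes I: "finite I" "n \<notin> I" and IH: "santalo_bound I" and \<epsilon>: "\<bar>\<epsilon>\<bar> = 1"
    and f[measurable]: "f \<in> borel_measurable (lborel_PiM (insert n I))"
    and g[measurable]: "g \<in> borel_measurable (lborel_PiM (insert n I))"
    and fin: "(\<integral>\<^sup>+x. g x \<partial>lborel_PiM (insert n I)) < \<infinity>"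
    and centred: "\<And>i. i \<in> I \<Longrightarrow> integrable (density (lborel_PiM (insert n I)) g)
                 (\<lambda>x. indicator {0<..} (\<epsilon> * (x n - a)) * (x i - z i - (x n - a) * w i))
         \<and> (LINT x|density (lborel_PiM (insert n I)) g.
                 indicator {0<..} (\<epsilon> * (x n - a)) * (x i - z i - (x n - a) * w i)) = 0"
    and dual: "\<And>x y. x \<in> space (lborel_PiM (insert n I)) \<Longrightarrow> y \<in> space (lborel_PiM (insert n I)) \<Longrightarrow>
       f x * g (\<lambda>i\<in>insert n I. (z(n := a)) i + y i) \<le> ennreal (exp (- (\<Sum>i\<in>insert n I. x i * y i)))"
  shows "(\<integral>\<^sup>+x. g x * indicator {0<..} (\<epsilon> * (x n - a)) \<partial>lborel_PiM (insert n I)) *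
         (\<integral>\<^sup>+x. f x * indicator {0<..} (\<epsilon> * (x n + (\<Sum>i\<in>I. w i * x i))) \<partial>lborel_PiM (insert n I))
         \<le> half_gaussian\<^sup>2 * (4 * half_gaussian\<^sup>2) ^ card I"
proof -
  define F where "F y = (\<integral>\<^sup>+s. g (shear I n z a w \<epsilon> y s) * indicator {0<..} s \<partial>lborel)" for y
  define G where "G x = (\<integral>\<^sup>+t. f (x(n := \<epsilon> * t - (\<Sum>i\<in>I. w i * x i))) * indicator {0<..} t \<partial>lborel)" for x
  let ?P = "lborel_PiM (insert n I)" and ?Q = "lborel_PiM I"
  have ee: "\<epsilon> * \<epsilon> = 1" using \<epsilon> by (cases "\<epsilon> \<ge> 0") auto
  note [measurable] = measurable_shear[OF I(2)]
  have comp: "(\<lambda>x. x i) \<in> borel_measurable ?P" if "i \<in> insert n I" for i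
    by (rule borel_measurable_PiM_component[OF that])
  have compn[measurable]: "(\<lambda>x. x n) \<in> borel_measurable ?P"
    by (rule comp) simp
  have intF: "(\<integral>\<^sup>+y. F y \<partial>?Q) = (\<integral>\<^sup>+x. g x * indicator {0<..} (\<epsilon> * (x n - a)) \<partial>?P)"
    unfolding F_def by (rule nn_integral_shear[OF I g \<epsilon>])
  have intG: "(\<integral>\<^sup>+x. G x \<partial>?Q) = (\<integral>\<^sup>+x. f x * indicator {0<..} (\<epsilon> * (x n + (\<Sum>i\<in>I. w i * x i))) \<partial>?P)"
    unfolding G_def by (rule nn_integral_dual_shear[OF I f \<epsilon>])
  have [measurable]: "F \<in> borel_measurable ?Q"
    unfolding F_def by (rule lborel.borel_measurable_nn_integral) (simp add: case_prod_beta')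
  have "(\<lambda>p. (fst p)(n := \<epsilon> * snd p - (\<Sum>i\<in>I. w i * fst p i))) \<in> measurable (?Q \<Otimes>\<^sub>M lborel) ?P"
  proof (rule measurable_fun_upd)
    have "(\<lambda>p. fst p i) \<in> borel_measurable (?Q \<Otimes>\<^sub>M (lborel :: real measure))" if "i \<in> I" for i
      by (rule measurable_compose[OF measurable_fst borel_measurable_PiM_component[OF that]])
    then have [measurable]: "(\<lambda>p. (\<Sum>i\<in>I. w i * fst p i)) \<in> borel_measurable (?Q \<Otimes>\<^sub>M (lborel :: real measure))"
      by (intro borel_measurable_sum borel_measurable_times) auto
    show "(\<lambda>p. \<epsilon> * snd p - (\<Sum>i\<in>I. w i * fst p i)) \<in> measurable (?Q \<Otimes>\<^sub>M lborel) lborel"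
      by measurable
  qed auto
  note upd[measurable] = measurable_compose[OF this f]
  have [measurable]: "G \<in> borel_measurable ?Q"
    unfolding G_def by (rule lborel.borel_measurable_nn_integral) (simp add: case_prod_beta')
  have FG: "F y * G x \<le> half_gaussian\<^sup>2 * ennreal (exp (- (\<Sum>i\<in>I. y i * x i)))"
    if x: "x \<in> space ?Q" and y: "y \<in> space ?Q" for x y
  proof -
    let ?c = "ennreal (exp (\<Sum>i\<in>I. y i * x i))"
    let ?X = "\<lambda>t. x(n := \<epsilon> * t - (\<Sum>i\<in>I. w i * x i))"
    have "(\<lambda>s. (\<lambda>p. shear I n z a w \<epsilon> (fst p) (snd p)) (y, s)) \<in> measurable lborel ?P"
      by (rule measurable_compose[OF measurable_Pair1'[OF y] measurable_shear[OF I(2)]])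
    then have m1[measurable]: "(\<lambda>s. g (shear I n z a w \<epsilon> y s)) \<in> borel_measurable borel"
      using measurable_compose[OF _ g] by simp
    have "(\<lambda>t. (\<lambda>p. f ((fst p)(n := \<epsilon> * snd p - (\<Sum>i\<in>I. w i * fst p i)))) (x, t)) \<in> borel_measurable lborel"
      by (rule measurable_compose[OF measurable_Pair1'[OF x] upd])
    then have m2[measurable]: "(\<lambda>t. f (?X t)) \<in> borel_measurable borel" by simp
    \<comment> \<open>The factor \<open>?c\<close> cancels the part of the pairing that does not
      depend on \<open>s\<close> and \<open>t\<close>, so that exactly
      \<open>exp (- (s * t))\<close> remains.\<close>
    have "F y * (?c * G x) = (\<integral>\<^sup>+s. g (shear I n z a w \<epsilon> y s) * indicator {0<..} s \<partial>lborel) *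
       (\<integral>\<^sup>+t. ?c * f (?X t) * indicator {0<..} t \<partial>lborel)"
      unfolding F_def G_def by (subst nn_integral_cmult[symmetric]) (auto simp: mult.assoc)
    also have "\<dots> \<le> half_gaussian\<^sup>2"
    proof (rule polar_half_line)
      fix s t :: real assume "s > 0" "t > 0"
      define Y where "Y = (\<lambda>i\<in>insert n I. if i = n then \<epsilon> * s else y i + \<epsilon> * s * w i)"
      have Y: "Y \<in> space ?P" and X: "?X t \<in> space ?P"
        using x by (auto simp: space_PiM Y_def PiE_def extensional_def)
      have sh: "shear I n z a w \<epsilon> y s = (\<lambda>i\<in>insert n I. (z(n := a)) i + Y i)"
        using I by (auto simp: shear_def Y_def fun_eq_iff)
      have "(\<Sum>i\<in>insert n I. ?X t i * Y i) = ?X t n * Y n + (\<Sum>i\<in>I. x i * (y i + \<epsilon> * s * w i))"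
        using I by (subst sum.insert) (auto simp: Y_def intro!: sum.cong)
      also have "(\<Sum>i\<in>I. x i * (y i + \<epsilon> * s * w i)) = (\<Sum>i\<in>I. y i * x i) + \<epsilon> * s * (\<Sum>i\<in>I. w i * x i)"
        by (simp add: sum.distrib sum_distrib_left algebra_simps)
      also have "?X t n * Y n = (\<epsilon> * \<epsilon>) * s * t - \<epsilon> * s * (\<Sum>i\<in>I. w i * x i)"
        unfolding Y_def by (simp add: algebra_simps)
      finally have ip: "(\<Sum>i\<in>insert n I. ?X t i * Y i) = s * t + (\<Sum>i\<in>I. y i * x i)"
        by (simp add: ee)
      have "g (shear I n z a w \<epsilon> y s) * (?c * f (?X t)) = ?c * (f (?X t) * g (\<lambda>i\<in>insert n I. (z(n := a)) i + Y i))"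
        unfolding sh by (simp add: mult_ac)
      also have "\<dots> \<le> ?c * ennreal (exp (- (s * t + (\<Sum>i\<in>I. y i * x i))))"
        using dual[OF X Y] unfolding ip by (intro mult_left_mono) auto
      also have "\<dots> = ennreal (exp (- (s * t)))"
        by (simp add: ennreal_mult[symmetric] exp_add[symmetric])
      finally show "g (shear I n z a w \<epsilon> y s) * (?c * f (?X t)) \<le> ennreal (exp (- (s * t)))" .
    qed measurable
    finally have "F y * (?c * G x) \<le> half_gaussian\<^sup>2" .
    then have "ennreal (exp (- (\<Sum>i\<in>I. y i * x i))) * (F y * (?c * G x)) \<le> ennreal (exp (- (\<Sum>i\<in>I. y i * x i))) * half_gaussian\<^sup>2"
      by (rule mult_left_mono) simp
    moreover have "ennreal (exp (- (\<Sum>i\<in>I. y i * x i))) * ?c = 1"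
      by (simp add: ennreal_mult[symmetric] exp_add[symmetric])
    then have "ennreal (exp (- (\<Sum>i\<in>I. y i * x i))) * (F y * (?c * G x)) = F y * G x"
      by (metis mult.left_commute mult.assoc mult.right_neutral)
    ultimately show ?thesis by (simp add: mult.commute)
  qed
  have finF: "(\<integral>\<^sup>+y. F y \<partial>?Q) < \<infinity>"
    unfolding intF by (rule le_less_trans[OF nn_integral_mono fin]) (auto simp: indicator_def)
  have momF: "integrable (density ?Q F) (\<lambda>y. y i) \<and> (LINT y|density ?Q F. y i) = 0" if i: "i \<in> I" for i
  proof -
    have [measurable]: "(\<lambda>x. x i) \<in> borel_measurable ?P" "(\<lambda>x. x i) \<in> borel_measurable ?Q"
      using i by (auto intro: borel_measurable_PiM_component)
    have ni: "i \<noteq> n" using i I by auto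
    let ?h = "\<lambda>x. indicator {0<..} (\<epsilon> * (x n - a)) * (x i - z i - (x n - a) * w i)"
    \<comment> \<open>The signs \<sigma> = 1 and \<sigma> = -1 give the positive and the negative
      part of the moment.\<close>
    have pos: "(\<integral>\<^sup>+y. ennreal (\<sigma> * y i) \<partial>density ?Q F) = (\<integral>\<^sup>+x. ennreal (\<sigma> * ?h x) \<partial>density ?P g)" for \<sigma> :: real
    proof -
      let ?U = "\<lambda>x. g x * ennreal (\<sigma> * (x i - z i - (x n - a) * w i))"
      have "(\<integral>\<^sup>+y. ennreal (\<sigma> * y i) \<partial>density ?Q F) = (\<integral>\<^sup>+y. F y * ennreal (\<sigma> * y i) \<partial>?Q)"
        by (rule nn_integral_density) measurable
      also have "\<dots> = (\<integral>\<^sup>+y. \<integral>\<^sup>+s. ?U (shear I n z a w \<epsilon> y s) * indicator {0<..} s \<partial>lborel \<partial>?Q)"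
      proof (rule nn_integral_cong)
        fix y assume y: "y \<in> space ?Q"
        have "(\<lambda>s. (\<lambda>p. shear I n z a w \<epsilon> (fst p) (snd p)) (y, s)) \<in> measurable lborel ?P"
          by (rule measurable_compose[OF measurable_Pair1'[OF y] measurable_shear[OF I(2)]])
        then have m1[measurable]: "(\<lambda>s. g (shear I n z a w \<epsilon> y s)) \<in> borel_measurable borel"
          using measurable_compose[OF _ g] by simp
        have *: "shear I n z a w \<epsilon> y s i - z i - (shear I n z a w \<epsilon> y s n - a) * w i = y i" for s
          using i ni by (simp add: shear_def algebra_simps)
        show "F y * ennreal (\<sigma> * y i) = (\<integral>\<^sup>+s. ?U (shear I n z a w \<epsilon> y s) * indicator {0<..} s \<partial>lborel)"
          unfolding * F_def by (subst nn_integral_multc[symmetric]) (auto simp: mult_ac)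
      qed
      also have "\<dots> = (\<integral>\<^sup>+x. ?U x * indicator {0<..} (\<epsilon> * (x n - a)) \<partial>?P)"
        by (rule nn_integral_shear[OF I _ \<epsilon>]) measurable
      also have "\<dots> = (\<integral>\<^sup>+x. g x * ennreal (\<sigma> * ?h x) \<partial>?P)"
        by (intro nn_integral_cong) (auto simp: indicator_def)
      also have "\<dots> = (\<integral>\<^sup>+x. ennreal (\<sigma> * ?h x) \<partial>density ?P g)"
        by (rule nn_integral_density[symmetric]) measurable
      finally show ?thesis .
    qed
    show ?thesis
      using centred[OF i] pos[of 1] pos[of "-1"] unfolding centred_iff_nn_integral by simp
  qed
  define c where "c = inverse (half_gaussian\<^sup>2)"
  have hc: "half_gaussian\<^sup>2 * c = 1"
    unfolding c_def divide_ennreal_def[symmetric] using half_gaussian_pos half_gaussian_finite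
    by (intro ennreal_divide_self) (auto simp: power2_eq_square ennreal_mult_less_top)
  have "(\<integral>\<^sup>+y. F y \<partial>?Q) * (\<integral>\<^sup>+x. c * G x \<partial>?Q) \<le> (4 * half_gaussian\<^sup>2) ^ card I"
  proof -
    have "F x * (c * G y) \<le> ennreal (exp (- (\<Sum>i\<in>I. x i * y i)))" if "x \<in> space ?Q" "y \<in> space ?Q" for x y
    proof -
      have "F x * (c * G y) = c * (F x * G y)" by (simp add: mult_ac)
      also have "\<dots> \<le> c * (half_gaussian\<^sup>2 * ennreal (exp (- (\<Sum>i\<in>I. x i * y i))))"
        by (intro mult_left_mono FG that) simp
      also have "\<dots> = (half_gaussian\<^sup>2 * c) * ennreal (exp (- (\<Sum>i\<in>I. x i * y i)))" by (simp add: mult_ac)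
      finally show ?thesis by (simp add: hc)
    qed
    moreover have "(\<lambda>x. c * G x) \<in> borel_measurable ?Q" by measurable
    ultimately show ?thesis
      using IH[unfolded santalo_bound_def, rule_format, of F "\<lambda>x. c * G x"] finF momF by simp
  qed
  also have "(\<integral>\<^sup>+x. c * G x \<partial>?Q) = c * (\<integral>\<^sup>+x. G x \<partial>?Q)"
    by (rule nn_integral_cmult) measurable
  finally have "half_gaussian\<^sup>2 * ((\<integral>\<^sup>+y. F y \<partial>?Q) * (c * (\<integral>\<^sup>+x. G x \<partial>?Q))) \<le> half_gaussian\<^sup>2 * (4 * half_gaussian\<^sup>2) ^ card I"
    by (rule mult_left_mono) simp
  moreover have "half_gaussian\<^sup>2 * ((\<integral>\<^sup>+y. F y \<partial>?Q) * (c * (\<integral>\<^sup>+x. G x \<partial>?Q))) = (half_gaussian\<^sup>2 * c) * ((\<integral>\<^sup>+y. F y \<partial>?Q) * (\<integral>\<^sup>+x. G x \<partial>?Q))"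
    by (simp only: mult_ac)
  ultimately show ?thesis unfolding intF[symmetric] intG[symmetric] hc by simp
qed

section \<open>Lehec's functional Santalo inequality\<close>

lemma AE_lborel_PiM_affine:
  assumes I: "finite I" "n \<notin> I"
  shows "AE x in lborel_PiM (insert n I). x n + (\<Sum>i\<in>I. w i * x i) \<noteq> a"
proof -
  let ?P = "lborel_PiM (insert n I)"
  have [measurable]: "(\<lambda>x. x i) \<in> borel_measurable ?P" if "i \<in> insert n I" for i
    by (rule borel_measurable_PiM_component[OF that])
  have [measurable]: "(\<lambda>x. x n + (\<Sum>i\<in>I. w i * x i)) \<in> borel_measurable ?P" by simp
  have "(\<integral>\<^sup>+x. indicator {a} (x n + (\<Sum>i\<in>I. w i * x i)) \<partial>?P) =
    (\<integral>\<^sup>+x. \<integral>\<^sup>+t. indicator {a} ((x(n := t)) n + (\<Sum>i\<in>I. w i * (x(n := t)) i)) \<partial>lborel \<partial>lborel_PiM I)"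
    by (rule lborel_PiM.product_nn_integral_insert[OF I]) measurable
  also have "\<dots> = (\<integral>\<^sup>+x. \<integral>\<^sup>+t. indicator {a - (\<Sum>i\<in>I. w i * x i)} t \<partial>lborel \<partial>lborel_PiM I)"
  proof (intro nn_integral_cong)
    fix x and t :: real
    have "(\<Sum>i\<in>I. w i * (x(n := t)) i) = (\<Sum>i\<in>I. w i * x i)"
      using I(2) by (intro sum.cong) auto
    then show "indicator {a} ((x(n := t)) n + (\<Sum>i\<in>I. w i * (x(n := t)) i)) = (indicator {a - (\<Sum>i\<in>I. w i * x i)} t :: ennreal)"
      by (auto simp: indicator_def)
  qed
  also have "\<dots> = 0" by simp
  finally have "AE x in ?P. indicator {a} (x n + (\<Sum>i\<in>I. w i * x i)) = (0 :: ennreal)"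
    by (subst (asm) nn_integral_0_iff_AE) auto
  then show ?thesis by (rule eventually_mono) (auto simp: indicator_def)
qed

text \<open>Without atoms the distribution function of \<open>u\<close> is continuous, so it takes
  the value half of the total mass.\<close>

lemma bisecting_value:
  fixes u :: "'a \<Rightarrow> real"
  assumes M: "finite_measure M" and [measurable]: "u \<in> borel_measurable M"
    and no_atom: "\<And>a. AE x in M. u x \<noteq> a" and pos: "measure M (space M) > 0"
  obtains a where "measure M {x\<in>space M. u x < a} = measure M (space M) / 2"
    "measure M {x\<in>space M. u x > a} = measure M (space M) / 2"
proof -
  interpret finite_measure M by fact
  define N where "N = distr M borel u"
  interpret N: finite_borel_measure N
    unfolding N_def by (intro finite_borel_measure.intro finite_borel_measure_axioms.intro finite_measure_distr) auto
  have spN: "measure N (space N) = measure M (space M)"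
    unfolding N_def by (subst measure_distr) auto
  have meas: "measure N A = measure M {x\<in>space M. u x \<in> A}" if "A \<in> sets borel" for A
    unfolding N_def using that by (subst measure_distr) (auto simp: vimage_def Int_def conj_commute)
  have null: "measure M {x\<in>space M. u x = a} = 0" for a
    using no_atom[of a] by (intro measure_eq_0_null_sets) (simp add: AE_iff_null)
  have cont: "isCont (cdf N) a" for a
    using null[of a] by (subst N.isCont_cdf) (simp add: meas)
  have "(cdf N \<longlongrightarrow> measure M (space M)) at_top" using N.cdf_lim_at_top by (simp add: spN)
  then have "\<forall>\<^sub>F x in at_top. cdf N x > measure M (space M) / 2"
    using pos by (intro order_tendstoD) auto
  then obtain t1 where t1: "cdf N t1 > measure M (space M) / 2"
    using eventually_happens trivial_limit_at_top_linorder by blast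
  have "\<forall>\<^sub>F x in at_bot. cdf N x < measure M (space M) / 2"
    using N.cdf_lim_at_bot pos by (intro order_tendstoD) auto
  then obtain t0 where t0: "cdf N t0 < measure M (space M) / 2"
    using eventually_happens trivial_limit_at_bot_linorder by blast
  have "t0 \<le> t1" using t0 t1 N.cdf_nondecreasing[of t1 t0] by linarith
  then obtain a where a: "cdf N a = measure M (space M) / 2"
    using IVT[of "cdf N" t0 "measure M (space M) / 2" t1] t0 t1 cont by auto
  have "measure M {x\<in>space M. u x \<le> a} = measure M (space M) / 2"
    using a meas[of "{..a}"] by (simp add: cdf_def)
  moreover have "measure M {x\<in>space M. u x \<le> a} = measure M {x\<in>space M. u x < a} + measure M {x\<in>space M. u x = a}"
    by (subst finite_measure_Union[symmetric]) (auto intro!: arg_cong[where f="measure M"])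
  moreover have "measure M (space M) = measure M {x\<in>space M. u x \<le> a} + measure M {x\<in>space M. u x > a}"
    by (subst finite_measure_Union[symmetric]) (auto intro!: arg_cong[where f="measure M"])
  ultimately show ?thesis using null[of a] by (intro that[of a]) auto
qed

text \<open>With the bisecting hyperplane \<open>x n = a\<close> and the line through the barycentres of the two halves of \<open>g\<close>,
  both halves become centred after projection along the line; \<open>z\<close> is the point where the line meets the hyperplane.\<close>

lemma santalo_point:
  fixes g :: "('i \<Rightarrow> real) \<Rightarrow> ennreal"
  assumes I: "finite I" "n \<notin> I" and IH: "santalo_bound I"
    and g[measurable]: "g \<in> borel_measurable (lborel_PiM (insert n I))"
    and fin: "(\<integral>\<^sup>+x. g x \<partial>lborel_PiM (insert n I)) < \<infinity>" and pos: "(\<integral>\<^sup>+x. g x \<partial>lborel_PiM (insert n I)) > 0"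
    and mom: "\<And>i. i \<in> insert n I \<Longrightarrow> integrable (density (lborel_PiM (insert n I)) g) (\<lambda>x. x i)"
  obtains z where "\<And>f. f \<in> borel_measurable (lborel_PiM (insert n I)) \<Longrightarrow>
     (\<And>x y. x \<in> space (lborel_PiM (insert n I)) \<Longrightarrow> y \<in> space (lborel_PiM (insert n I)) \<Longrightarrow>
       f x * g (\<lambda>i\<in>insert n I. z i + y i) \<le> ennreal (exp (- (\<Sum>i\<in>insert n I. x i * y i)))) \<Longrightarrow>
     (\<integral>\<^sup>+x. g x \<partial>lborel_PiM (insert n I)) * (\<integral>\<^sup>+x. f x \<partial>lborel_PiM (insert n I)) \<le> (4 * half_gaussian\<^sup>2) ^ Suc (card I)"
proof -
  let ?P = "lborel_PiM (insert n I)"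
  define M where "M = density ?P g"
  have [measurable]: "(\<lambda>x. x i) \<in> borel_measurable ?P" if "i \<in> insert n I" for i
    by (rule borel_measurable_PiM_component[OF that])
  have sM[simp]: "sets M = sets ?P" "space M = space ?P" by (auto simp: M_def)
  have [measurable]: "(\<lambda>x. x i) \<in> borel_measurable M" if "i \<in> insert n I" for i
    unfolding M_def using that by simp
  have em: "emeasure M (space M) = (\<integral>\<^sup>+x. g x \<partial>?P)"
    unfolding sM M_def by (subst emeasure_density) (auto intro!: nn_integral_cong)
  interpret finite_measure M
    by (rule finite_measureI) (use fin em in simp)
  have emm: "(\<integral>\<^sup>+x. g x \<partial>?P) = ennreal (measure M (space M))"
    unfolding em[symmetric] by (rule emeasure_eq_measure)
  then have mpos: "measure M (space M) > 0" using pos by simp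
  have noatom: "AE x in M. x n \<noteq> a" for a
    unfolding M_def using AE_lborel_PiM_affine[OF I, of "\<lambda>_. 0" a]
    by (subst AE_density) auto
  obtain a where a: "measure M {x\<in>space M. x n < a} = measure M (space M) / 2"
    "measure M {x\<in>space M. x n > a} = measure M (space M) / 2"
    by (rule bisecting_value[OF finite_measure_axioms, of "\<lambda>x. x n"]) (use noatom mpos in auto)
  define m where "m = measure M (space M) / 2"
  have m: "m > 0" using mpos by (simp add: m_def)
  define H where "H \<epsilon> x = (indicator {0<..} (\<epsilon> * (x n - a)) :: real)" for \<epsilon> and x :: "'i \<Rightarrow> real"
  have [measurable]: "H \<epsilon> \<in> borel_measurable M" for \<epsilon> unfolding H_def by measurable
  have mint: "integrable M (\<lambda>x. x i)" if "i \<in> insert n I" for i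
    unfolding M_def by (rule mom[OF that])
  have Hint: "integrable M (\<lambda>x. H \<epsilon> x * u x)" if "integrable M u" for \<epsilon> u
    by (rule Bochner_Integration.integrable_bound[OF that]) (use that in \<open>auto simp: H_def indicator_def\<close>)
  have Hm: "LINT x|M. H \<epsilon> x = m" if "\<epsilon> = 1 \<or> \<epsilon> = -1" for \<epsilon>
  proof -
    have "LINT x|M. H \<epsilon> x = LINT x|M. indicator {x\<in>space M. 0 < \<epsilon> * (x n - a)} x"
      by (intro Bochner_Integration.integral_cong) (auto simp: H_def indicator_def)
    also have "\<dots> = measure M {x\<in>space M. 0 < \<epsilon> * (x n - a)}" by (auto simp: Int_absorb1)
    also have "\<dots> = m" using that a unfolding m_def by auto
    finally show ?thesis .
  qed
  define c where "c \<epsilon> = (LINT x|M. H \<epsilon> x * (x n - a))" for \<epsilon>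
  define \<beta> where "\<beta> \<epsilon> i = (LINT x|M. H \<epsilon> x * x i)" for \<epsilon> i
  have nint: "integrable M (\<lambda>x. x n - a)" using mint by simp
  \<comment> \<open>The difference of the two moments normal to the hyperplane is the integral of
    \<open>\<bar>x n - a\<bar>\<close>, which is positive since the hyperplane is a null set. Hence
    the line joining the barycentres is not parallel to the hyperplane, and the slope
    \<open>w\<close> exists.\<close>
  have cpos: "c 1 - c (-1) > 0"
  proof -
    have "c 1 - c (-1) = LINT x|M. H 1 x * (x n - a) - H (-1) x * (x n - a)"
      unfolding c_def by (intro Bochner_Integration.integral_diff[symmetric] Hint nint)
    also have "\<dots> = LINT x|M. \<bar>x n - a\<bar>"
      by (intro Bochner_Integration.integral_cong) (auto simp: H_def indicator_def)
    finally have *: "c 1 - c (-1) = (LINT x|M. \<bar>x n - a\<bar>)" .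
    have "(LINT x|M. \<bar>x n - a\<bar>) \<noteq> 0"
    proof
      assume "(LINT x|M. \<bar>x n - a\<bar>) = 0"
      then have "AE x in M. \<bar>x n - a\<bar> = 0"
        using nint by (subst (asm) integral_nonneg_eq_0_iff_AE) auto
      then have "AE x in M. False" using noatom[of a] by eventually_elim auto
      then show False using mpos by (simp add: AE_iff_null null_sets_def emeasure_eq_measure)
    qed
    moreover have "(LINT x|M. \<bar>x n - a\<bar>) \<ge> 0" by simp
    ultimately show ?thesis using * by linarith
  qed
  \<comment> \<open>\<open>\<beta> \<epsilon>\<close> and \<open>c \<epsilon>\<close> are moments
    without normalisation; since both halves have the same mass \<open>m\<close>, their differences
    are proportional to the vector joining the barycentres. The point \<open>z\<close> can be
    computed from either half, as the line passes through both barycentres.\<close>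
  define w where "w i = (\<beta> 1 i - \<beta> (-1) i) / (c 1 - c (-1))" for i
  define z where "z i = (\<beta> 1 i - c 1 * w i) / m" for i
  have z2: "z i = (\<beta> (-1) i - c (-1) * w i) / m" for i
  proof -
    have "\<beta> 1 i - \<beta> (-1) i = w i * (c 1 - c (-1))" using cpos by (simp add: w_def)
    then have "\<beta> 1 i - c 1 * w i = \<beta> (-1) i - c (-1) * w i" by (simp add: algebra_simps)
    then show ?thesis by (simp add: z_def)
  qed
  have centred: "integrable M (\<lambda>x. H \<epsilon> x * (x i - z i - (x n - a) * w i)) \<and>
      (LINT x|M. H \<epsilon> x * (x i - z i - (x n - a) * w i)) = 0" if \<epsilon>: "\<epsilon> = 1 \<or> \<epsilon> = -1" and i: "i \<in> I" for \<epsilon> i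
  proof
    have 1: "integrable M (\<lambda>x. H \<epsilon> x * x i)" using i by (intro Hint mint) auto
    have 2: "integrable M (\<lambda>x. H \<epsilon> x)" using Hint[of "\<lambda>_. 1"] by simp
    have 3: "integrable M (\<lambda>x. H \<epsilon> x * (x n - a))" by (intro Hint nint)
    have eq: "H \<epsilon> x * (x i - z i - (x n - a) * w i) = H \<epsilon> x * x i - z i * H \<epsilon> x - w i * (H \<epsilon> x * (x n - a))" for x
      by (simp add: algebra_simps)
    show "integrable M (\<lambda>x. H \<epsilon> x * (x i - z i - (x n - a) * w i))"
      unfolding eq by (intro Bochner_Integration.integrable_diff integrable_mult_right 1 2 3)
    have "(LINT x|M. H \<epsilon> x * (x i - z i - (x n - a) * w i)) = \<beta> \<epsilon> i - z i * m - w i * c \<epsilon>"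
      unfolding eq using 1 2 3 Hm[OF \<epsilon>] by (simp add: \<beta>_def c_def)
    also have "\<dots> = 0" using \<epsilon> m z2[of i] z_def[of i] by (auto simp: field_simps)
    finally show "(LINT x|M. H \<epsilon> x * (x i - z i - (x n - a) * w i)) = 0" .
  qed
  have half: "(\<integral>\<^sup>+x. g x * indicator {0<..} (\<epsilon> * (x n - a)) \<partial>?P) = ennreal m" if \<epsilon>: "\<epsilon> = 1 \<or> \<epsilon> = -1" for \<epsilon>
  proof -
    have "(\<integral>\<^sup>+x. g x * indicator {0<..} (\<epsilon> * (x n - a)) \<partial>?P) = (\<integral>\<^sup>+x. indicator {0<..} (\<epsilon> * (x n - a)) \<partial>M)"
      unfolding M_def by (rule nn_integral_density[symmetric]) measurable
    also have "\<dots> = (\<integral>\<^sup>+x. ennreal (H \<epsilon> x) \<partial>M)"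
      by (intro nn_integral_cong) (auto simp: H_def indicator_def)
    also have "\<dots> = ennreal m"
      unfolding Hm[OF \<epsilon>, symmetric] using Hint[of "\<lambda>_. 1" \<epsilon>]
      by (intro nn_integral_eq_integral) (auto simp: H_def)
    finally show ?thesis .
  qed
  show thesis
  proof (rule that[of "z(n := a)"])
    fix f :: "('i \<Rightarrow> real) \<Rightarrow> ennreal"
    assume f[measurable]: "f \<in> borel_measurable ?P"
      and dual: "\<And>x y. x \<in> space ?P \<Longrightarrow> y \<in> space ?P \<Longrightarrow>
       f x * g (\<lambda>i\<in>insert n I. (z(n := a)) i + y i) \<le> ennreal (exp (- (\<Sum>i\<in>insert n I. x i * y i)))"
    \<comment> \<open>The function \<open>f\<close> is cut by the hyperplane through the origin
      orthogonal to the direction (w, 1), and each half of \<open>f\<close> is paired with the half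
      of \<open>g\<close> of the same sign.\<close>
    let ?l = "\<lambda>x. x n + (\<Sum>i\<in>I. w i * x i)"
    let ?h = "\<lambda>\<epsilon> x. f x * indicator {0<..} (\<epsilon> * ?l x)"
    have *: "ennreal m * (\<integral>\<^sup>+x. ?h \<epsilon> x \<partial>?P) \<le> half_gaussian\<^sup>2 * (4 * half_gaussian\<^sup>2) ^ card I"
      if \<epsilon>: "\<epsilon> = 1 \<or> \<epsilon> = -1" for \<epsilon>
      unfolding half[OF \<epsilon>, symmetric]
    proof (rule santalo_half_space[OF I IH _ f g fin _ dual])
      show "\<bar>\<epsilon>\<bar> = 1" using \<epsilon> by auto
      show "integrable (density ?P g) (\<lambda>x. indicator {0<..} (\<epsilon> * (x n - a)) * (x i - z i - (x n - a) * w i)) \<and>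
          (LINT x|density ?P g. indicator {0<..} (\<epsilon> * (x n - a)) * (x i - z i - (x n - a) * w i)) = 0" if "i \<in> I" for i
        using centred[OF \<epsilon> that] unfolding H_def M_def .
    qed
    have "(\<integral>\<^sup>+x. f x \<partial>?P) = (\<integral>\<^sup>+x. ?h 1 x + ?h (-1) x \<partial>?P)"
      using AE_lborel_PiM_affine[OF I, of w 0]
      by (intro nn_integral_cong_AE) (auto elim!: eventually_mono simp: indicator_def)
    also have "\<dots> = (\<integral>\<^sup>+x. ?h 1 x \<partial>?P) + (\<integral>\<^sup>+x. ?h (-1) x \<partial>?P)"
      by (rule nn_integral_add) measurable
    finally have split: "(\<integral>\<^sup>+x. f x \<partial>?P) = (\<integral>\<^sup>+x. ?h 1 x \<partial>?P) + (\<integral>\<^sup>+x. ?h (-1) x \<partial>?P)" .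
    have "(\<integral>\<^sup>+x. g x \<partial>?P) = 2 * ennreal m"
      unfolding emm m_def by (simp add: numeral_mult_ennreal)
    then have "(\<integral>\<^sup>+x. g x \<partial>?P) * (\<integral>\<^sup>+x. f x \<partial>?P) = 2 * (ennreal m * (\<integral>\<^sup>+x. ?h 1 x \<partial>?P) + ennreal m * (\<integral>\<^sup>+x. ?h (-1) x \<partial>?P))"
      unfolding split by (simp only: distrib_left mult.assoc)
    \<comment> \<open>The factor 4 of the new dimension arises as 2 * 2: \<open>g\<close> has mass
      \<open>2 * m\<close>, and \<open>f\<close> consists of two halves.\<close>
    also have "\<dots> \<le> 2 * (half_gaussian\<^sup>2 * (4 * half_gaussian\<^sup>2) ^ card I + half_gaussian\<^sup>2 * (4 * half_gaussian\<^sup>2) ^ card I)"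
      by (intro mult_left_mono add_mono *) auto
    also have "\<dots> = (4 * half_gaussian\<^sup>2) ^ Suc (card I)"
    proof -
      have "2 * (t + t) = 4 * t" for t :: ennreal
        by (simp add: mult_2[symmetric] mult.assoc[symmetric])
      then show ?thesis by (simp add: mult.assoc)
    qed
    finally show "(\<integral>\<^sup>+x. g x \<partial>?P) * (\<integral>\<^sup>+x. f x \<partial>?P) \<le> (4 * half_gaussian\<^sup>2) ^ Suc (card I)" .
  qed
qed


text \<open>The roles are exchanged: the previous lemma is applied to the translated (and truncated) \<open>g\<close> and to
  \<open>f x * exp \<langle>z, x\<rangle>\<close>, whose integral is at least that of the centred \<open>f\<close> because \<open>exp t \<ge> 1 + t\<close>.\<close>

lemma santalo_bound_insert:
  assumes I: "finite I" "n \<notin> I" and IH: "santalo_bound I"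
  shows "santalo_bound (insert n I)"
  unfolding santalo_bound_def
proof (intro ballI impI)
  let ?P = "lborel_PiM (insert n I)"
  fix f g :: "('a \<Rightarrow> real) \<Rightarrow> ennreal"
  assume f[measurable]: "f \<in> borel_measurable ?P" and g[measurable]: "g \<in> borel_measurable ?P"
    and fin: "(\<integral>\<^sup>+x. f x \<partial>?P) < \<infinity>"
    and cen: "\<forall>i\<in>insert n I. integrable (density ?P f) (\<lambda>x. x i) \<and> (LINT x|density ?P f. x i) = 0"
    and dual: "\<forall>x\<in>space ?P. \<forall>y\<in>space ?P. f x * g y \<le> ennreal (exp (- (\<Sum>i\<in>insert n I. x i * y i)))"
  have [measurable]: "(\<lambda>x. x i) \<in> borel_measurable ?P" if "i \<in> insert n I" for i
    by (rule borel_measurable_PiM_component[OF that])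
  define M where "M = density ?P f"
  have sM[simp]: "sets M = sets ?P" "space M = space ?P" by (auto simp: M_def)
  have em: "emeasure M (space M) = (\<integral>\<^sup>+x. f x \<partial>?P)"
    unfolding sM M_def by (subst emeasure_density) (auto intro!: nn_integral_cong)
  interpret finite_measure M
    by (rule finite_measureI) (use fin em in simp)
  \<comment> \<open>Truncation in value and in support makes the integral finite and the first
    moments exist, as \<open>santalo_point\<close> requires; it keeps the duality inequality because
    \<open>gk k \<le> g\<close>, and monotone convergence removes it in the end.\<close>
  define gk where "gk k y = min (g y) (of_nat k) * indicator {y. \<forall>i\<in>insert n I. \<bar>y i\<bar> \<le> real k} y" for k :: nat and y
  have fI: "finite (insert n I)" using I by simp
  have pr[measurable]: "Measurable.pred ?P (\<lambda>y. \<forall>i\<in>insert n I. \<bar>y i\<bar> \<le> real k)" for k :: nat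
    by (rule pred_intros_finite(3)[OF fI]) measurable
  have gkm[measurable]: "gk k \<in> borel_measurable ?P" for k
  proof -
    have "(\<lambda>y. if \<forall>i\<in>insert n I. \<bar>y i\<bar> \<le> real k then min (g y) (of_nat k) else 0) \<in> borel_measurable ?P"
      by measurable
    moreover have "(\<lambda>y. if \<forall>i\<in>insert n I. \<bar>y i\<bar> \<le> real k then min (g y) (of_nat k) else 0) = gk k"
      by (auto simp: gk_def fun_eq_iff)
    ultimately show ?thesis by simp
  qed
  have gkle: "gk k y \<le> g y" for k y by (auto simp: gk_def indicator_def)
  have step: "(\<integral>\<^sup>+x. f x \<partial>?P) * (\<integral>\<^sup>+x. gk k x \<partial>?P) \<le> (4 * half_gaussian\<^sup>2) ^ card (insert n I)" for k
  proof (cases "(\<integral>\<^sup>+x. gk k x \<partial>?P) = 0")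
    case False
    have "(\<integral>\<^sup>+x. gk k x \<partial>?P) \<le> (\<integral>\<^sup>+x. of_nat k * indicator (PiE (insert n I) (\<lambda>_. {- real k..real k})) x \<partial>?P)"
    proof (rule nn_integral_mono)
      fix x assume "x \<in> space ?P"
      then have "(\<forall>i\<in>insert n I. \<bar>x i\<bar> \<le> real k) \<Longrightarrow> x \<in> PiE (insert n I) (\<lambda>_. {- real k..real k})"
        by (force simp: space_PiM PiE_def Pi_def abs_le_iff)
      then show "gk k x \<le> of_nat k * indicator (PiE (insert n I) (\<lambda>_. {- real k..real k})) x"
        by (auto simp: gk_def indicator_def)
    qed
    also have "\<dots> = of_nat k * emeasure ?P (PiE (insert n I) (\<lambda>_. {- real k..real k}))"
      using fI by (intro nn_integral_cmult_indicator sets_PiM_I_finite) auto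
    also have "emeasure ?P (PiE (insert n I) (\<lambda>_. {- real k..real k})) = (\<Prod>i\<in>insert n I. ennreal (2 * real k))"
      using fI by (subst lborel_PiM.emeasure_PiM) auto
    also have "of_nat k * (\<Prod>i\<in>insert n I. ennreal (2 * real k)) < \<infinity>"
      by (simp add: ennreal_mult_less_top power_less_top_ennreal of_nat_less_top)
    finally have gfin: "(\<integral>\<^sup>+x. gk k x \<partial>?P) < \<infinity>" .
    define N where "N = density ?P (gk k)"
    have sN: "sets N = sets ?P" "space N = space ?P" by (auto simp: N_def)
    have eN: "emeasure N (space N) = (\<integral>\<^sup>+x. gk k x \<partial>?P)"
      unfolding sN N_def by (subst emeasure_density) (auto intro!: nn_integral_cong)
    interpret N: finite_measure N
      by (rule finite_measureI) (use gfin eN in simp)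
    have momN: "integrable N (\<lambda>x. x i)" if i: "i \<in> insert n I" for i
    proof (rule N.integrable_const_bound[of _ "real k"])
      show "AE x in N. norm (x i) \<le> real k"
        unfolding N_def using i by (subst AE_density) (auto simp: gk_def indicator_def intro!: AE_I2 split: if_splits)
      show "(\<lambda>x. x i) \<in> borel_measurable N" unfolding N_def using i by simp
    qed
    obtain z where z: "\<And>f. f \<in> borel_measurable ?P \<Longrightarrow>
     (\<And>x y. x \<in> space ?P \<Longrightarrow> y \<in> space ?P \<Longrightarrow>
       f x * gk k (\<lambda>i\<in>insert n I. z i + y i) \<le> ennreal (exp (- (\<Sum>i\<in>insert n I. x i * y i)))) \<Longrightarrow>
     (\<integral>\<^sup>+x. gk k x \<partial>?P) * (\<integral>\<^sup>+x. f x \<partial>?P) \<le> (4 * half_gaussian\<^sup>2) ^ Suc (card I)"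
      by (rule santalo_point[OF I IH gkm gfin]) (use False momN in \<open>auto simp: N_def zero_less_iff_neq_zero\<close>)
    define l where "l x = (\<Sum>i\<in>insert n I. z i * x i)" for x :: "'a \<Rightarrow> real"
    have [measurable]: "l \<in> borel_measurable ?P" unfolding l_def
      by (intro borel_measurable_sum borel_measurable_times) auto
    have l0: "integrable M l" "(LINT x|M. l x) = 0"
    proof -
      have i: "integrable M (\<lambda>x. z i * x i)" "(LINT x|M. z i * x i) = 0" if "i \<in> insert n I" for i
        using cen[rule_format, OF that] unfolding M_def by auto
      show "integrable M l" unfolding l_def by (intro Bochner_Integration.integrable_sum i)
      have "(LINT x|M. l x) = (\<Sum>i\<in>insert n I. LINT x|M. z i * x i)"
        unfolding l_def by (rule Bochner_Integration.integral_sum[OF i(1)])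
      also have "\<dots> = 0" by (rule sum.neutral) (use i(2) in blast)
      finally show "(LINT x|M. l x) = 0" .
    qed
    have "(\<integral>\<^sup>+x. f x \<partial>?P) = ennreal (LINT x|M. 1 + l x)"
      using l0 by (simp add: em[symmetric] emeasure_eq_measure)
    also have "\<dots> \<le> (\<integral>\<^sup>+x. ennreal (1 + l x) \<partial>M)"
    proof -
      have i: "integrable M (\<lambda>x. 1 + l x)" using l0 by simp
      have "(LINT x|M. 1 + l x) \<le> (LINT x|M. max 0 (1 + l x))"
        using i by (intro integral_mono) auto
      then have "ennreal (LINT x|M. 1 + l x) \<le> ennreal (LINT x|M. max 0 (1 + l x))"
        by (rule ennreal_leI)
      also have "\<dots> = (\<integral>\<^sup>+x. ennreal (max 0 (1 + l x)) \<partial>M)"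
        using i by (intro nn_integral_eq_integral[symmetric]) auto
      also have "(\<lambda>x. ennreal (max 0 (1 + l x))) = (\<lambda>x. ennreal (1 + l x))"
        by (simp add: fun_eq_iff max_def ennreal_neg)
      finally show ?thesis .
    qed
    also have "\<dots> \<le> (\<integral>\<^sup>+x. ennreal (exp (l x)) \<partial>M)"
      by (intro nn_integral_mono ennreal_leI exp_ge_add_one_self)
    also have "\<dots> = (\<integral>\<^sup>+x. f x * ennreal (exp (l x)) \<partial>?P)"
      unfolding M_def by (rule nn_integral_density) measurable
    finally have le: "(\<integral>\<^sup>+x. f x \<partial>?P) \<le> (\<integral>\<^sup>+x. f x * ennreal (exp (l x)) \<partial>?P)" .
    have "(\<integral>\<^sup>+x. gk k x \<partial>?P) * (\<integral>\<^sup>+x. f x * ennreal (exp (l x)) \<partial>?P) \<le> (4 * half_gaussian\<^sup>2) ^ Suc (card I)"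
    proof (rule z)
      show "(\<lambda>x. f x * ennreal (exp (l x))) \<in> borel_measurable ?P" by measurable
      fix x y assume x: "x \<in> space ?P" and y: "y \<in> space ?P"
      let ?y = "\<lambda>i\<in>insert n I. z i + y i"
      have y': "?y \<in> space ?P" by (auto simp: space_PiM)
      have ip: "(\<Sum>i\<in>insert n I. x i * ?y i) = l x + (\<Sum>i\<in>insert n I. x i * y i)"
        unfolding l_def sum.distrib[symmetric] by (intro sum.cong) (auto simp: algebra_simps)
      have "f x * ennreal (exp (l x)) * gk k ?y \<le> ennreal (exp (l x)) * (f x * g ?y)"
        using mult_left_mono[OF gkle[of k ?y], of "f x * ennreal (exp (l x))"] by (simp add: mult_ac)
      also have "\<dots> \<le> ennreal (exp (l x)) * ennreal (exp (- (l x + (\<Sum>i\<in>insert n I. x i * y i))))"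
        using dual[rule_format, OF x y'] unfolding ip by (intro mult_left_mono) auto
      also have "\<dots> = ennreal (exp (- (\<Sum>i\<in>insert n I. x i * y i)))"
        by (simp add: ennreal_mult[symmetric] exp_add[symmetric])
      finally show "f x * ennreal (exp (l x)) * gk k ?y \<le> ennreal (exp (- (\<Sum>i\<in>insert n I. x i * y i)))" .
    qed
    then have "(\<integral>\<^sup>+x. gk k x \<partial>?P) * (\<integral>\<^sup>+x. f x \<partial>?P) \<le> (4 * half_gaussian\<^sup>2) ^ Suc (card I)"
      using mult_left_mono[OF le, of "\<integral>\<^sup>+x. gk k x \<partial>?P"] by (rule order_trans[rotated]) simp
    then show ?thesis using I by (simp add: mult.commute)
  qed simp
  have sup: "(SUP k. gk k y) = g y" for y
  proof (rule antisym)
    show "(SUP k. gk k y) \<le> g y" by (intro SUP_least gkle)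
    obtain k0 where k0: "\<forall>i\<in>insert n I. \<bar>y i\<bar> \<le> real k0"
    proof -
      obtain k0 where "(\<Sum>i\<in>insert n I. \<bar>y i\<bar>) \<le> real k0" using real_arch_simple by blast
      moreover have "\<bar>y i\<bar> \<le> (\<Sum>i\<in>insert n I. \<bar>y i\<bar>)" if "i \<in> insert n I" for i
        using fI that by (intro member_le_sum) auto
      ultimately show ?thesis by (intro that[of k0]) (meson order_trans)
    qed
    have gk': "gk k y = min (g y) (of_nat k)" if "k \<ge> k0" for k
    proof -
      have "\<bar>y i\<bar> \<le> real k" if "i \<in> insert n I" for i
        using k0 that \<open>k \<ge> k0\<close> by (meson of_nat_le_iff order_trans)
      then show ?thesis unfolding gk_def by simp
    qed
    show "g y \<le> (SUP k. gk k y)"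
    proof (cases "g y")
      case (real r)
      obtain k1 where "r \<le> real k1" using real_arch_simple by blast
      then have "g y \<le> of_nat (max k0 k1)"
        unfolding real(2) ennreal_of_nat_eq_real_of_nat by (intro ennreal_leI) linarith+
      then have "gk (max k0 k1) y = g y"
        by (subst gk') (auto simp: min_def)
      then show ?thesis by (metis SUP_upper UNIV_I)
    next
      case top
      have "of_nat j \<le> gk (max k0 j) y" for j
        by (subst gk') (auto simp: top)
      then have "(SUP j. of_nat j) \<le> (SUP k. gk k y)"
        by (intro SUP_least) (meson SUP_upper2 UNIV_I)
      then show ?thesis unfolding ennreal_SUP_of_nat_eq_top top .
    qed
  qed
  have inc: "incseq gk"
  proof (intro incseq_SucI le_funI)
    fix k y
    show "gk k y \<le> gk (Suc k) y"
      unfolding gk_def by (intro mult_mono indicator_leI) (auto simp: min_le_iff_disj intro: order_trans)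
  qed
  have "(\<integral>\<^sup>+x. f x \<partial>?P) * (\<integral>\<^sup>+x. g x \<partial>?P) = (\<integral>\<^sup>+x. f x \<partial>?P) * (SUP k. (\<integral>\<^sup>+x. gk k x \<partial>?P))"
    unfolding sup[symmetric] by (subst nn_integral_monotone_convergence_SUP[OF inc]) auto
  also have "\<dots> = (SUP k. (\<integral>\<^sup>+x. f x \<partial>?P) * (\<integral>\<^sup>+x. gk k x \<partial>?P))"
    by (rule SUP_mult_left_ennreal)
  also have "\<dots> \<le> (4 * half_gaussian\<^sup>2) ^ card (insert n I)"
    by (intro SUP_least step)
  finally show "(\<integral>\<^sup>+x. f x \<partial>?P) * (\<integral>\<^sup>+x. g x \<partial>?P) \<le> (4 * half_gaussian\<^sup>2) ^ card (insert n I)" .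
qed

lemma santalo_bound_finite: "finite I \<Longrightarrow> santalo_bound I"
proof (induction I rule: finite_induct)
  case empty
  show ?case
    unfolding santalo_bound_def
  proof (intro ballI impI)
    fix f g :: "('a \<Rightarrow> real) \<Rightarrow> ennreal"
    assume "\<forall>x\<in>space (lborel_PiM {}). \<forall>y\<in>space (lborel_PiM {}). f x * g y \<le> ennreal (exp (- (\<Sum>i\<in>{}. x i * y i)))"
    then show "(\<integral>\<^sup>+x. f x \<partial>lborel_PiM {}) * (\<integral>\<^sup>+x. g x \<partial>lborel_PiM {}) \<le> (4 * half_gaussian\<^sup>2) ^ card ({} :: 'a set)"
      by (simp add: PiM_empty nn_integral_count_space_finite)
  qed
qed (rule santalo_bound_insert)

text \<open>The coordinate form is carried to a Euclidean space through its basis. The bound is the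
  value attained when both functions are the standard Gaussian, see
  \<open>gaussian_integral\<close>.\<close>

theorem functional_santalo:
  fixes f :: "'a::euclidean_space \<Rightarrow> real" and g :: "'a \<Rightarrow> ennreal"
  assumes g: "g \<in> borel_measurable borel"
    and f: "integrable lborel f" "\<And>x. 0 \<le> f x"
    and mom: "integrable lborel (\<lambda>x. f x *\<^sub>R x)" "(LINT x|lborel. f x *\<^sub>R x) = 0"
    and dual: "\<And>x y. ennreal (f x) * g y \<le> ennreal (exp (- (x \<bullet> y)))"
  shows "(\<integral>\<^sup>+x. ennreal (f x) \<partial>lborel) * (\<integral>\<^sup>+x. g x \<partial>lborel) \<le> (2 * half_gaussian) ^ (2 * DIM('a))"
proof -
  let ?P = "lborel_PiM (Basis :: 'a set)" and ?T = "\<lambda>f. \<Sum>b\<in>Basis. f b *\<^sub>R b :: 'a"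
  have [measurable]: "f \<in> borel_measurable borel" using f by auto
  note [measurable] = g
  have T[measurable]: "?T \<in> measurable ?P borel"
    by (intro borel_measurable_sum borel_measurable_scaleR borel_measurable_PiM_component) auto
  have int: "(\<integral>\<^sup>+x. u x \<partial>lborel) = (\<integral>\<^sup>+x. u (?T x) \<partial>?P)" if "u \<in> borel_measurable borel" for u :: "'a \<Rightarrow> ennreal"
    by (subst lborel_eq) (rule nn_integral_distr[OF T], use that in simp)
  have Ti: "?T x \<bullet> b = x b" if "b \<in> Basis" for x b
    using that by (simp add: inner_sum_left inner_Basis if_distrib sum.delta cong: if_cong)
  have fm: "(\<lambda>x. ennreal (f (?T x))) \<in> borel_measurable ?P" by measurable
  have gm: "(\<lambda>x. g (?T x)) \<in> borel_measurable ?P" by measurable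
  have fin: "(\<integral>\<^sup>+x. ennreal (f (?T x)) \<partial>?P) < \<infinity>"
    using f by (subst int[symmetric]) (auto simp: real_integrable_def less_top)
  have cen: "integrable (density ?P (\<lambda>x. ennreal (f (?T x)))) (\<lambda>x. x b) \<and>
     (LINT x|density ?P (\<lambda>x. ennreal (f (?T x))). x b) = 0" if b: "b \<in> Basis" for b
  proof -
    have [measurable]: "(\<lambda>x. x b) \<in> borel_measurable ?P"
      using b by (rule borel_measurable_PiM_component)
    have *: "integrable lborel (\<lambda>x. f x * (x \<bullet> b)) \<and> (LINT x|lborel. f x * (x \<bullet> b)) = 0"
      using integrable_inner_left[OF mom(1), of b] integral_inner_left[of b lborel "\<lambda>x. f x *\<^sub>R x"] mom
      by (auto simp: inner_scaleR_left)
    have 1: "(\<integral>\<^sup>+x. ennreal (\<sigma> * x b) \<partial>density ?P (\<lambda>x. ennreal (f (?T x)))) = (\<integral>\<^sup>+x. ennreal (\<sigma> * (f x * (x \<bullet> b))) \<partial>lborel)" for \<sigma> :: real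
    proof -
      have "(\<integral>\<^sup>+x. ennreal (\<sigma> * x b) \<partial>density ?P (\<lambda>x. ennreal (f (?T x)))) = (\<integral>\<^sup>+x. ennreal (f (?T x)) * ennreal (\<sigma> * x b) \<partial>?P)"
        by (rule nn_integral_density) measurable
      also have "\<dots> = (\<integral>\<^sup>+x. ennreal (\<sigma> * (f (?T x) * (?T x \<bullet> b))) \<partial>?P)"
        using f(2) by (intro nn_integral_cong) (simp add: Ti[OF b] ennreal_mult''[symmetric] mult_ac)
      also have "\<dots> = (\<integral>\<^sup>+x. ennreal (\<sigma> * (f x * (x \<bullet> b))) \<partial>lborel)"
        by (rule int[symmetric]) measurable
      finally show ?thesis .
    qed
    show ?thesis
      using * 1[of 1] 1[of "-1"] unfolding centred_iff_nn_integral by simp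
  qed
  have "(\<integral>\<^sup>+x. ennreal (f (?T x)) \<partial>?P) * (\<integral>\<^sup>+x. g (?T x) \<partial>?P) \<le> (4 * half_gaussian\<^sup>2) ^ card (Basis :: 'a set)"
  proof (rule santalo_bound_finite[OF finite_Basis, unfolded santalo_bound_def, rule_format])
    show "ennreal (f (?T x)) * g (?T y) \<le> ennreal (exp (- (\<Sum>i\<in>Basis. x i * y i)))" for x y
      using dual[of "?T x" "?T y"] by (simp add: euclidean_inner[of "?T x" "?T y"] Ti)
  qed (use fm gm fin cen in auto)
  then show ?thesis
    using g by (simp add: int power_mult power_mult_distrib)
qed

lemma gaussian_integral:
  "(\<integral>\<^sup>+x. ennreal (exp (- (norm x)\<^sup>2 / 2)) \<partial>(lborel :: 'a::euclidean_space measure)) = (2 * half_gaussian) ^ DIM('a)"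
proof -
  have "(\<integral>\<^sup>+x. (\<Prod>b\<in>Basis. ennreal (exp (- (x \<bullet> b)\<^sup>2 / 2))) \<partial>(lborel :: 'a measure)) =
     (\<Prod>b\<in>(Basis :: 'a set). (\<integral>\<^sup>+r. ennreal (exp (- r\<^sup>2 / 2)) \<partial>lborel))"
    by (rule nn_integral_lborel_prod) auto
  also have "\<dots> = (2 * half_gaussian) ^ DIM('a)"
    unfolding nn_integral_gaussian_real by simp
  also have "(\<lambda>x::'a. \<Prod>b\<in>Basis. ennreal (exp (- (x \<bullet> b)\<^sup>2 / 2))) = (\<lambda>x. ennreal (exp (- (norm x)\<^sup>2 / 2)))"
  proof
    fix x :: 'a
    have "(norm x)\<^sup>2 = (\<Sum>b\<in>Basis. (x \<bullet> b)\<^sup>2)"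
      unfolding power2_norm_eq_inner by (subst euclidean_inner) (simp add: power2_eq_square)
    then show "(\<Prod>b\<in>Basis. ennreal (exp (- (x \<bullet> b)\<^sup>2 / 2))) = ennreal (exp (- (norm x)\<^sup>2 / 2))"
      by (simp add: prod_ennreal exp_sum[symmetric] sum_negf sum_divide_distrib)
  qed
  finally show ?thesis .
qed

section \<open>Convex bodies around the origin\<close>

text \<open>For such bodies the gauge of \<open>K\<close> is the support function of
  \<open>polar K\<close>. No separate gauge is introduced: membership, interior and frontier are all
  read off from \<open>support_function (polar K)\<close>.\<close>

definition origin_body :: "'a::euclidean_space set \<Rightarrow> bool" where
  "origin_body K \<longleftrightarrow> compact K \<and> convex K \<and> 0 \<in> interior K"

lemma origin_body_D:
  assumes "origin_body K"
  shows "compact K" "convex K" "0 \<in> interior K" "0 \<in> K" "K \<noteq> {}" "closed K" "bounded K"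
  using assms interior_subset unfolding origin_body_def by (auto intro: compact_imp_closed compact_imp_bounded)

lemma origin_body_ball:
  assumes "origin_body K" obtains r where "r > 0" "cball 0 r \<subseteq> K"
  using assms unfolding origin_body_def mem_interior_cball by blast

lemma origin_body_bound:
  assumes "origin_body K" obtains R where "R > 0" "\<And>x. x \<in> K \<Longrightarrow> norm x \<le> R"
  using origin_body_D(7)[OF assms] unfolding bounded_pos by blast

lemma inner_le_support:
  assumes "origin_body K" "x \<in> K"
  shows "x \<bullet> u \<le> support_function K u"
proof -
  obtain R where R: "\<And>x. x \<in> K \<Longrightarrow> norm x \<le> R" using origin_body_bound[OF assms(1)] by blast
  have "x \<bullet> u \<le> R * norm u" if "x \<in> K" for x
    using Cauchy_Schwarz_ineq2[of x u] mult_right_mono[OF R[OF that], of "norm u"] by (auto simp: abs_le_iff intro: order_trans)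
  then have "bdd_above ((\<lambda>x. x \<bullet> u) ` K)" by (auto simp: bdd_above_def)
  then show ?thesis unfolding support_function_def by (rule cSUP_upper[OF assms(2)])
qed

lemma support_le:
  assumes "origin_body K" "\<And>x. x \<in> K \<Longrightarrow> x \<bullet> u \<le> c"
  shows "support_function K u \<le> c"
  unfolding support_function_def using assms origin_body_D(5)[OF assms(1)] by (intro cSUP_least) auto

lemma support_attained:
  assumes "origin_body K" obtains x where "x \<in> K" "x \<bullet> u = support_function K u"
proof -
  obtain x where x: "x \<in> K" "\<And>y. y \<in> K \<Longrightarrow> y \<bullet> u \<le> x \<bullet> u"
    using continuous_attains_sup[OF origin_body_D(1,5)[OF assms], of "\<lambda>x. x \<bullet> u"] continuous_on_inner[OF continuous_on_id continuous_on_const] by blast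
  then show ?thesis
    using that[of x] inner_le_support[OF assms x(1), of u] support_le[OF assms x(2)] by force
qed

lemma support_scale:
  assumes "origin_body K" "c \<ge> 0"
  shows "support_function K (c *\<^sub>R u) = c * support_function K u"
proof (rule antisym)
  show "support_function K (c *\<^sub>R u) \<le> c * support_function K u"
    using assms by (intro support_le) (auto intro: mult_left_mono inner_le_support)
  obtain x where "x \<in> K" "x \<bullet> u = support_function K u" using support_attained[OF assms(1)] .
  then show "c * support_function K u \<le> support_function K (c *\<^sub>R u)"
    using inner_le_support[OF assms(1), of x "c *\<^sub>R u"] by simp
qed

lemma support_0 [simp]: "origin_body K \<Longrightarrow> support_function K 0 = 0"
  using support_scale[of K 0 0] by simp

lemma support_add:
  assumes "origin_body K"
  shows "support_function K (u + v) \<le> support_function K u + support_function K v"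
  using assms by (intro support_le) (auto simp: inner_add_right intro!: add_mono inner_le_support)

lemma support_ge_norm:
  assumes "origin_body K" obtains r where "r > 0" "\<And>u. r * norm u \<le> support_function K u"
proof -
  obtain r where r: "r > 0" "cball 0 r \<subseteq> K" using origin_body_ball[OF assms] .
  have "r * norm u \<le> support_function K u" for u
  proof (cases "u = 0")
    case False
    have "(r / norm u) *\<^sub>R u \<in> K" using r False by (intro subsetD[OF r(2)]) simp
    from inner_le_support[OF assms this, of u] False show ?thesis
      by (simp add: power2_norm_eq_inner[symmetric] power2_eq_square)
  qed (simp add: assms)
  then show ?thesis using that r by blast
qed

lemma support_le_norm:
  assumes "origin_body K" obtains R where "R > 0" "\<And>u. support_function K u \<le> R * norm u"
proof -
  obtain R where R: "R > 0" "\<And>x. x \<in> K \<Longrightarrow> norm x \<le> R" using origin_body_bound[OF assms] by blast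
  have "support_function K u \<le> R * norm u" for u
  proof (rule support_le[OF assms])
    fix x assume "x \<in> K"
    then show "x \<bullet> u \<le> R * norm u"
      using norm_cauchy_schwarz[of x u] mult_right_mono[OF R(2), of x "norm u"] by (auto intro: order_trans)
  qed
  then show ?thesis using that R by blast
qed

lemma support_pos: "origin_body K \<Longrightarrow> u \<noteq> 0 \<Longrightarrow> support_function K u > 0"
  by (rule support_ge_norm, assumption) (meson less_le_trans mult_pos_pos zero_less_norm_iff)

lemma support_nonneg: "origin_body K \<Longrightarrow> support_function K u \<ge> 0"
  using support_pos[of K u] by (cases "u = 0") auto

lemma continuous_support:
  assumes "origin_body K" shows "continuous_on S (support_function K)"
proof -
  obtain R where R: "R > 0" "\<And>u. support_function K u \<le> R * norm u" using support_le_norm[OF assms] by blast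
  have 1: "support_function K u - support_function K v \<le> R * norm (u - v)" for u v
    using support_add[OF assms, of "u - v" v] R(2)[of "u - v"] by simp
  have "\<bar>support_function K u - support_function K v\<bar> \<le> R * norm (u - v)" for u v
    using 1[of u v] 1[of v u] by (auto simp: abs_le_iff norm_minus_commute)
  then have "R-lipschitz_on S (support_function K)"
    using R(1) by (intro lipschitz_onI) (auto simp: dist_norm)
  then show ?thesis by (rule lipschitz_on_continuous_on)
qed

lemma borel_measurable_support [measurable]:
  "origin_body K \<Longrightarrow> support_function K \<in> borel_measurable borel"
  by (intro borel_measurable_continuous_onI continuous_support)

lemma mem_polar_iff: "origin_body K \<Longrightarrow> y \<in> polar K \<longleftrightarrow> support_function K y \<le> 1"
  unfolding polar_def using support_le[of K y 1] inner_le_support[of K _ y] by (auto intro: order_trans)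

lemma origin_body_polar:
  assumes "origin_body K" shows "origin_body (polar K)"
proof -
  obtain r where r: "r > 0" "\<And>u. r * norm u \<le> support_function K u" using support_ge_norm[OF assms] by blast
  obtain R where R: "R > 0" "\<And>u. support_function K u \<le> R * norm u" using support_le_norm[OF assms] by blast
  have eq: "polar K = (\<Inter>x\<in>K. {y. x \<bullet> y \<le> 1})" by (auto simp: polar_def)
  have "closed (polar K)" unfolding eq by (intro closed_INT ballI closed_halfspace_le)
  moreover have "bounded (polar K)"
  proof (rule boundedI)
    fix y assume "y \<in> polar K"
    then have "r * norm y \<le> 1" using r(2)[of y] mem_polar_iff[OF assms, of y] by linarith
    then show "norm y \<le> 1 / r" using r by (simp add: field_simps)
  qed
  ultimately have "compact (polar K)" by (simp add: compact_eq_bounded_closed)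
  moreover have "convex (polar K)" unfolding eq by (intro convex_INT convex_halfspace_le)
  moreover have "cball 0 (1 / R) \<subseteq> polar K"
  proof
    fix y :: 'a assume "y \<in> cball 0 (1 / R)"
    then have "R * norm y \<le> 1" using R by (simp add: field_simps)
    then show "y \<in> polar K" using R(2)[of y] mem_polar_iff[OF assms, of y] by linarith
  qed
  then have "0 \<in> interior (polar K)" using R unfolding mem_interior_cball by (intro exI[of _ "1 / R"]) auto
  ultimately show ?thesis by (simp add: origin_body_def)
qed

text \<open>A point outside \<open>K\<close> is separated from \<open>K\<close> by a hyperplane that
  misses the origin; its normal, suitably scaled, lies in \<open>polar K\<close> and has pairing
  greater than 1 with the point.\<close>

lemma polar_polar:
  assumes "origin_body K" shows "polar (polar K) = K"
proof
  show "K \<subseteq> polar (polar K)" by (auto simp: polar_def inner_commute)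
  show "polar (polar K) \<subseteq> K"
  proof (rule ccontr)
    assume "\<not> polar (polar K) \<subseteq> K"
    then obtain x where x: "x \<in> polar (polar K)" "x \<notin> K" by blast
    obtain a b where ab: "a \<bullet> x < b" "\<forall>y\<in>K. b < a \<bullet> y"
      using separating_hyperplane_closed_point[OF origin_body_D(2,6)[OF assms] x(2)] by blast
    have b: "b < 0" using ab(2) origin_body_D(4)[OF assms] by force
    have "y \<bullet> ((1 / b) *\<^sub>R a) \<le> 1" if "y \<in> K" for y
      using ab(2) that b by (auto simp: inner_commute field_simps)
    then have "(1 / b) *\<^sub>R a \<in> polar K" by (simp add: polar_def)
    then have "((1 / b) *\<^sub>R a) \<bullet> x \<le> 1" using x(1) unfolding polar_def by blast
    then show False using ab(1) b by (simp add: field_simps)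
  qed
qed

lemma mem_body_iff: "origin_body K \<Longrightarrow> x \<in> K \<longleftrightarrow> support_function (polar K) x \<le> 1"
  using mem_polar_iff[OF origin_body_polar] polar_polar by blast

text \<open>A Cauchy--Schwarz inequality for gauge and support function: divided by its gauge,
  \<open>x\<close> lies in \<open>K\<close>. Its equality case relates boundary points and
  normals.\<close>

lemma inner_le_support_polar:
  assumes "origin_body K" shows "x \<bullet> y \<le> support_function (polar K) x * support_function K y"
proof (cases "x = 0")
  case False
  let ?g = "support_function (polar K) x"
  have g: "?g > 0" using support_pos[OF origin_body_polar[OF assms] False] .
  have "(1 / ?g) *\<^sub>R x \<in> K"
    using g by (subst mem_body_iff[OF assms], subst support_scale[OF origin_body_polar[OF assms]]) auto
  from inner_le_support[OF assms this, of y] show ?thesis using g by (simp add: field_simps)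
qed (use assms support_0[OF origin_body_polar[OF assms]] in simp)

lemma interior_body_iff:
  assumes "origin_body K" shows "x \<in> interior K \<longleftrightarrow> support_function (polar K) x < 1"
proof
  assume x: "x \<in> interior K"
  show "support_function (polar K) x < 1"
  proof (cases "x = 0")
    case False
    obtain e where e: "e > 0" "cball x e \<subseteq> K" using x unfolding mem_interior_cball by blast
    let ?c = "1 + e / norm x"
    have "?c *\<^sub>R x \<in> cball x e" using False e by (simp add: algebra_simps dist_norm)
    then have "support_function (polar K) (?c *\<^sub>R x) \<le> 1" using e mem_body_iff[OF assms] by blast
    moreover have c: "?c > 1" using e False by simp
    then have "support_function (polar K) (?c *\<^sub>R x) = ?c * support_function (polar K) x"
      by (intro support_scale origin_body_polar assms) simp
    ultimately have "?c * support_function (polar K) x \<le> 1" by simp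
    moreover have "1 * support_function (polar K) x < ?c * support_function (polar K) x"
      using c support_pos[OF origin_body_polar[OF assms] False] by (intro mult_strict_right_mono)
    ultimately show ?thesis by linarith
  qed (use assms support_0[OF origin_body_polar[OF assms]] in simp)
next
  assume "support_function (polar K) x < 1"
  moreover have "open {x. support_function (polar K) x < 1}"
    by (intro open_Collect_less continuous_support origin_body_polar assms continuous_on_const)
  moreover have "{x. support_function (polar K) x < 1} \<subseteq> K" using mem_body_iff[OF assms] by force
  ultimately show "x \<in> interior K" using interior_maximal by blast
qed

lemma frontier_body_iff:
  assumes "origin_body K" shows "x \<in> frontier K \<longleftrightarrow> support_function (polar K) x = 1"
  using mem_body_iff[OF assms, of x] interior_body_iff[OF assms, of x] origin_body_D(6)[OF assms]
  by (auto simp: frontier_def)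

lemma outer_unit_normal_iff:
  assumes "origin_body K" "x \<in> K"
  shows "outer_unit_normal K x u \<longleftrightarrow> norm u = 1 \<and> x \<bullet> u = support_function K u"
proof -
  have "(\<forall>y\<in>K. (y - x) \<bullet> u \<le> 0) \<longleftrightarrow> x \<bullet> u = support_function K u"
    using support_le[OF assms(1), of u "x \<bullet> u"] inner_le_support[OF assms(1), of _ u] assms(2)
    by (auto simp: inner_diff_left intro!: antisym) 
  then show ?thesis by (simp add: outer_unit_normal_def)
qed

section \<open>The Blaschke--Santalo inequality\<close>

text \<open>By homogeneity the measure with density \<open>w\<close> of the sublevel set of
  \<open>h\<close> at \<open>s\<close> is \<open>s ^ (n + k)\<close> times that at 1, and
  \<open>exp (- (h x)\<^sup>2 / 2)\<close> exceeds \<open>u\<close> exactly where \<open>h x\<close>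
  is below \<open>?s u\<close>. The constant is obtained before \<open>h\<close> and
  \<open>w\<close> are chosen: it depends on the dimension and on \<open>k\<close> only, so it
  cancels when bodies are compared. A signed \<open>w\<close> enters through its positive part;
  \<open>k = 0\<close> gives volumes and \<open>k = 1\<close> first moments.\<close>

lemma gaussian_homogeneous_integral:
  fixes k :: nat
  obtains c :: ennreal where
    "\<And>(h :: 'a::euclidean_space \<Rightarrow> real) (w :: 'a \<Rightarrow> real).
       h \<in> borel_measurable borel \<Longrightarrow> w \<in> borel_measurable borel \<Longrightarrow> (\<And>x. h x \<ge> 0) \<Longrightarrow>
       (\<And>x s. s > 0 \<Longrightarrow> h (s *\<^sub>R x) = s * h x) \<Longrightarrow> (\<And>x s. s > 0 \<Longrightarrow> w (s *\<^sub>R x) = s ^ k * w x) \<Longrightarrow>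
       (\<integral>\<^sup>+x. ennreal (exp (- (h x)\<^sup>2 / 2)) * ennreal (w x) \<partial>lborel) =
        c * (\<integral>\<^sup>+x. ennreal (w x) * indicator {x. h x < 1} x \<partial>lborel)"
proof
  let ?n = "DIM('a)"
  let ?s = "\<lambda>u. sqrt (- 2 * ln u)"
  let ?c = "\<integral>\<^sup>+u. ennreal (?s u ^ (?n + k)) * indicator {0<..<1} u \<partial>lborel"
  fix h :: "'a \<Rightarrow> real" and w :: "'a \<Rightarrow> real"
  assume [measurable]: "h \<in> borel_measurable borel" "w \<in> borel_measurable borel" and h0: "\<And>x. h x \<ge> 0"
    and hs: "\<And>x s. s > 0 \<Longrightarrow> h (s *\<^sub>R x) = s * h x" and ws: "\<And>x s. s > 0 \<Longrightarrow> w (s *\<^sub>R x) = s ^ k * w x"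
  define N where "N = density lborel (\<lambda>x. ennreal (w x))"
  have "sigma_finite_measure N"
    unfolding N_def by (subst sigma_finite_measure.sigma_finite_iff_density_finite[OF sigma_finite_lborel]) auto
  let ?f = "\<lambda>x. ennreal (exp (- (h x)\<^sup>2 / 2))"
  have scale: "emeasure N {x. h x < s} = ennreal (s ^ (?n + k)) * emeasure N {x. h x < 1}" if s: "s > 0" for s
  proof -
    have "emeasure N {x. h x < s} = (\<integral>\<^sup>+x. ennreal (w x) * indicator {x. h x < s} x \<partial>lborel)"
      unfolding N_def by (rule emeasure_density) measurable
    also have "\<dots> = (\<integral>\<^sup>+x. ennreal (w x) * indicator {x. h x < s} x \<partial>density (distr lborel borel (\<lambda>x. 0 + s *\<^sub>R x)) (\<lambda>_. ennreal (\<bar>s\<bar> ^ ?n)))"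
      using lborel_affine[of s "0::'a"] s by simp
    also have "\<dots> = (\<integral>\<^sup>+x. ennreal (s ^ ?n) * (ennreal (w (s *\<^sub>R x)) * indicator {x. h x < s} (s *\<^sub>R x)) \<partial>lborel)"
      using s by (subst nn_integral_density) (auto simp: nn_integral_distr)
    also have "\<dots> = (\<integral>\<^sup>+x. ennreal (s ^ (?n + k)) * (ennreal (w x) * indicator {x. h x < 1} x) \<partial>lborel)"
    proof (intro nn_integral_cong)
      fix x
      have "ennreal (w (s *\<^sub>R x)) = ennreal (s ^ k) * ennreal (w x)" using s by (simp add: ws ennreal_mult')
      moreover have "ennreal (s ^ (?n + k)) = ennreal (s ^ ?n) * ennreal (s ^ k)" using s by (simp add: power_add ennreal_mult)
      moreover have "indicator {x. h x < s} (s *\<^sub>R x) = (indicator {x. h x < 1} x :: ennreal)" using s by (simp add: hs indicator_def)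
      ultimately show "ennreal (s ^ ?n) * (ennreal (w (s *\<^sub>R x)) * indicator {x. h x < s} (s *\<^sub>R x)) =
          ennreal (s ^ (?n + k)) * (ennreal (w x) * indicator {x. h x < 1} x)" by (simp only: mult.assoc)
    qed
    also have "\<dots> = ennreal (s ^ (?n + k)) * (\<integral>\<^sup>+x. ennreal (w x) * indicator {x. h x < 1} x \<partial>lborel)"
      by (rule nn_integral_cmult) measurable
    also have "(\<integral>\<^sup>+x. ennreal (w x) * indicator {x. h x < 1} x \<partial>lborel) = emeasure N {x. h x < 1}"
      unfolding N_def by (rule emeasure_density[symmetric]) measurable
    finally show ?thesis .
  qed
  have level: "{x. ennreal u < ?f x} = {x. h x < ?s u}" if u: "0 < u" "u < 1" for u
  proof -
    have "ennreal u < ?f x \<longleftrightarrow> h x < ?s u" for x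
    proof -
      have "ennreal u < ?f x \<longleftrightarrow> u < exp (- (h x)\<^sup>2 / 2)" using u by (simp add: ennreal_less_iff)
      also have "\<dots> \<longleftrightarrow> ln u < - (h x)\<^sup>2 / 2" using u by (metis exp_ln exp_less_cancel_iff)
      also have "\<dots> \<longleftrightarrow> (h x)\<^sup>2 < - 2 * ln u" by auto
      also have "\<dots> \<longleftrightarrow> sqrt ((h x)\<^sup>2) < ?s u" by (simp only: real_sqrt_less_iff)
      finally show ?thesis using h0[of x] by simp
    qed
    then show ?thesis by simp
  qed
  have "(\<integral>\<^sup>+x. ?f x * ennreal (w x) \<partial>lborel) = (\<integral>\<^sup>+x. ?f x \<partial>N)"
    unfolding N_def by (subst nn_integral_density) (auto simp: mult.commute)
  also have "\<dots> = (\<integral>\<^sup>+u. emeasure N {x. ennreal u < ?f x} * indicator {0..} u \<partial>lborel)"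
    using nn_integral_layer_cake[OF \<open>sigma_finite_measure N\<close>, of ?f] by (simp add: N_def)
  also have "\<dots> = (\<integral>\<^sup>+u. (ennreal (?s u ^ (?n + k)) * indicator {0<..<1} u) * emeasure N {x. h x < 1} \<partial>lborel)"
  proof (rule nn_integral_cong_AE)
    show "AE u in lborel. emeasure N {x. ennreal u < ?f x} * indicator {0..} u = (ennreal (?s u ^ (?n + k)) * indicator {0<..<1} u) * emeasure N {x. h x < 1}"
      using AE_lborel_singleton[of "0::real"]
    proof eventually_elim
      case (elim u)
      consider "u < 0" | "0 < u" "u < 1" | "1 \<le> u" using elim by linarith
      then show ?case
      proof cases
        case 2
        have "?s u > 0" using 2 by simp
        have "emeasure N {x. ennreal u < ?f x} = ennreal (?s u ^ (?n + k)) * emeasure N {x. h x < 1}"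
          unfolding level[OF 2] by (rule scale[OF \<open>?s u > 0\<close>])
        moreover have "indicator {0..} u = (1 :: ennreal)" "indicator {0<..<1} u = (1 :: ennreal)" using 2 by auto
        ultimately show ?thesis by (simp only: mult_1_right)
      next
        case 3
        have "\<not> ennreal u < ?f x" for x
        proof -
          have "exp (- (h x)\<^sup>2 / 2) \<le> 1" by simp
          then have "?f x \<le> ennreal u" using 3 by (intro ennreal_leI) linarith
          then show ?thesis by simp
        qed
        then show ?thesis using 3 by simp
      qed auto
    qed
  qed
  also have "\<dots> = ?c * emeasure N {x. h x < 1}"
    by (rule nn_integral_multc) measurable
  also have "emeasure N {x. h x < 1} = (\<integral>\<^sup>+x. ennreal (w x) * indicator {x. h x < 1} x \<partial>lborel)"
    unfolding N_def by (rule emeasure_density) measurable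
  finally show "(\<integral>\<^sup>+x. ?f x * ennreal (w x) \<partial>lborel) = ?c * (\<integral>\<^sup>+x. ennreal (w x) * indicator {x. h x < 1} x \<partial>lborel)" .
qed

lemma null_sets_frontier_body:
  assumes "origin_body K" shows "frontier K \<in> null_sets lborel"
proof -
  have "frontier K \<in> null_sets lebesgue"
    using negligible_convex_frontier[OF origin_body_D(2)[OF assms]] by (simp add: negligible_iff_null_sets)
  then show ?thesis
    by (simp add: null_sets_completion_iff)
qed

lemma emeasure_interior_body:
  assumes "origin_body K"
  shows "emeasure lborel (interior K) = ennreal (vol K)"
proof -
  have K: "K \<in> sets borel" using origin_body_D(6)[OF assms] by (rule borel_closed)
  have "K - frontier K = interior K"
    using interior_subset origin_body_D(6)[OF assms] by (auto simp: frontier_def)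
  then have "emeasure lborel (interior K) = emeasure lborel K"
    using emeasure_Diff_null_set[OF null_sets_frontier_body[OF assms], of K] K by simp
  also have "\<dots> = ennreal (measure lborel K)"
    using emeasure_compact_finite[OF origin_body_D(1)[OF assms]] by (intro emeasure_eq_ennreal_measure) auto
  also have "measure lborel K = vol K"
    unfolding vol_def using K by (simp add: measure_completion)
  finally show ?thesis .
qed

lemma vol_pos:
  assumes "origin_body K" shows "vol K > 0"
proof -
  have "emeasure lborel (interior K) \<noteq> 0"
  proof
    assume "emeasure lborel (interior K) = 0"
    then have "interior K \<in> null_sets lebesgue"
      by (intro null_sets_completionI) (auto simp: null_sets_def)
    then have "negligible (interior K)" by (simp add: negligible_iff_null_sets)
    then show False using open_not_negligible[of "interior K"] origin_body_D(3)[OF assms] by auto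
  qed
  then show ?thesis unfolding emeasure_interior_body[OF assms] by (simp add: zero_less_iff_neq_zero[symmetric])
qed

lemma centroid_eq_0_iff:
  assumes "origin_body K"
  shows "centroid K = 0 \<longleftrightarrow> (LINT x|lborel. indicator K x *\<^sub>R x) = 0"
proof -
  have "integrable lborel (\<lambda>x. indicator K x *\<^sub>R x)"
    using origin_body_D(1)[OF assms] by (intro borel_integrable_compact) auto
  then have "integral K (\<lambda>x. x) = (LINT x|lborel. indicator K x *\<^sub>R x)"
    using set_borel_integral_eq_integral(2)[of K "\<lambda>x. x"] by (simp add: set_integrable_def set_lebesgue_integral_def)
  then show ?thesis using vol_pos[OF assms] by (simp add: centroid_def)
qed

text \<open>With \<open>?g\<close> the gauge and \<open>?h\<close> the support function of
  \<open>K\<close>, the functions \<open>exp (- (?g x)\<^sup>2 / 2)\<close> and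
  \<open>exp (- (?h y)\<^sup>2 / 2)\<close> satisfy the duality inequality, because the inner
  product is at most \<open>?g x * ?h y\<close>, hence at most half the sum of the squares. Their
  integrals are \<open>c0\<close> times the two volumes; the same formula for the Euclidean norm
  expresses the Gaussian constant through the ball, and \<open>c0\<close> drops out.\<close>

theorem blaschke_santalo:
  fixes K :: "'a::euclidean_space set"
  assumes K: "origin_body K" and cen: "centroid K = 0"
  shows "vol K * vol (polar K) \<le> (vol (cball 0 1 :: 'a set))\<^sup>2"
proof -
  obtain c0 :: ennreal where c0: "\<And>(h :: 'a \<Rightarrow> real) (w :: 'a \<Rightarrow> real).
       h \<in> borel_measurable borel \<Longrightarrow> w \<in> borel_measurable borel \<Longrightarrow> (\<And>x. h x \<ge> 0) \<Longrightarrow>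
       (\<And>x s. s > 0 \<Longrightarrow> h (s *\<^sub>R x) = s * h x) \<Longrightarrow> (\<And>x s. s > 0 \<Longrightarrow> w (s *\<^sub>R x) = s ^ 0 * w x) \<Longrightarrow>
       (\<integral>\<^sup>+x. ennreal (exp (- (h x)\<^sup>2 / 2)) * ennreal (w x) \<partial>lborel) =
        c0 * (\<integral>\<^sup>+x. ennreal (w x) * indicator {x. h x < 1} x \<partial>lborel)"
    using gaussian_homogeneous_integral[where k=0 and 'a='a] by blast
  obtain c1 :: ennreal where c1: "\<And>(h :: 'a \<Rightarrow> real) (w :: 'a \<Rightarrow> real).
       h \<in> borel_measurable borel \<Longrightarrow> w \<in> borel_measurable borel \<Longrightarrow> (\<And>x. h x \<ge> 0) \<Longrightarrow>
       (\<And>x s. s > 0 \<Longrightarrow> h (s *\<^sub>R x) = s * h x) \<Longrightarrow> (\<And>x s. s > 0 \<Longrightarrow> w (s *\<^sub>R x) = s ^ 1 * w x) \<Longrightarrow>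
       (\<integral>\<^sup>+x. ennreal (exp (- (h x)\<^sup>2 / 2)) * ennreal (w x) \<partial>lborel) =
        c1 * (\<integral>\<^sup>+x. ennreal (w x) * indicator {x. h x < 1} x \<partial>lborel)"
    using gaussian_homogeneous_integral[where k=1 and 'a='a] by blast
  have K': "origin_body (polar K)" by (rule origin_body_polar[OF K])
  let ?g = "support_function (polar K)" and ?h = "support_function K"
  have set1: "{x. ?g x < 1} = interior K" using interior_body_iff[OF K] by blast
  have set2: "{x. ?h x < 1} = interior (polar K)"
    using interior_body_iff[OF K'] polar_polar[OF K] by auto
  have gm[measurable]: "?g \<in> borel_measurable borel" "?h \<in> borel_measurable borel"
    using K K' by auto
  have w1: "(\<integral>\<^sup>+x. ennreal (exp (- (h x)\<^sup>2 / 2)) \<partial>lborel) = c0 * emeasure lborel {x. h x < 1}"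
    if "h \<in> borel_measurable borel" "\<And>x. h x \<ge> 0" "\<And>x s. s > 0 \<Longrightarrow> h (s *\<^sub>R x) = s * h x" for h :: "'a \<Rightarrow> real"
    using c0[of h "\<lambda>_. 1"] that by simp
  have I1: "(\<integral>\<^sup>+x. ennreal (exp (- (?g x)\<^sup>2 / 2)) \<partial>lborel) = c0 * ennreal (vol K)"
    using w1[of ?g] support_nonneg[OF K'] support_scale[OF K'] by (simp add: set1 emeasure_interior_body[OF K])
  have I2: "(\<integral>\<^sup>+x. ennreal (exp (- (?h x)\<^sup>2 / 2)) \<partial>lborel) = c0 * ennreal (vol (polar K))"
    using w1[of ?h] support_nonneg[OF K] support_scale[OF K] by (simp add: set2 emeasure_interior_body[OF K'])
  have B: "origin_body (cball 0 1 :: 'a set)" by (simp add: origin_body_def)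
  have "{x::'a. norm x < 1} = interior (cball 0 1)" by (auto simp: dist_norm)
  then have I3: "c0 * ennreal (vol (cball 0 1 :: 'a set)) = (2 * half_gaussian) ^ DIM('a)"
    using w1[of norm] emeasure_interior_body[OF B] gaussian_integral[where 'a='a] by simp
  have gam: "(2 * half_gaussian) ^ DIM('a) < \<infinity>" "(2 * half_gaussian) ^ DIM('a) > 0"
    using half_gaussian_finite half_gaussian_pos by (auto simp: power_less_top_ennreal ennreal_mult_less_top zero_less_iff_neq_zero)
  have vB: "vol (cball 0 1 :: 'a set) > 0" by (rule vol_pos[OF B])
  have "c0 < \<infinity>" using gam(1) vB unfolding I3[symmetric] by (auto simp: ennreal_mult_less_top)
  then obtain c where c: "c0 = ennreal c" "c \<ge> 0" by (cases c0) auto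
  have cpos: "c > 0" using gam(2) c unfolding I3[symmetric] by (cases "c = 0") auto
  define f where "f x = exp (- (?g x)\<^sup>2 / 2)" for x
  have [measurable]: "f \<in> borel_measurable borel" unfolding f_def by measurable
  have fint: "integrable lborel f"
  proof (rule integrableI_nonneg)
    show "(\<integral>\<^sup>+x. ennreal (f x) \<partial>lborel) < \<infinity>"
      unfolding f_def I1 c by (simp add: ennreal_mult_less_top)
  qed (auto simp: f_def)
  obtain R where R: "R > 0" "\<And>x. R * norm x \<le> ?g x" using support_ge_norm[OF K'] by blast
  \<comment> \<open>The norm is bounded by a multiple of the gauge, and
    \<open>t \<le> 1 + t\<^sup>2 / 4 \<le> exp (t\<^sup>2 / 4)\<close> absorbs this factor into half
    of the exponent. What remains is the Gaussian of the gauge divided by the root of 2, whose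
    sublevel set is bounded.\<close>
  have fmom: "integrable lborel (\<lambda>x. f x *\<^sub>R x)"
  proof (rule Bochner_Integration.integrable_bound)
    let ?G = "\<lambda>x. ?g x / sqrt 2"
    have "(\<integral>\<^sup>+x. ennreal (exp (- (?G x)\<^sup>2 / 2)) \<partial>lborel) = c0 * emeasure lborel {x. ?G x < 1}"
      using support_nonneg[OF K'] support_scale[OF K'] by (intro w1) auto
    also have "emeasure lborel {x. ?G x < 1} \<le> emeasure lborel (cball (0::'a) (sqrt 2 / R))"
    proof (rule emeasure_mono)
      show "{x. ?G x < 1} \<subseteq> cball 0 (sqrt 2 / R)"
      proof
        fix x assume "x \<in> {x. ?G x < 1}"
        then have "?g x < sqrt 2" by (simp add: field_simps)
        then have "R * norm x \<le> sqrt 2" using R(2)[of x] by linarith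
        then show "x \<in> cball 0 (sqrt 2 / R)" using R(1) by (simp add: field_simps)
      qed
    qed simp
    also have "c0 * emeasure lborel (cball (0::'a) (sqrt 2 / R)) < \<infinity>"
      using \<open>c0 < \<infinity>\<close> emeasure_compact_finite[of "cball (0::'a) (sqrt 2 / R)"] by (simp add: ennreal_mult_less_top)
    finally have "(\<integral>\<^sup>+x. ennreal (exp (- (?G x)\<^sup>2 / 2)) \<partial>lborel) < \<infinity>" by (simp add: mult_left_mono)
    then have "integrable lborel (\<lambda>x. exp (- (?G x)\<^sup>2 / 2))"
      by (intro integrableI_nonneg) auto
    then show "integrable lborel (\<lambda>x. (1 / R) * exp (- (?G x)\<^sup>2 / 2))" by simp
    show "AE x in lborel. norm (f x *\<^sub>R x) \<le> norm ((1 / R) * exp (- (?G x)\<^sup>2 / 2))"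
    proof (rule AE_I2)
      fix x :: 'a
      have "?g x \<le> 1 + (?g x)\<^sup>2 / 4"
        using zero_le_power2[of "?g x / 2 - 1"] by (simp add: power2_diff power_divide)
      also have "\<dots> \<le> exp ((?g x)\<^sup>2 / 4)" by (rule exp_ge_add_one_self)
      finally have "f x * ?g x \<le> exp (- (?g x)\<^sup>2 / 2) * exp ((?g x)\<^sup>2 / 4)"
        unfolding f_def by (intro mult_left_mono) auto
      also have "\<dots> = exp (- (?G x)\<^sup>2 / 2)"
        by (simp add: exp_add[symmetric] power_divide)
      finally have "f x * ?g x \<le> exp (- (?G x)\<^sup>2 / 2)" .
      moreover have "f x * (R * norm x) \<le> f x * ?g x" using R by (intro mult_left_mono) (auto simp: f_def)
      ultimately have "f x * (R * norm x) \<le> exp (- (?G x)\<^sup>2 / 2)" by linarith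
      then show "norm (f x *\<^sub>R x) \<le> norm ((1 / R) * exp (- (?G x)\<^sup>2 / 2))"
        using R(1) by (simp add: f_def field_simps)
    qed
  qed measurable
  have Kint: "integrable lborel (\<lambda>x. indicator K x *\<^sub>R x)"
    using origin_body_D(1)[OF K] by (intro borel_integrable_compact) auto
  have Kbor: "K \<in> sets borel" using origin_body_D(6)[OF K] by (rule borel_closed)
  have f0: "(LINT x|lborel. f x *\<^sub>R x) = 0"
  proof (rule euclidean_eqI)
    fix b :: 'a assume b: "b \<in> Basis"
    have "(LINT x|lborel. indicator K x *\<^sub>R x) = 0" using cen centroid_eq_0_iff[OF K] by simp
    then have "integrable lborel (\<lambda>x. indicator K x * (x \<bullet> b)) \<and> (LINT x|lborel. indicator K x * (x \<bullet> b)) = 0"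
      using Kint integrable_inner_left[of b lborel "\<lambda>x. indicator K x *\<^sub>R x"] integral_inner_left[of b lborel "\<lambda>x. indicator K x *\<^sub>R x"]
      by auto
    then have *: "(\<integral>\<^sup>+x. ennreal (- (indicator K x * (x \<bullet> b))) \<partial>lborel) = (\<integral>\<^sup>+x. ennreal (indicator K x * (x \<bullet> b)) \<partial>lborel)"
      unfolding centred_iff_nn_integral by simp
    \<comment> \<open>The first moments of \<open>f\<close> are \<open>c1\<close> times those of
      \<open>K\<close>, for the positive and the negative part separately; hence the centroid of
      \<open>K\<close> at 0 makes \<open>f\<close> centred.\<close>
    have eq: "(\<integral>\<^sup>+x. ennreal (\<sigma> * (f x * (x \<bullet> b))) \<partial>lborel) = c1 * (\<integral>\<^sup>+x. ennreal (\<sigma> * (indicator K x * (x \<bullet> b))) \<partial>lborel)" for \<sigma> :: real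
    proof -
      have "(\<integral>\<^sup>+x. ennreal (\<sigma> * (f x * (x \<bullet> b))) \<partial>lborel) = (\<integral>\<^sup>+x. ennreal (exp (- (?g x)\<^sup>2 / 2)) * ennreal (\<sigma> * (x \<bullet> b)) \<partial>lborel)"
        by (intro nn_integral_cong) (simp add: f_def ennreal_mult'[symmetric] mult.left_commute)
      also have "\<dots> = c1 * (\<integral>\<^sup>+x. ennreal (\<sigma> * (x \<bullet> b)) * indicator {x. ?g x < 1} x \<partial>lborel)"
        using support_nonneg[OF K'] support_scale[OF K'] by (intro c1) auto
      also have "(\<integral>\<^sup>+x. ennreal (\<sigma> * (x \<bullet> b)) * indicator {x. ?g x < 1} x \<partial>lborel) = (\<integral>\<^sup>+x. ennreal (\<sigma> * (indicator K x * (x \<bullet> b))) \<partial>lborel)"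
      proof (rule nn_integral_cong_AE)
        have "AE x in lborel. x \<notin> frontier K" using null_sets_frontier_body[OF K] by (rule AE_not_in)
        then show "AE x in lborel. ennreal (\<sigma> * (x \<bullet> b)) * indicator {x. ?g x < 1} x = ennreal (\<sigma> * (indicator K x * (x \<bullet> b)))"
        proof eventually_elim
          case (elim x)
          then have "x \<in> {x. ?g x < 1} \<longleftrightarrow> x \<in> K"
            unfolding set1 using interior_subset[of K] origin_body_D(6)[OF K] by (auto simp: frontier_def)
          then show ?case by (cases "x \<in> K") auto
        qed
      qed
      finally show ?thesis .
    qed
    have "integrable lborel (\<lambda>x. f x * (x \<bullet> b))"
      using integrable_inner_left[of b lborel "\<lambda>x. f x *\<^sub>R x"] fmom by auto
    then have "(LINT x|lborel. f x * (x \<bullet> b)) = 0"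
      using eq[of 1] eq[of "-1"] * by (simp add: real_lebesgue_integral_def)
    then show "(LINT x|lborel. f x *\<^sub>R x) \<bullet> b = 0 \<bullet> b"
      using integral_inner_left[of b lborel "\<lambda>x. f x *\<^sub>R x"] fmom by auto
  qed
  have "(\<integral>\<^sup>+x. ennreal (f x) \<partial>lborel) * (\<integral>\<^sup>+x. ennreal (exp (- (?h x)\<^sup>2 / 2)) \<partial>lborel) \<le> (2 * half_gaussian) ^ (2 * DIM('a))"
  proof (rule functional_santalo[OF _ fint _ fmom f0])
    fix x y :: 'a
    have "x \<bullet> y \<le> ?g x * ?h y" by (rule inner_le_support_polar[OF K])
    also have "\<dots> \<le> (?g x)\<^sup>2 / 2 + (?h y)\<^sup>2 / 2"
      using zero_le_power2[of "?g x - ?h y"] by (simp add: power2_diff)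
    finally have "- (?g x)\<^sup>2 / 2 + - (?h y)\<^sup>2 / 2 \<le> - (x \<bullet> y)" by simp
    then show "ennreal (f x) * ennreal (exp (- (?h y)\<^sup>2 / 2)) \<le> ennreal (exp (- (x \<bullet> y)))"
      unfolding f_def by (simp add: ennreal_mult[symmetric] exp_add[symmetric])
  qed (auto simp: f_def)
  also have "(2 * half_gaussian) ^ (2 * DIM('a)) = (c0 * ennreal (vol (cball 0 1 :: 'a set)))\<^sup>2"
    unfolding I3 by (simp only: power_mult[symmetric] mult.commute)
  finally have "ennreal (c * vol K * (c * vol (polar K))) \<le> ennreal ((c * vol (cball 0 1 :: 'a set))\<^sup>2)"
    using c vB vol_pos[OF K] vol_pos[OF K']
    unfolding f_def I1 I2 by (simp add: ennreal_mult[symmetric] ennreal_power)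
  then have "c * vol K * (c * vol (polar K)) \<le> (c * vol (cball 0 1 :: 'a set))\<^sup>2"
    by (subst (asm) ennreal_le_iff) auto
  then have "c\<^sup>2 * (vol K * vol (polar K)) \<le> c\<^sup>2 * (vol (cball 0 1 :: 'a set))\<^sup>2"
    by (simp add: power2_eq_square mult_ac)
  then show ?thesis using cpos by simp
qed

section \<open>Change of variables over an arbitrary finite index type\<close>

text \<open>The change of variables theorem of the library requires a well-ordered index type of the coordinates.\<close>

typedef 'a ordered_copy = "UNIV :: 'a set" ..

definition copy_index :: "'a::finite \<Rightarrow> nat" where
  "copy_index = (SOME f. inj f)"

lemma inj_copy_index: "inj (copy_index :: 'a::finite \<Rightarrow> nat)"
  unfolding copy_index_def
  using finite_imp_inj_to_nat_seg[OF finite[of "UNIV :: 'a set"]] someI_ex[of "inj :: ('a \<Rightarrow> nat) \<Rightarrow> bool"] by blast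

lemma bij_Rep_ordered_copy: "bij (Rep_ordered_copy :: 'a ordered_copy \<Rightarrow> 'a)"
  by (metis Abs_ordered_copy_inverse Rep_ordered_copy_inverse UNIV_I bij_iff)

instance ordered_copy :: (finite) finite
proof
  have "finite (Rep_ordered_copy ` (UNIV :: 'a ordered_copy set))" by simp
  then show "finite (UNIV :: 'a ordered_copy set)"
    using bij_Rep_ordered_copy bij_is_inj finite_imageD by blast
qed

instantiation ordered_copy :: (finite) wellorder
begin

definition less_eq_ordered_copy :: "'a ordered_copy \<Rightarrow> 'a ordered_copy \<Rightarrow> bool" where
  "less_eq_ordered_copy x y \<longleftrightarrow> copy_index (Rep_ordered_copy x) \<le> copy_index (Rep_ordered_copy y)"

definition less_ordered_copy :: "'a ordered_copy \<Rightarrow> 'a ordered_copy \<Rightarrow> bool" where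
  "less_ordered_copy x y \<longleftrightarrow> copy_index (Rep_ordered_copy x) < copy_index (Rep_ordered_copy y)"

instance
proof
  fix x y z :: "'a ordered_copy" and P :: "'a ordered_copy \<Rightarrow> bool" and a :: "'a ordered_copy"
  show "x < y \<longleftrightarrow> x \<le> y \<and> \<not> y \<le> x" by (auto simp: less_eq_ordered_copy_def less_ordered_copy_def)
  show "x \<le> x" by (simp add: less_eq_ordered_copy_def)
  show "x \<le> y \<Longrightarrow> y \<le> z \<Longrightarrow> x \<le> z" by (simp add: less_eq_ordered_copy_def)
  show "x \<le> y \<Longrightarrow> y \<le> x \<Longrightarrow> x = y"
    using injD[OF inj_copy_index] by (force simp: less_eq_ordered_copy_def Rep_ordered_copy_inject[symmetric])
  show "x \<le> y \<or> y \<le> x" by (auto simp: less_eq_ordered_copy_def)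
  assume *: "\<And>x. (\<And>y. y < x \<Longrightarrow> P y) \<Longrightarrow> P x"
  show "P a"
    by (induction "copy_index (Rep_ordered_copy a)" arbitrary: a rule: less_induct)
      (auto intro: * simp: less_ordered_copy_def)
qed

end

definition reindex :: "real^'n \<Rightarrow> real^('n ordered_copy)" where
  "reindex x = (\<chi> a. x $ Rep_ordered_copy a)"

definition unindex :: "real^('n ordered_copy) \<Rightarrow> real^'n" where
  "unindex x = (\<chi> i. x $ Abs_ordered_copy i)"

lemma unindex_reindex [simp]: "unindex (reindex x) = x"
  by (simp add: reindex_def unindex_def vec_eq_iff Abs_ordered_copy_inverse)

lemma reindex_unindex [simp]: "reindex (unindex x) = x"
  by (simp add: reindex_def unindex_def vec_eq_iff Rep_ordered_copy_inverse)

lemma linear_reindex: "linear (reindex :: real^'n::finite \<Rightarrow> _)" and linear_unindex: "linear (unindex :: _ \<Rightarrow> real^'n::finite)"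
  by (auto simp: reindex_def unindex_def vec_eq_iff intro!: linearI)

lemma bounded_linear_reindex: "bounded_linear (reindex :: real^'n::finite \<Rightarrow> _)"
  and bounded_linear_unindex: "bounded_linear (unindex :: _ \<Rightarrow> real^'n::finite)"
  by (simp_all add: linear_reindex linear_unindex linear_conv_bounded_linear[symmetric])

lemma measurable_reindex [measurable]: "(reindex :: real^'n::finite \<Rightarrow> _) \<in> borel_measurable borel"
  and measurable_unindex [measurable]: "(unindex :: _ \<Rightarrow> real^'n::finite) \<in> borel_measurable borel"
  by (auto intro!: borel_measurable_continuous_onI linear_continuous_on bounded_linear_reindex bounded_linear_unindex)

lemma inner_reindex:
  fixes x y :: "real^'n::finite"
  shows "reindex x \<bullet> reindex y = x \<bullet> y"
  using sum.reindex_bij_betw[OF bij_Rep_ordered_copy, of "\<lambda>i. x $ i * y $ i"]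
  by (simp add: inner_vec_def reindex_def)

lemma reindex_axis: "reindex (axis i c) = axis (Abs_ordered_copy i) c"
  and unindex_axis: "unindex (axis a c) = axis (Rep_ordered_copy a) c"
  by (auto simp: reindex_def unindex_def axis_def vec_eq_iff Rep_ordered_copy_inverse Abs_ordered_copy_inverse)

lemma distr_unindex: "distr lborel borel (unindex :: _ \<Rightarrow> real^'n::finite) = lborel"
proof (rule lborel_eqI[symmetric])
  fix l u :: "real^'n"
  assume lu: "\<And>b. b \<in> Basis \<Longrightarrow> l \<bullet> b \<le> u \<bullet> b"
  have "unindex -` box l u = box (reindex l) (reindex u)"
  proof (intro set_eqI)
    fix x :: "real^('n ordered_copy)"
    have "(\<forall>i. P (Abs_ordered_copy i)) \<longleftrightarrow> (\<forall>a. P a)" for P :: "'n ordered_copy \<Rightarrow> bool"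
      by (metis Rep_ordered_copy_inverse)
    from this[of "\<lambda>a. l $ Rep_ordered_copy a < x $ a \<and> x $ a < u $ Rep_ordered_copy a"]
    show "x \<in> unindex -` box l u \<longleftrightarrow> x \<in> box (reindex l) (reindex u)"
      by (simp add: mem_box_cart unindex_def reindex_def Abs_ordered_copy_inverse)
  qed
  then have "emeasure (distr lborel borel unindex) (box l u) = emeasure lborel (box (reindex l) (reindex u))"
    by (subst emeasure_distr) auto
  also have "\<dots> = ennreal (\<Prod>b\<in>Basis. (reindex u - reindex l) \<bullet> b)"
  proof (rule emeasure_lborel_box)
    fix b :: "real^('n ordered_copy)" assume "b \<in> Basis"
    then have "unindex b \<in> Basis" by (auto simp: Basis_vec_def unindex_axis)
    from lu[OF this] show "reindex l \<bullet> b \<le> reindex u \<bullet> b"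
      using inner_reindex[of l "unindex b"] inner_reindex[of u "unindex b"] by simp
  qed
  also have "(\<Prod>b\<in>Basis. (reindex u - reindex l) \<bullet> b) = (\<Prod>b\<in>Basis. (u - l) \<bullet> b)"
  proof (rule prod.reindex_bij_witness[of _ reindex unindex])
    fix b :: "real^('n ordered_copy)" assume "b \<in> Basis"
    then show "unindex b \<in> Basis" by (auto simp: Basis_vec_def unindex_axis)
    show "(u - l) \<bullet> unindex b = (reindex u - reindex l) \<bullet> b"
      using inner_reindex[of "u - l" "unindex b"] linear_diff[OF linear_reindex, of u l] by simp
  next
    fix b :: "real^'n" assume "b \<in> Basis"
    then show "reindex b \<in> Basis" by (auto simp: Basis_vec_def reindex_axis)
  qed auto
  finally show "emeasure (distr lborel borel unindex) (box l u) = (\<Prod>b\<in>Basis. (u - l) \<bullet> b)" .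
qed simp

text \<open>Conjugation with the bijection of the index types carries permutations to permutations
  of the same sign, and the Leibniz formulas agree term by term.\<close>

lemma det_reindex:
  fixes A :: "real^'n::finite^'n"
  shows "det (\<chi> a b. A $ Rep_ordered_copy a $ Rep_ordered_copy b) = det A"
proof -
  let ?R = "Rep_ordered_copy :: 'n ordered_copy \<Rightarrow> 'n"
  let ?m = "map_permutation (UNIV :: 'n ordered_copy set) ?R"
  let ?k = "map_permutation (UNIV :: 'n set) Abs_ordered_copy"
  have bR: "bij_betw ?R UNIV UNIV" using bij_Rep_ordered_copy .
  have bA: "bij_betw (Abs_ordered_copy :: 'n \<Rightarrow> _) UNIV UNIV"
    by (metis Abs_ordered_copy_inverse Rep_ordered_copy_inverse UNIV_I bij_iff)
  have m: "?m p (?R a) = ?R (p a)" for p a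
    using bR by (intro map_permutation_apply) (auto simp: bij_betw_def)
  have "det A = (\<Sum>q\<in>{q. q permutes UNIV}. of_int (sign q) * (\<Prod>i\<in>UNIV. A $ i $ q i))"
    by (simp add: det_def)
  also have "\<dots> = (\<Sum>p\<in>{p. p permutes UNIV}. of_int (sign (?m p)) * (\<Prod>i\<in>UNIV. A $ i $ ?m p i))"
  proof (rule sum.reindex_bij_witness[where i="?m" and j="?k"])
    fix q :: "'n \<Rightarrow> 'n" assume "q \<in> {q. q permutes UNIV}"
    then have q: "q permutes UNIV" by simp
    show mk: "?m (?k q) = q"
      using q bR bA by (intro map_permutation_compose_inv[where B=UNIV]) (auto simp: Abs_ordered_copy_inverse)
    show "of_int (sign (?m (?k q))) * (\<Prod>i\<in>UNIV. A $ i $ ?m (?k q) i) = of_int (sign q) * (\<Prod>i\<in>UNIV. A $ i $ q i)"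
      unfolding mk ..
    show "?k q \<in> {p. p permutes UNIV}" using map_permutation_permutes[OF bA q] by simp
  next
    fix p :: "'n ordered_copy \<Rightarrow> 'n ordered_copy" assume "p \<in> {p. p permutes UNIV}"
    then have p: "p permutes UNIV" by simp
    show "?k (?m p) = p"
      using p bR bA by (intro map_permutation_compose_inv[where B=UNIV]) (auto simp: Rep_ordered_copy_inverse)
    show "?m p \<in> {q. q permutes UNIV}" using map_permutation_permutes[OF bR p] by simp
  qed
  also have "\<dots> = (\<Sum>p\<in>{p. p permutes UNIV}. of_int (sign p) * (\<Prod>a\<in>UNIV. A $ ?R a $ ?R (p a)))"
  proof (rule sum.cong)
    fix p :: "'n ordered_copy \<Rightarrow> 'n ordered_copy" assume "p \<in> {p. p permutes UNIV}"
    then have p: "p permutes UNIV" by simp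
    have "sign (?m p) = sign p" using p bR by (intro sign_map_permutation) (auto simp: bij_betw_def)
    moreover have "(\<Prod>i\<in>UNIV. A $ i $ ?m p i) = (\<Prod>a\<in>UNIV. A $ ?R a $ ?m p (?R a))"
      using prod.reindex_bij_betw[OF bR, of "\<lambda>i. A $ i $ ?m p i"] by simp
    ultimately show "of_int (sign (?m p)) * (\<Prod>i\<in>UNIV. A $ i $ ?m p i) = of_int (sign p) * (\<Prod>a\<in>UNIV. A $ ?R a $ ?R (p a))"
      by (simp add: m)
  qed simp
  finally show ?thesis by (simp add: det_def)
qed

section \<open>Determinants and the volume of differentiable images\<close>

text \<open>An orthogonal transformation takes a coordinate axis to the direction of
  \<open>w\<close>. In the rotated coordinates the map changes the identity matrix in the column
  \<open>k\<close> only, and Cramer's rule gives the determinant.\<close>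

lemma det_rank_one_update:
  fixes w z :: "real^'n::finite"
  shows "det (matrix (\<lambda>v. v + (w \<bullet> v) *\<^sub>R z)) = 1 + w \<bullet> z"
proof (cases "w = 0")
  case True
  have "det (matrix (\<lambda>v::real^'n. v)) = 1" using det_I matrix_id_mat_1 by (metis id_def eq_id_iff)
  then show ?thesis using True by simp
next
  case False
  obtain k :: 'n where True by simp
  have "norm (axis k (norm w) :: real^'n) = norm w" by (simp add: norm_eq_sqrt_inner inner_axis_axis)
  then obtain f where f: "orthogonal_transformation f" "f (axis k (norm w)) = w"
    using orthogonal_transformation_exists by blast
  obtain g where g: "orthogonal_transformation g" "\<And>x. g (f x) = x" "\<And>x. f (g x) = x"
    using f(1) orthogonal_transformation_inv orthogonal_transformation_bij
    by (metis bij_inv_eq_iff bij_is_inj inv_f_f)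
  have lf: "linear f" and lg: "linear g" using f g orthogonal_transformation_linear by auto
  let ?L = "\<lambda>v. v + (w \<bullet> v) *\<^sub>R z"
  have lL: "linear ?L" by (intro linearI) (auto simp: inner_add_right algebra_simps)
  define z' where "z' = norm w *\<^sub>R g z"
  have comp: "g (?L (f v)) = v + (v $ k) *\<^sub>R z'" for v
  proof -
    have "w \<bullet> f v = axis k (norm w) \<bullet> v" using f by (metis orthogonal_transformation_def)
    then show ?thesis using lg by (simp add: linear_add linear_scale g(2) z'_def inner_axis' mult.commute)
  qed
  have wz: "w \<bullet> z = z' $ k"
  proof -
    have "w \<bullet> z = f (axis k (norm w)) \<bullet> f (g z)" by (simp add: f g)
    also have "\<dots> = axis k (norm w) \<bullet> g z" using f(1) by (simp add: orthogonal_transformation_def)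
    finally show ?thesis by (simp add: z'_def inner_axis')
  qed
  have "matrix (g \<circ> (?L \<circ> f)) = matrix g ** (matrix ?L ** matrix f)"
    using lf lg lL by (simp add: matrix_compose linear_compose)
  then have "det (matrix (g \<circ> (?L \<circ> f))) = det (matrix g) * det (matrix f) * det (matrix ?L)"
    by (simp add: det_mul)
  moreover have "det (matrix g) * det (matrix f) = 1"
  proof -
    have "g \<circ> f = id" using g by auto
    then have "matrix g ** matrix f = mat 1"
      using matrix_compose[OF lf lg] by (simp add: matrix_id_mat_1)
    then show ?thesis by (metis det_I det_mul)
  qed
  ultimately have "det (matrix (g \<circ> (?L \<circ> f))) = det (matrix ?L)" by simp
  moreover have "matrix (g \<circ> (?L \<circ> f)) = (\<chi> i j. if j = k then (mat 1 *v (axis k 1 + z')) $ i else mat 1 $ i $ j)"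
    unfolding matrix_vector_mul_lid by (auto simp: matrix_def comp vec_eq_iff axis_def mat_def)
  moreover have "det \<dots> = 1 + z' $ k"
    unfolding cramer_lemma by (simp add: axis_def)
  ultimately show ?thesis by (simp add: wz)
qed

lemma det_compose:
  fixes f g :: "real^'n::finite \<Rightarrow> real^'n"
  assumes "linear f" "linear g"
  shows "det (matrix (\<lambda>v. f (g v))) = det (matrix f) * det (matrix g)"
  using matrix_compose[OF assms(2,1)] by (simp add: o_def det_mul)

text \<open>The statement is moved to the well-ordered copy of the index type, where the library
  theorem holds, and back. The function \<open>D\<close> is a Borel function on the whole space that
  agrees on \<open>S\<close> with the Jacobian, so that the integral can be taken over
  \<open>lborel\<close>.\<close>

lemma emeasure_differentiable_image:
  fixes f :: "real^'n::finite \<Rightarrow> real^'n"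
  assumes S: "open S" and der: "\<And>x. x \<in> S \<Longrightarrow> (f has_derivative f' x) (at x)" and inj: "inj_on f S"
    and T: "f ` S = T" "open T" "emeasure lborel T < \<infinity>"
    and D[measurable]: "D \<in> borel_measurable borel" and D_eq: "\<And>x. x \<in> S \<Longrightarrow> D x = \<bar>det (matrix (f' x))\<bar>"
  shows "(\<integral>\<^sup>+x. ennreal (D x) * indicator S x \<partial>lborel) = emeasure lborel T"
proof -
  let ?S = "reindex ` S" and ?f = "\<lambda>x. reindex (f (unindex x))" and ?f' = "\<lambda>x v. reindex (f' (unindex x) (unindex v))"
  have vS: "reindex ` U = unindex -` U" for U :: "(real^'n) set"
    by (auto simp: image_iff) (metis reindex_unindex)
  have openr: "open (reindex ` U)" if "open U" for U :: "(real^'n) set"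
    unfolding vS using that by (intro open_vimage linear_continuous_on bounded_linear_unindex)
  have em: "emeasure lborel (reindex ` U) = emeasure lborel U" if "open U" for U :: "(real^'n) set"
    unfolding vS using that by (subst (2) distr_unindex[symmetric], subst emeasure_distr) auto
  have "reindex ` T = ?f ` ?S" by (auto simp: T(1)[symmetric] image_image)
  have fin: "emeasure lborel (reindex ` T) < \<infinity>" using em[OF T(2)] T(3) by simp
  have lm: "?f ` ?S \<in> lmeasurable"
    unfolding \<open>reindex ` T = ?f ` ?S\<close>[symmetric] using openr[OF T(2)] fin
    by (auto simp: fmeasurable_def)
  have "((\<lambda>x. \<bar>det (matrix (?f' x))\<bar>) has_integral measure lebesgue (?f ` ?S)) ?S"
  proof (rule has_measure_differentiable_image[THEN iffD1])
    show "?S \<in> sets lebesgue" using openr[OF S] by auto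
    show "(?f has_derivative ?f' x) (at x within ?S)" if "x \<in> ?S" for x
    proof -
      have "unindex x \<in> S" using that by auto
      have "(f has_derivative f' (unindex x)) (at (unindex x))" by (rule der) fact
      then have "((\<lambda>x. f (unindex x)) has_derivative (\<lambda>v. f' (unindex x) (unindex v))) (at x)"
        using has_derivative_compose[OF bounded_linear_imp_has_derivative[OF bounded_linear_unindex]] by blast
      then have "(?f has_derivative ?f' x) (at x)"
        by (rule bounded_linear.has_derivative[OF bounded_linear_reindex])
      then show ?thesis by (rule has_derivative_at_withinI)
    qed
    show "inj_on ?f ?S" using inj by (auto simp: inj_on_def) (metis unindex_reindex)
    show "?f ` ?S \<in> lmeasurable \<and> measure lebesgue (?f ` ?S) = measure lebesgue (?f ` ?S)" using lm by simp
  qed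
  moreover have "\<bar>det (matrix (?f' x))\<bar> = D (unindex x)" if "x \<in> ?S" for x
  proof -
    have xS: "unindex x \<in> S" using that by auto
    have "matrix (?f' x) = (\<chi> a b. matrix (f' (unindex x)) $ Rep_ordered_copy a $ Rep_ordered_copy b)"
      by (simp add: matrix_def reindex_def vec_eq_iff unindex_axis)
    then show ?thesis using D_eq[OF xS] det_reindex[of "matrix (f' (unindex x))"] by simp
  qed
  ultimately have "((\<lambda>x. D (unindex x)) has_integral measure lebesgue (?f ` ?S)) ?S"
    by (rule has_integral_eq_rhs[OF has_integral_eq[rotated]]) auto
  then have "((\<lambda>x. indicator S (unindex x) * D (unindex x)) has_integral measure lebesgue (?f ` ?S)) UNIV"
  proof -
    have "(\<lambda>x. indicator S (unindex x) * D (unindex x)) = (\<lambda>x. if x \<in> ?S then D (unindex x) else 0)"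
      by (auto simp: vS fun_eq_iff indicator_def)
    then show ?thesis using \<open>((\<lambda>x. D (unindex x)) has_integral _) ?S\<close> by (simp add: has_integral_restrict_UNIV)
  qed
  then have "(\<integral>\<^sup>+x. ennreal (indicator S (unindex x) * D (unindex x)) \<partial>lborel) = ennreal (measure lebesgue (?f ` ?S))"
  proof (rule nn_integral_has_integral_lborel[rotated 2])
    have [measurable]: "S \<in> sets borel" using S by simp
    show "(\<lambda>x. indicator S (unindex x) * D (unindex x)) \<in> borel_measurable borel" by measurable
  qed (auto simp: indicator_def D_eq)
  also have "measure lebesgue (?f ` ?S) = measure lborel (reindex ` T)"
    unfolding \<open>reindex ` T = ?f ` ?S\<close>[symmetric] using openr[OF T(2)] by (simp add: measure_completion)
  also have "ennreal (measure lborel (reindex ` T)) = emeasure lborel T"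
    using fin em[OF T(2)] by (subst emeasure_eq_ennreal_measure[symmetric]) auto
  also have "(\<integral>\<^sup>+x. ennreal (indicator S (unindex x) * D (unindex x)) \<partial>lborel) = (\<integral>\<^sup>+x. ennreal (indicator S x * D x) \<partial>distr lborel borel unindex)"
    using S by (subst nn_integral_distr) auto
  also have "\<dots> = (\<integral>\<^sup>+x. ennreal (D x) * indicator S x \<partial>lborel)"
    unfolding distr_unindex by (intro nn_integral_cong) (auto simp: indicator_def)
  finally show ?thesis .
qed

section \<open>Gauss maps\<close>

text \<open>Since \<open>X u\<close> and \<open>X y\<close> maximise their own functionals, the
  error of the linear approximation lies between 0 and \<open>(X y - X u) \<bullet> (y - u)\<close>.
  Continuity of the selection \<open>X\<close> at \<open>u\<close> is therefore enough. The lemma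
  serves for \<open>K\<close> and for \<open>polar K\<close>.\<close>

lemma support_has_derivative:
  fixes K :: "'a::euclidean_space set"
  assumes K: "origin_body K" and X: "\<And>u. u \<noteq> 0 \<Longrightarrow> X u \<in> K \<and> X u \<bullet> u = support_function K u"
    and cont: "isCont X u" and u: "u \<noteq> 0"
  shows "(support_function K has_derivative (\<lambda>v. X u \<bullet> v)) (at u)"
proof (rule has_derivativeI)
  show "bounded_linear (\<lambda>v. X u \<bullet> v)" by (rule bounded_linear_inner_right)
  have bound: "norm ((support_function K y - support_function K u - X u \<bullet> (y - u)) /\<^sub>R norm (y - u)) \<le> norm (X y - X u)"
    if y: "y \<noteq> 0" for y
  proof -
    have "X u \<bullet> y \<le> support_function K y" "X y \<bullet> u \<le> support_function K u"
      using inner_le_support[OF K] X u y by auto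
    then have "0 \<le> support_function K y - support_function K u - X u \<bullet> (y - u)"
      "support_function K y - support_function K u - X u \<bullet> (y - u) \<le> (X y - X u) \<bullet> (y - u)"
      using X[OF u] X[OF y] by (auto simp: inner_diff_right inner_diff_left)
    moreover have "(X y - X u) \<bullet> (y - u) \<le> norm (X y - X u) * norm (y - u)" by (rule norm_cauchy_schwarz)
    ultimately show ?thesis by (cases "y = u") (auto simp: field_simps)
  qed
  have "((\<lambda>y. norm (X y - X u)) \<longlongrightarrow> 0) (at u)"
    using cont by (simp add: isCont_def LIM_zero_iff tendsto_norm_zero_iff)
  moreover have "\<forall>\<^sub>F y in at u. y \<noteq> 0"
    using u by (simp add: eventually_neq_at_within)
  then have "\<forall>\<^sub>F y in at u. norm ((support_function K y - support_function K u - X u \<bullet> (y - u)) /\<^sub>R norm (y - u)) \<le> norm (X y - X u)"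
    by (rule eventually_mono) (rule bound)
  ultimately show "((\<lambda>y. (support_function K y - support_function K u - X u \<bullet> (y - u)) /\<^sub>R norm (y - u)) \<longlongrightarrow> 0) (at u)"
    by (rule Lim_null_comparison[rotated])
qed

lemma has_derivative_along_line:
  fixes f :: "'a::real_normed_vector \<Rightarrow> 'b::real_normed_vector"
  assumes "(f has_derivative f') (at x)"
  shows "((\<lambda>t::real. f (x + t *\<^sub>R v)) has_vector_derivative f' v) (at 0)"
proof -
  have "((\<lambda>t::real. x + t *\<^sub>R v) has_derivative (\<lambda>t. t *\<^sub>R v)) (at 0)"
    by (auto intro!: derivative_eq_intros)
  moreover have "(f has_derivative f') (at (x + 0 *\<^sub>R v))" using assms by simp
  ultimately have "((\<lambda>t::real. f (x + t *\<^sub>R v)) has_derivative (\<lambda>t. f' (t *\<^sub>R v))) (at 0)"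
    by (rule has_derivative_compose)
  then show ?thesis
    using linear_scale[OF has_derivative_linear[OF assms]] by (simp add: has_vector_derivative_def)
qed

lemma has_derivative_zero_of_minimum:
  fixes f :: "real \<Rightarrow> real"
  assumes "(f has_vector_derivative c) (at 0)" "f 0 = 0" "\<And>t. 0 \<le> t * f t"
  shows "0 \<le> c"
proof (rule ccontr)
  assume "\<not> 0 \<le> c"
  then have "c < 0" by simp
  have d: "(f has_real_derivative c) (at 0)"
    using assms(1) by (simp add: has_real_derivative_iff_has_vector_derivative)
  obtain e where e: "e > 0" "\<And>h. 0 < h \<Longrightarrow> h < e \<Longrightarrow> f (0 + h) < f 0"
    using DERIV_neg_dec_right[OF d \<open>c < 0\<close>] by blast
  have "f (e / 2) < 0" using e(2)[of "e / 2"] e(1) assms(2) by simp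
  then have "e / 2 * f (e / 2) < 0" using e(1) by (simp add: mult_pos_neg)
  then show False using assms(3)[of "e / 2"] by simp
qed

lemma continuous_det_matrix:
  fixes L :: "real \<Rightarrow> real^'n::finite \<Rightarrow> real^'n"
  assumes "\<And>v. continuous_on S (\<lambda>t. L t v)"
  shows "continuous_on S (\<lambda>t. det (matrix (L t)))"
  unfolding det_def matrix_def using assms
  by (auto intro!: continuous_intros)

text \<open>On the segment from the identity to \<open>L\<close>, all maps before the end point are
  injective, since their quadratic forms are positive on nonzero vectors. So the determinant keeps
  the sign it has at the identity, and the limit is nonnegative. This spares showing that the
  derivative of the inverse Gauss map is self-adjoint.\<close>

lemma det_nonneg_of_monotone:
  fixes L :: "real^'n::finite \<Rightarrow> real^'n"
  assumes L: "linear L" and mono: "\<And>v. 0 \<le> v \<bullet> L v"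
  shows "0 \<le> det (matrix L)"
proof -
  define q where "q t = det (matrix (\<lambda>v. (1 - t) *\<^sub>R v + t *\<^sub>R L v))" for t :: real
  have cont: "continuous_on UNIV q"
    unfolding q_def by (intro continuous_det_matrix continuous_intros)
  have nz: "q t \<noteq> 0" if t: "0 \<le> t" "t < 1" for t
  proof -
    let ?F = "\<lambda>v. (1 - t) *\<^sub>R v + t *\<^sub>R L v"
    have lin: "linear ?F" using L by (intro linearI) (auto simp: linear_add linear_scale algebra_simps)
    have "v = 0" if "?F v = 0" for v
    proof -
      have "v \<bullet> ?F v = 0" using that by simp
      then have "(1 - t) * (v \<bullet> v) + t * (v \<bullet> L v) = 0" by (simp add: inner_add_right)
      moreover have "0 \<le> t * (v \<bullet> L v)" "0 \<le> (1 - t) * (v \<bullet> v)" using mono[of v] t by auto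
      ultimately have "(1 - t) * (v \<bullet> v) = 0" by linarith
      then show "v = 0" using t by simp
    qed
    then have "inj ?F" using lin linear_injective_0 by blast
    then show ?thesis
      using lin det_nz_iff_inj unfolding q_def by blast
  qed
  have q0: "q 0 = 1"
  proof -
    have "matrix (\<lambda>v::real^'n. v) = mat 1" using matrix_id_mat_1 by (simp add: id_def)
    then show ?thesis by (simp add: q_def)
  qed
  have pos: "q t > 0" if t: "0 \<le> t" "t < 1" for t
  proof (rule ccontr)
    assume "\<not> q t > 0"
    then have "\<exists>s. 0 \<le> s \<and> s \<le> t \<and> q s = 0"
      using IVT2[of q t 0 0] q0 t cont by (auto simp: continuous_on_eq_continuous_at)
    then show False using nz t by force
  qed
  have "(q \<longlongrightarrow> q 1) (at_left 1)"
    using cont by (simp add: continuous_on_def filterlim_at_split)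
  moreover have "\<forall>\<^sub>F t in at_left 1. 0 \<le> q t"
    using eventually_at_left_real[of 0 1] by (rule eventually_mono) (use pos in \<open>auto intro: less_imp_le\<close>)
  ultimately have "0 \<le> q 1" by (intro tendsto_lowerbound) auto
  then show ?thesis by (simp add: q_def)
qed

text \<open>The Gauss map \<nu> and its inverse \<open>X\<close>, extended to the punctured space by
  homogeneity of degree 0. Thus ordinary derivatives replace derivatives within the boundary or the
  sphere, and the formulation passes to the polar body by \<open>gauss_pair_polar\<close>.\<close>

locale gauss_pair =
  fixes K :: "(real^'n::finite) set" and \<nu> X :: "real^'n \<Rightarrow> real^'n"
  assumes body: "origin_body K"
    and \<nu>_diff: "x \<noteq> 0 \<Longrightarrow> \<nu> differentiable (at x)" and X_diff: "x \<noteq> 0 \<Longrightarrow> X differentiable (at x)"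
    and \<nu>_scale: "c > 0 \<Longrightarrow> \<nu> (c *\<^sub>R x) = \<nu> x" and X_scale: "c > 0 \<Longrightarrow> X (c *\<^sub>R x) = X x"
    and normal_iff: "x \<in> frontier K \<Longrightarrow> outer_unit_normal K x u \<longleftrightarrow> u = \<nu> x"
    and point_iff: "norm u = 1 \<Longrightarrow> x \<in> frontier K \<and> outer_unit_normal K x u \<longleftrightarrow> x = X u"
begin

abbreviation "h \<equiv> support_function K"
abbreviation "g \<equiv> support_function (polar K)"

lemmas polar_body = origin_body_polar[OF body]

lemma frontier_in: "x \<in> frontier K \<Longrightarrow> x \<in> K"
  using frontier_subset_closed[OF origin_body_D(6)[OF body]] by blast

lemma g_scale: "c \<ge> 0 \<Longrightarrow> g (c *\<^sub>R x) = c * g x" and h_scale: "c \<ge> 0 \<Longrightarrow> h (c *\<^sub>R x) = c * h x"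
  using support_scale body polar_body by blast+

lemma g_pos: "x \<noteq> 0 \<Longrightarrow> g x > 0" and h_pos: "x \<noteq> 0 \<Longrightarrow> h x > 0"
  using support_pos body polar_body by blast+

lemma frontier_iff: "x \<in> frontier K \<longleftrightarrow> g x = 1"
  by (rule frontier_body_iff[OF body])

lemma frontier_nz: "x \<in> frontier K \<Longrightarrow> x \<noteq> 0"
  using frontier_iff support_0[OF polar_body] by auto

lemma radial_frontier: "x \<noteq> 0 \<Longrightarrow> x /\<^sub>R g x \<in> frontier K"
  using g_pos[of x] by (simp add: frontier_iff g_scale)

lemma normalD:
  assumes "x \<in> frontier K" shows "norm (\<nu> x) = 1" "x \<bullet> \<nu> x = h (\<nu> x)"
  using normal_iff[OF assms, of "\<nu> x"] outer_unit_normal_iff[OF body frontier_in[OF assms], of "\<nu> x"] by auto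

lemma X_unit:
  assumes "norm u = 1" shows "X u \<in> frontier K" "X u \<bullet> u = h u" "\<nu> (X u) = u"
proof -
  have *: "X u \<in> frontier K" "outer_unit_normal K (X u) u" using point_iff[OF assms, of "X u"] by auto
  then show "X u \<in> frontier K" by simp
  show "X u \<bullet> u = h u" using outer_unit_normal_iff[OF body frontier_in] * by blast
  show "\<nu> (X u) = u" using normal_iff[OF *(1), of u] *(2) by simp
qed

lemma X_nz:
  assumes "u \<noteq> 0" shows "X u \<in> frontier K" "X u \<bullet> u = h u" "\<nu> (X u) = u /\<^sub>R norm u"
proof -
  have X: "X (u /\<^sub>R norm u) = X u" using assms by (intro X_scale) simp
  have n: "norm (u /\<^sub>R norm u) = 1" using assms by simp
  show "X u \<in> frontier K" "\<nu> (X u) = u /\<^sub>R norm u" using X_unit[OF n] X by auto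
  show "X u \<bullet> u = h u" using X_unit(2)[OF n] X assms by (simp add: h_scale field_simps)
qed

lemma \<nu>_radial: "x \<noteq> 0 \<Longrightarrow> \<nu> (x /\<^sub>R g x) = \<nu> x"
  using g_pos[of x] by (intro \<nu>_scale) simp

lemma \<nu>_norm: "x \<noteq> 0 \<Longrightarrow> norm (\<nu> x) = 1"
  using normalD(1)[OF radial_frontier] \<nu>_radial by simp

lemma \<nu>_nz: "x \<noteq> 0 \<Longrightarrow> \<nu> x \<noteq> 0"
  using \<nu>_norm[of x] by auto

lemma X_\<nu>:
  assumes "x \<noteq> 0" shows "X (\<nu> x) = x /\<^sub>R g x"
proof -
  have "outer_unit_normal K (x /\<^sub>R g x) (\<nu> x)"
    using normal_iff[OF radial_frontier[OF assms]] \<nu>_radial[OF assms] by simp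
  then show ?thesis using point_iff[OF \<nu>_norm[OF assms]] radial_frontier[OF assms] by metis
qed

lemma \<nu>_inner: "x \<noteq> 0 \<Longrightarrow> \<nu> x \<bullet> x = g x * h (\<nu> x)"
  using X_nz(2)[OF \<nu>_nz, of x] g_pos[of x] by (simp add: X_\<nu> inner_commute field_simps)

lemma h_has_derivative: "u \<noteq> 0 \<Longrightarrow> (h has_derivative (\<lambda>v. X u \<bullet> v)) (at u)"
  using X_nz frontier_in X_diff differentiable_imp_continuous_within[of X u UNIV]
  by (intro support_has_derivative[OF body]) auto

text \<open>The gradient of the gauge at \<open>x\<close> is the boundary point of
  \<open>polar K\<close> whose outer normal has the direction of \<open>x\<close>.\<close>

lemma g_has_derivative:
  assumes "x \<noteq> 0" shows "(g has_derivative (\<lambda>v. (\<nu> x /\<^sub>R h (\<nu> x)) \<bullet> v)) (at x)"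
proof (rule support_has_derivative[OF polar_body _ _ assms])
  fix y :: "real^'n" assume y: "y \<noteq> 0"
  show "\<nu> y /\<^sub>R h (\<nu> y) \<in> polar K \<and> (\<nu> y /\<^sub>R h (\<nu> y)) \<bullet> y = g y"
    using h_pos[OF \<nu>_nz[OF y]] \<nu>_inner[OF y] by (simp add: mem_polar_iff[OF body] h_scale)
next
  have "isCont \<nu> x" using \<nu>_diff[OF assms] by (rule differentiable_imp_continuous_within)
  moreover have "isCont (\<lambda>x. h (\<nu> x)) x"
    using \<open>isCont \<nu> x\<close> continuous_support[OF body, of UNIV] by (simp add: continuous_on_eq_continuous_at isCont_o2)
  ultimately show "isCont (\<lambda>y. \<nu> y /\<^sub>R h (\<nu> y)) x"
    using h_pos[OF \<nu>_nz[OF assms]] by (intro continuous_intros) auto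
qed

lemma gauss_map_eq: "x \<in> frontier K \<Longrightarrow> gauss_map K x = \<nu> x"
  unfolding gauss_map_def by (rule the_equality) (auto simp: normal_iff)

end

text \<open>Along tangent vectors, a derivative within the boundary is computed by the curve
  \<open>t \<mapsto> (x + t \<tau>) / g (x + t \<tau>)\<close>, which stays in the boundary.\<close>

lemma derivative_within_frontier_unique:
  fixes K :: "'a::euclidean_space set"
  assumes K: "origin_body K" and x: "x \<in> frontier K"
    and g: "(support_function (polar K) has_derivative (\<lambda>v. N \<bullet> v)) (at x)" and \<tau>: "N \<bullet> \<tau> = 0"
    and W: "(f has_derivative W) (at x within frontier K)" "(f has_derivative W') (at x within frontier K)"
  shows "W \<tau> = W' \<tau>"
proof -
  let ?g = "support_function (polar K)"
  define \<gamma> where "\<gamma> t = (x + t *\<^sub>R \<tau>) /\<^sub>R ?g (x + t *\<^sub>R \<tau>)" for t :: real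
  have gx: "?g x = 1" using x frontier_body_iff[OF K] by simp
  have x0: "x \<noteq> 0" using gx support_0[OF origin_body_polar[OF K]] by auto
  have gl: "((\<lambda>t. ?g (x + t *\<^sub>R \<tau>)) has_derivative (\<lambda>t. 0)) (at 0)"
    using has_derivative_along_line[OF g, of \<tau>] \<tau> by (simp add: has_vector_derivative_def)
  have \<gamma>: "(\<gamma> has_derivative (\<lambda>t. t *\<^sub>R \<tau>)) (at 0)"
    unfolding \<gamma>_def by (rule derivative_eq_intros refl gl | simp add: gx)+
  define A where "A = {t. x + t *\<^sub>R \<tau> \<noteq> 0}"
  have "open A" unfolding A_def by (intro open_Collect_neq continuous_intros)
  have A0: "0 \<in> A" using x0 by (simp add: A_def)
  have sub: "\<gamma> ` A \<subseteq> frontier K"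
  proof safe
    fix t assume "t \<in> A"
    then have "?g (x + t *\<^sub>R \<tau>) > 0" using support_pos[OF origin_body_polar[OF K]] by (simp add: A_def)
    then show "\<gamma> t \<in> frontier K"
      unfolding \<gamma>_def by (simp add: frontier_body_iff[OF K] support_scale[OF origin_body_polar[OF K]])
  qed
  have \<gamma>0: "\<gamma> 0 = x" by (simp add: \<gamma>_def gx)
  have "((\<lambda>t. f (\<gamma> t)) has_derivative (\<lambda>t. V (t *\<^sub>R \<tau>))) (at 0)"
    if "(f has_derivative V) (at x within frontier K)" for V
  proof -
    have "(f has_derivative V) (at (\<gamma> 0) within \<gamma> ` A)"
      using has_derivative_subset[OF that sub] \<gamma>0 by simp
    then have "((\<lambda>t. f (\<gamma> t)) has_derivative (\<lambda>t. V (t *\<^sub>R \<tau>))) (at 0 within A)"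
      using has_derivative_in_compose[OF has_derivative_at_withinI[OF \<gamma>]] by blast
    then show ?thesis using at_within_open[OF A0 \<open>open A\<close>] by simp
  qed
  from has_derivative_unique[OF this[OF W(1)] this[OF W(2)]]
  have "W (1 *\<^sub>R \<tau>) = W' (1 *\<^sub>R \<tau>)" by metis
  then show ?thesis by simp
qed

text \<open>The definite description is unambiguous: the determinant uses \<open>W\<close> only on
  vectors orthogonal to \<open>u\<close>, that is, tangent to the boundary by the hypothesis on the
  gradient of the gauge, and there all derivatives within the boundary agree.\<close>

lemma gauss_curvature_eqI:
  fixes K :: "(real^'n::finite) set"
  assumes K: "origin_body K" and x: "x \<in> frontier K" and u: "gauss_map K x = u"
    and g: "(support_function (polar K) has_derivative (\<lambda>v. (c *\<^sub>R u) \<bullet> v)) (at x)" and nu: "norm u = 1"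
    and W: "(gauss_map K has_derivative W) (at x within frontier K)"
  shows "gauss_curvature K x = det (matrix (\<lambda>v. W (v - (v \<bullet> u) *\<^sub>R u) + (v \<bullet> u) *\<^sub>R u))"
  unfolding gauss_curvature_def u Let_def
proof (rule the_equality)
  fix k assume "\<exists>W. (gauss_map K has_derivative W) (at x within frontier K) \<and> k = det (matrix (\<lambda>v. W (v - (v \<bullet> u) *\<^sub>R u) + (v \<bullet> u) *\<^sub>R u))"
  then obtain W' where W': "(gauss_map K has_derivative W') (at x within frontier K)"
    "k = det (matrix (\<lambda>v. W' (v - (v \<bullet> u) *\<^sub>R u) + (v \<bullet> u) *\<^sub>R u))" by blast
  have "W' (v - (v \<bullet> u) *\<^sub>R u) = W (v - (v \<bullet> u) *\<^sub>R u)" for v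
  proof (rule derivative_within_frontier_unique[OF K x g _ W'(1) W])
    show "c *\<^sub>R u \<bullet> (v - (v \<bullet> u) *\<^sub>R u) = 0"
      using nu by (simp add: inner_diff_right inner_commute power2_norm_eq_inner[symmetric])
  qed
  then show "k = det (matrix (\<lambda>v. W (v - (v \<bullet> u) *\<^sub>R u) + (v \<bullet> u) *\<^sub>R u))" using W'(2) by simp
qed (use W in blast)

section \<open>The curvature function\<close>

lemma has_derivative_norm_at:
  fixes u :: "'a::real_inner"
  assumes "u \<noteq> 0"
  shows "(norm has_derivative (\<lambda>v. (u \<bullet> v) / norm u)) (at u)"
proof -
  have "(norm has_derivative (\<lambda>v. v \<bullet> sgn u)) (at u)" using has_derivative_norm[OF assms] .
  then show ?thesis by (simp add: sgn_div_norm inner_commute divide_inverse mult.commute)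
qed

context gauss_pair
begin

definition X' :: "real^'n \<Rightarrow> real^'n \<Rightarrow> real^'n" where "X' u = frechet_derivative X (at u)"
definition \<nu>' :: "real^'n \<Rightarrow> real^'n \<Rightarrow> real^'n" where "\<nu>' x = frechet_derivative \<nu> (at x)"
text \<open>At a unit vector \<open>u\<close>, the derivative of the inverse Gauss map on the
  tangent space, extended by \<open>u \<mapsto> u\<close> exactly as the Weingarten map is in
  \<open>gauss_curvature\<close>; \<open>X' u\<close> itself annihilates \<open>u\<close>.\<close>

definition A :: "real^'n \<Rightarrow> real^'n \<Rightarrow> real^'n" where "A u v = X' u v + (u \<bullet> v) *\<^sub>R u"

lemma X_der: "u \<noteq> 0 \<Longrightarrow> (X has_derivative X' u) (at u)"
  unfolding X'_def using X_diff frechet_derivative_works by blast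

lemma \<nu>_der: "x \<noteq> 0 \<Longrightarrow> (\<nu> has_derivative \<nu>' x) (at x)"
  unfolding \<nu>'_def using \<nu>_diff frechet_derivative_works by blast

lemma linear_X': "u \<noteq> 0 \<Longrightarrow> linear (X' u)" and linear_\<nu>': "u \<noteq> 0 \<Longrightarrow> linear (\<nu>' u)"
  using X_der \<nu>_der has_derivative_linear by blast+

lemma linear_A: "u \<noteq> 0 \<Longrightarrow> linear (A u)"
  unfolding A_def using linear_X' by (intro linearI) (auto simp: linear_add linear_scale inner_add_right algebra_simps)

lemma X'_radial:
  assumes "u \<noteq> 0" shows "X' u u = 0"
proof -
  have "((\<lambda>t. X (u + t *\<^sub>R u)) has_vector_derivative X' u u) (at 0)"
    by (rule has_derivative_along_line[OF X_der[OF assms]])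
  moreover have "((\<lambda>t. X (u + t *\<^sub>R u)) has_vector_derivative 0) (at 0)"
  proof (rule has_vector_derivative_transform_within_open[OF has_vector_derivative_const, where S="{-1<..}"])
    show "X u = X (u + t *\<^sub>R u)" if "t \<in> {-1<..}" for t
      using X_scale[of "1 + t" u] that by (simp add: scaleR_add_left)
  qed auto
  ultimately show ?thesis by (rule vector_derivative_unique_at)
qed

text \<open>Two derivatives of \<open>X u \<bullet> u = h u\<close> are compared: the product rule
  and the gradient \<open>X u\<close> of \<open>h\<close>.\<close>

lemma inner_X':
  assumes u: "u \<noteq> 0" shows "X' u v \<bullet> u = 0"
proof -
  have "((\<lambda>u. X u \<bullet> u) has_derivative (\<lambda>v. X u \<bullet> v + X' u v \<bullet> u)) (at u)"
    by (rule has_derivative_inner[OF X_der[OF u] has_derivative_ident])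
  moreover have "((\<lambda>u. X u \<bullet> u) has_derivative (\<lambda>v. X u \<bullet> v)) (at u)"
    by (rule has_derivative_transform_within_open[OF h_has_derivative[OF u], where s="- {0}"])
      (use u X_nz(2) in auto)
  ultimately have "(\<lambda>v. X u \<bullet> v + X' u v \<bullet> u) = (\<lambda>v. X u \<bullet> v)" by (rule has_derivative_unique)
  then show ?thesis by (metis add_cancel_right_right)
qed

lemma inner_\<nu>':
  assumes x: "x \<noteq> 0" shows "\<nu>' x v \<bullet> \<nu> x = 0"
proof -
  have "((\<lambda>x. \<nu> x \<bullet> \<nu> x) has_derivative (\<lambda>v. \<nu> x \<bullet> \<nu>' x v + \<nu>' x v \<bullet> \<nu> x)) (at x)"
    by (rule has_derivative_inner[OF \<nu>_der[OF x] \<nu>_der[OF x]])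
  moreover have "((\<lambda>x. \<nu> x \<bullet> \<nu> x) has_derivative (\<lambda>v. 0)) (at x)"
  proof (rule has_derivative_transform_within_open[OF has_derivative_const, where s="- {0}"])
    show "1 = \<nu> y \<bullet> \<nu> y" if "y \<in> - {0}" for y
      using \<nu>_norm[of y] that by (simp add: power2_norm_eq_inner[symmetric])
  qed (use x in auto)
  ultimately have "(\<lambda>v. \<nu> x \<bullet> \<nu>' x v + \<nu>' x v \<bullet> \<nu> x) = (\<lambda>v. 0)" by (rule has_derivative_unique)
  then have "\<nu> x \<bullet> \<nu>' x v + \<nu>' x v \<bullet> \<nu> x = 0" by metis
  then show ?thesis by (simp add: inner_commute)
qed

text \<open>Differentiate the identity \<open>X (\<nu> y) = y /\<^sub>R g y\<close> at
  \<open>y = X u\<close>. On vectors orthogonal to \<open>u\<close> the derivative of the gauge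
  vanishes, so the right side contributes the identity.\<close>

lemma X'_\<nu>':
  assumes u: "norm u = 1" and v: "u \<bullet> v = 0"
  shows "X' u (\<nu>' (X u) v) = v"
proof -
  let ?x = "X u"
  have x: "?x \<in> frontier K" "\<nu> ?x = u" "g ?x = 1" using X_unit[OF u] frontier_iff by auto
  have x0: "?x \<noteq> 0" using frontier_nz[OF x(1)] .
  have u0: "u \<noteq> 0" using u by auto
  have "((\<lambda>y. X (\<nu> y)) has_derivative (\<lambda>v. X' u (\<nu>' ?x v))) (at ?x)"
    using has_derivative_compose[OF \<nu>_der[OF x0], of X "X' u"] X_der[OF u0] x(2) by simp
  moreover have gd: "(g has_derivative (\<lambda>v. (u /\<^sub>R h u) \<bullet> v)) (at ?x)" using g_has_derivative[OF x0] x(2) by simp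
  have "((\<lambda>y. y /\<^sub>R g y) has_derivative (\<lambda>v. v - ((u /\<^sub>R h u) \<bullet> v) *\<^sub>R ?x)) (at ?x)"
    by (rule derivative_eq_intros refl gd | simp add: x(3))+
  then have "((\<lambda>y. X (\<nu> y)) has_derivative (\<lambda>v. v - ((u /\<^sub>R h u) \<bullet> v) *\<^sub>R ?x)) (at ?x)"
    by (rule has_derivative_transform_within_open[where s="- {0}"]) (use x0 X_\<nu> in auto)
  ultimately have "(\<lambda>v. X' u (\<nu>' ?x v)) = (\<lambda>v. v - ((u /\<^sub>R h u) \<bullet> v) *\<^sub>R ?x)" by (rule has_derivative_unique)
  then have "X' u (\<nu>' ?x v) = v - ((u /\<^sub>R h u) \<bullet> v) *\<^sub>R ?x" by metis
  then show ?thesis using v by simp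
qed

text \<open>\<open>A u\<close> inverts the extended Weingarten map, so the reciprocal of the Gauss
  curvature is its determinant. Positivity comes from the monotonicity of \<open>X\<close>: each
  value of \<open>X\<close> maximises its own functional over \<open>K\<close>, so the difference of
  two values has nonnegative inner product with the difference of the arguments, and
  \<open>det_nonneg_of_monotone\<close> applies.\<close>

lemma curvature_function_eq:
  assumes u: "norm u = 1"
  shows "curvature_function K u = det (matrix (A u))" and "0 < det (matrix (A u))"
proof -
  let ?x = "X u"
  have x: "?x \<in> frontier K" "\<nu> ?x = u" "g ?x = 1" using X_unit[OF u] frontier_iff by auto
  have x0: "?x \<noteq> 0" using frontier_nz[OF x(1)] .
  have u0: "u \<noteq> 0" using u by auto
  have uu: "u \<bullet> u = 1" using u by (simp add: power2_norm_eq_inner[symmetric])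
  define B where "B v = \<nu>' ?x (v - (v \<bullet> u) *\<^sub>R u) + (v \<bullet> u) *\<^sub>R u" for v
  have linB: "linear B" unfolding B_def using linear_\<nu>'[OF x0]
    by (intro linearI) (auto simp: linear_add linear_diff linear_scale inner_add_left algebra_simps)
  have "(gauss_map K has_derivative \<nu>' ?x) (at ?x within frontier K)"
    by (rule has_derivative_transform[OF x(1) gauss_map_eq has_derivative_at_withinI[OF \<nu>_der[OF x0]]])
  then have "gauss_curvature K ?x = det (matrix B)"
    unfolding B_def using gauss_map_eq[OF x(1)] x(2) g_has_derivative[OF x0] u
    by (intro gauss_curvature_eqI[OF body x(1), where c="inverse (h u)"]) auto
  moreover have "curvature_function K u = 1 / gauss_curvature K ?x"
    unfolding curvature_function_def using point_iff[OF u] by simp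
  moreover have AB: "A u (B v) = v" for v
  proof -
    have uv: "u \<bullet> (v - (v \<bullet> u) *\<^sub>R u) = 0" by (simp add: inner_diff_right uu inner_commute)
    have uB: "u \<bullet> B v = v \<bullet> u"
      using inner_\<nu>'[OF x0, of "v - (v \<bullet> u) *\<^sub>R u"] x(2) uu by (simp add: B_def inner_add_right inner_commute)
    have "X' u (B v) = v - (v \<bullet> u) *\<^sub>R u"
      unfolding B_def using X'_\<nu>'[OF u uv] linear_X'[OF u0] X'_radial[OF u0] by (simp add: linear_add linear_scale)
    then show ?thesis by (simp add: A_def uB)
  qed
  have "det (matrix (\<lambda>v. A u (B v))) = det (matrix (A u)) * det (matrix B)"
    by (rule det_compose[OF linear_A[OF u0] linB])
  moreover have "matrix (\<lambda>v::real^'n. v) = mat 1" using matrix_id_mat_1 by (simp add: id_def)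
  ultimately have 1: "det (matrix (A u)) * det (matrix B) = 1" unfolding AB by simp
  then show "curvature_function K u = det (matrix (A u))"
    using \<open>gauss_curvature K ?x = det (matrix B)\<close> \<open>curvature_function K u = 1 / gauss_curvature K ?x\<close>
    by (metis mult_eq_0_iff nonzero_eq_divide_eq zero_neq_one)
  have "0 \<le> det (matrix (A u))"
  proof (rule det_nonneg_of_monotone[OF linear_A[OF u0]])
    fix v
    have "0 \<le> X' u v \<bullet> v"
    proof (rule has_derivative_zero_of_minimum)
      have "((\<lambda>t. X (u + t *\<^sub>R v)) has_vector_derivative X' u v) (at 0)"
        by (rule has_derivative_along_line[OF X_der[OF u0]])
      then have "((\<lambda>t. (X (u + t *\<^sub>R v) - X u) \<bullet> v) has_derivative (\<lambda>t. (t *\<^sub>R X' u v - 0) \<bullet> v)) (at 0)"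
        unfolding has_vector_derivative_def
        by (intro has_derivative_inner_left has_derivative_diff has_derivative_const)
      then have d: "((\<lambda>t. (X (u + t *\<^sub>R v) - X u) \<bullet> v) has_vector_derivative X' u v \<bullet> v) (at 0)"
        by (simp add: has_vector_derivative_def)
      \<comment> \<open>\<open>X\<close> has no prescribed value at 0. The function is set to 0
        where \<open>u + t *\<^sub>R v\<close> vanishes, so that the sign condition holds for every
        \<open>t\<close>; near \<open>t = 0\<close> nothing changes.\<close>
      show "((\<lambda>t. (if u + t *\<^sub>R v = 0 then 0 else (X (u + t *\<^sub>R v) - X u) \<bullet> v)) has_vector_derivative X' u v \<bullet> v) (at 0)"
      proof (rule has_vector_derivative_transform_within_open[OF d, where S="{t. u + t *\<^sub>R v \<noteq> 0}"])
        show "open {t. u + t *\<^sub>R v \<noteq> 0}" by (intro open_Collect_neq continuous_intros)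
      qed (use u0 in auto)
      show "(if u + 0 *\<^sub>R v = 0 then 0 else (X (u + 0 *\<^sub>R v) - X u) \<bullet> v) = 0" by simp
      fix t :: real
      show "0 \<le> t * (if u + t *\<^sub>R v = 0 then 0 else (X (u + t *\<^sub>R v) - X u) \<bullet> v)"
      proof (cases "u + t *\<^sub>R v = 0")
        case False
        let ?y = "X (u + t *\<^sub>R v)"
        have y: "?y \<in> frontier K" "?y \<bullet> (u + t *\<^sub>R v) = h (u + t *\<^sub>R v)" using X_nz[OF False] by auto
        have "?y \<bullet> u \<le> ?x \<bullet> u" using inner_le_support[OF body frontier_in[OF y(1)], of u] X_unit(2)[OF u] by simp
        moreover have "?x \<bullet> (u + t *\<^sub>R v) \<le> ?y \<bullet> (u + t *\<^sub>R v)"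
          using inner_le_support[OF body frontier_in[OF x(1)], of "u + t *\<^sub>R v"] y(2) by simp
        ultimately have "0 \<le> t * ((?y - ?x) \<bullet> v)"
          by (simp add: inner_add_right inner_diff_left algebra_simps)
        then show ?thesis using False by simp
      qed simp
    qed
    then show "0 \<le> v \<bullet> A u v" by (simp add: A_def inner_add_right inner_commute)
  qed
  moreover have "det (matrix (A u)) \<noteq> 0" using 1 by auto
  ultimately show "0 < det (matrix (A u))" by simp
qed

text \<open>The operator is \<open>A u\<close> after a rank one update of the identity: with
  \<open>A u z = X u - u\<close>, it is
  \<open>v \<mapsto> A u (v + (u \<bullet> v) *\<^sub>R z)\<close>. As \<open>X' u\<close> has
  tangential values, \<open>u \<bullet> z = h u - 1\<close>, and the update contributes the factor
  \<open>h u\<close>.\<close>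

lemma det_mixed:
  assumes u: "norm u = 1"
  shows "det (matrix (\<lambda>v. X' u v + (u \<bullet> v) *\<^sub>R X u)) = h u * curvature_function K u"
proof -
  have u0: "u \<noteq> 0" using u by auto
  have uu: "u \<bullet> u = 1" using u by (simp add: power2_norm_eq_inner[symmetric])
  have "inj (A u)" using curvature_function_eq(2)[OF u] det_nz_iff_inj[OF linear_A[OF u0]] by simp
  then have "surj (A u)" using linear_injective_imp_surjective[OF linear_A[OF u0]] by simp
  then obtain z where z: "A u z = X u - u" by (metis surjD)
  have "u \<bullet> A u z = u \<bullet> z" using inner_X'[OF u0, of z] by (simp add: A_def inner_add_right uu inner_commute)
  then have uz: "u \<bullet> z = h u - 1" using X_unit(2)[OF u] by (simp add: z inner_diff_right uu inner_commute)
  have "X' u v + (u \<bullet> v) *\<^sub>R X u = A u (v + (u \<bullet> v) *\<^sub>R z)" for v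
    using linear_A[OF u0] by (simp add: linear_add linear_scale z) (simp add: A_def algebra_simps)
  then have "det (matrix (\<lambda>v. X' u v + (u \<bullet> v) *\<^sub>R X u)) = det (matrix (\<lambda>v. A u (v + (u \<bullet> v) *\<^sub>R z)))" by simp
  also have "\<dots> = det (matrix (A u)) * det (matrix (\<lambda>v. v + (u \<bullet> v) *\<^sub>R z))"
    by (rule det_compose[OF linear_A[OF u0]]) (auto intro!: linearI simp: inner_add_right algebra_simps)
  also have "\<dots> = h u * curvature_function K u"
    unfolding det_rank_one_update uz curvature_function_eq(1)[OF u] by simp
  finally show ?thesis .
qed

definition \<Phi> :: "real^'n \<Rightarrow> real^'n" where "\<Phi> y = norm y *\<^sub>R X y"
definition \<Phi>' :: "real^'n \<Rightarrow> real^'n \<Rightarrow> real^'n" where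
  "\<Phi>' y v = X' (y /\<^sub>R norm y) v + ((y /\<^sub>R norm y) \<bullet> v) *\<^sub>R X (y /\<^sub>R norm y)"

text \<open>The derivative is computed at the unit vector and transported: \<Phi> is homogeneous of
  degree 1, so its derivative is homogeneous of degree 0, which explains the form of
  \<open>\<Phi>'\<close>.\<close>

lemma \<Phi>_der:
  assumes y: "y \<noteq> 0" shows "(\<Phi> has_derivative \<Phi>' y) (at y)"
proof -
  define u where "u = y /\<^sub>R norm y"
  have nu: "norm u = 1" "u \<noteq> 0" using y by (auto simp: u_def)
  have 1: "(\<Phi> has_derivative (\<lambda>v. norm u *\<^sub>R X' u v + ((u \<bullet> v) / norm u) *\<^sub>R X u)) (at u)"
    unfolding \<Phi>_def by (rule has_derivative_scaleR[OF has_derivative_norm_at[OF nu(2)] X_der[OF nu(2)]])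
  have "((\<lambda>z. z /\<^sub>R norm y) has_derivative (\<lambda>v. v /\<^sub>R norm y)) (at y)"
    by (auto intro!: derivative_eq_intros)
  moreover have "(\<Phi> has_derivative (\<lambda>v. norm u *\<^sub>R X' u v + ((u \<bullet> v) / norm u) *\<^sub>R X u)) (at (y /\<^sub>R norm y))"
    using 1 unfolding u_def .
  ultimately have "((\<lambda>z. \<Phi> (z /\<^sub>R norm y)) has_derivative (\<lambda>v. norm u *\<^sub>R X' u (v /\<^sub>R norm y) + ((u \<bullet> (v /\<^sub>R norm y)) / norm u) *\<^sub>R X u)) (at y)"
    by (rule has_derivative_compose)
  then have "((\<lambda>z. norm y *\<^sub>R \<Phi> (z /\<^sub>R norm y)) has_derivative (\<lambda>v. norm y *\<^sub>R (norm u *\<^sub>R X' u (v /\<^sub>R norm y) + ((u \<bullet> (v /\<^sub>R norm y)) / norm u) *\<^sub>R X u))) (at y)"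
    by (rule has_derivative_scaleR_right)
  moreover have "norm y *\<^sub>R \<Phi> (z /\<^sub>R norm y) = \<Phi> z" for z
    using y X_scale[of "inverse (norm y)" z] by (simp add: \<Phi>_def)
  moreover have "norm y *\<^sub>R (norm u *\<^sub>R X' u (v /\<^sub>R norm y) + ((u \<bullet> (v /\<^sub>R norm y)) / norm u) *\<^sub>R X u) = \<Phi>' y v" for v
    using y linear_X'[OF nu(2)] nu(1) by (simp add: \<Phi>'_def u_def[symmetric] linear_scale algebra_simps)
  ultimately show ?thesis by simp
qed

lemma det_\<Phi>':
  assumes "y \<noteq> 0"
  shows "det (matrix (\<Phi>' y)) = h (y /\<^sub>R norm y) * curvature_function K (y /\<^sub>R norm y)"
  unfolding \<Phi>'_def using assms by (intro det_mixed) simp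

text \<open>The inverse is \<open>x \<mapsto> g x *\<^sub>R \<nu> x\<close>: \<Phi> turns the norm
  into the gauge.\<close>

lemma \<Phi>_image: "\<Phi> ` (ball 0 1 - {0}) = interior K - {0}"
proof (intro equalityI subsetI)
  fix x assume "x \<in> \<Phi> ` (ball 0 1 - {0})"
  then obtain y where "y \<in> ball 0 1 - {0}" "x = \<Phi> y" by blast
  then have y: "x = \<Phi> y" "norm y < 1" "y \<noteq> 0" by auto
  have f: "X y \<in> frontier K" using X_nz(1)[OF y(3)] .
  have "g x = norm y" using f y(1) by (simp add: \<Phi>_def g_scale frontier_iff)
  then show "x \<in> interior K - {0}" using y interior_body_iff[OF body] support_0[OF polar_body] by auto
next
  fix x assume x: "x \<in> interior K - {0}"
  let ?y = "g x *\<^sub>R \<nu> x"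
  have g: "g x > 0" "g x < 1" using x g_pos interior_body_iff[OF body] by auto
  have "norm ?y = g x" using x \<nu>_norm g by simp
  moreover have "\<Phi> ?y = x" using x g X_\<nu>[of x] \<nu>_norm[of x] by (simp add: \<Phi>_def X_scale)
  ultimately show "x \<in> \<Phi> ` (ball 0 1 - {0})" using g by (intro image_eqI[of _ _ ?y]) auto
qed

lemma inj_\<Phi>: "inj_on \<Phi> (- {0})"
proof (rule inj_on_inverseI[of _ "\<lambda>x. g x *\<^sub>R \<nu> x"])
  fix y :: "real^'n" assume "y \<in> - {0}"
  then have y: "y \<noteq> 0" by simp
  have f: "X y \<in> frontier K" using X_nz(1)[OF y] .
  have "g (\<Phi> y) = norm y" using f by (simp add: \<Phi>_def g_scale frontier_iff)
  moreover have "\<nu> (\<Phi> y) = y /\<^sub>R norm y" using y X_nz(3)[OF y] by (simp add: \<Phi>_def \<nu>_scale)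
  ultimately show "g (\<Phi> y) *\<^sub>R \<nu> (\<Phi> y) = y" using y by simp
qed

end

section \<open>Integrals over the sphere\<close>

lemma sets_sphere_measure [simp, measurable_cong]:
  "sets (sphere_measure :: 'a::euclidean_space measure) = sets (restrict_space borel (sphere 0 1))"
  and space_sphere_measure [simp]: "space (sphere_measure :: 'a::euclidean_space measure) = sphere 0 1"
  by (simp_all add: sphere_measure_def space_restrict_space)

lemma nn_integral_sphere_measure:
  fixes F :: "'a::euclidean_space \<Rightarrow> ennreal"
  assumes F[measurable]: "F \<in> borel_measurable borel"
  shows "(\<integral>\<^sup>+u. F u \<partial>sphere_measure) =
    of_nat DIM('a) * (\<integral>\<^sup>+y. F (y /\<^sub>R norm y) * indicator (ball 0 1 - {0}) y \<partial>lborel)"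
proof -
  let ?M = "restrict_space lborel (ball (0::'a) 1 - {0})"
  have p: "(\<lambda>x::'a. x /\<^sub>R norm x) \<in> measurable ?M (restrict_space borel (sphere 0 1))"
  proof (rule measurable_restrict_space2)
    show "(\<lambda>x::'a. x /\<^sub>R norm x) \<in> space ?M \<rightarrow> sphere 0 1"
      by (auto simp: space_restrict_space)
    show "(\<lambda>x::'a. x /\<^sub>R norm x) \<in> measurable ?M borel"
      by (rule measurable_restrict_space1) measurable
  qed
  then have p': "(\<lambda>x::'a. x /\<^sub>R norm x) \<in> measurable (scale_measure (of_nat DIM('a)) ?M) (restrict_space borel (sphere 0 1))"
    by (simp add: measurable_def space_scale_measure)
  have "(\<integral>\<^sup>+u. F u \<partial>sphere_measure) = (\<integral>\<^sup>+y. F (y /\<^sub>R norm y) \<partial>scale_measure (of_nat DIM('a)) ?M)"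
    unfolding sphere_measure_def
    by (rule nn_integral_distr[OF p']) (simp add: measurable_restrict_space1)
  also have "\<dots> = of_nat DIM('a) * (\<integral>\<^sup>+y. F (y /\<^sub>R norm y) \<partial>?M)"
    by (rule nn_integral_scale_measure) (rule measurable_restrict_space1, measurable)
  also have "(\<integral>\<^sup>+y. F (y /\<^sub>R norm y) \<partial>?M) = (\<integral>\<^sup>+y. F (y /\<^sub>R norm y) * indicator (ball 0 1 - {0}) y \<partial>lborel)"
    by (rule nn_integral_restrict_space) simp
  finally show ?thesis .
qed

lemma ball_remove_0_open: "open (ball (0::'a::euclidean_space) 1 - {0})" "ball (0::'a) 1 - {0} \<in> sets borel"
proof -
  show "open (ball (0::'a) 1 - {0})" by (intro open_Diff) auto
  then show "ball (0::'a) 1 - {0} \<in> sets borel" by simp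
qed

lemma emeasure_remove_0:
  fixes T :: "'a::euclidean_space set"
  assumes "T \<in> sets borel" shows "emeasure lborel (T - {0}) = emeasure lborel T"
  using assms by (intro emeasure_Diff_null_set) auto

context gauss_pair
begin

text \<open>A total Borel version of \<open>X\<close>, which is unspecified at 0.\<close>

definition X0 :: "real^'n \<Rightarrow> real^'n" where "X0 u = (if u = 0 then 0 else X u)"

lemma X0_measurable [measurable]: "X0 \<in> borel_measurable borel"
proof -
  have "continuous_on (- {0}) X"
    by (intro differentiable_imp_continuous_on) (auto simp: differentiable_on_def intro: differentiable_at_withinI X_diff)
  then have "(\<lambda>u. indicator (- {0}) u *\<^sub>R X u) \<in> borel_measurable borel"
    by (intro borel_measurable_continuous_on_indicator) auto
  moreover have "(\<lambda>u. indicator (- {0}) u *\<^sub>R X u) = X0" by (auto simp: X0_def fun_eq_iff)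
  ultimately show ?thesis by simp
qed

text \<open>The locale provides the derivative only pointwise. As a limit of difference quotients
  along a fixed sequence of increments it is Borel measurable in \<open>u\<close>.\<close>

lemma X'_limit:
  assumes "u \<noteq> 0"
  shows "(\<lambda>k. real (Suc k) *\<^sub>R (X0 (u + inverse (real (Suc k)) *\<^sub>R v) - X0 u)) \<longlonglongrightarrow> X' u v"
proof -
  have d: "((\<lambda>t. X (u + t *\<^sub>R v)) has_vector_derivative X' u v) (at 0)"
    by (rule has_derivative_along_line[OF X_der[OF assms]])
  have "((\<lambda>t. X0 (u + t *\<^sub>R v)) has_vector_derivative X' u v) (at 0)"
  proof (rule has_vector_derivative_transform_within_open[OF d, where S="{t. u + t *\<^sub>R v \<noteq> 0}"])
    show "open {t. u + t *\<^sub>R v \<noteq> 0}" by (intro open_Collect_neq continuous_intros)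
  qed (use assms in \<open>auto simp: X0_def\<close>)
  then have "((\<lambda>t. (X0 (u + t *\<^sub>R v) - X0 (u + 0 *\<^sub>R v)) /\<^sub>R (t - 0)) \<longlongrightarrow> X' u v) (at 0)"
  proof -
    let ?a = "\<lambda>t. X0 (u + t *\<^sub>R v) - X0 u"
    assume "((\<lambda>t. X0 (u + t *\<^sub>R v)) has_vector_derivative X' u v) (at 0)"
    then have "((\<lambda>t. norm (?a t - t *\<^sub>R X' u v) / norm t) \<longlongrightarrow> 0) (at 0)"
      by (simp add: has_vector_derivative_def has_derivative_iff_norm)
    moreover have "\<forall>\<^sub>F t in at 0. norm (?a t - t *\<^sub>R X' u v) / norm t = norm (?a t /\<^sub>R t - X' u v)"
      unfolding eventually_at_filter
    proof (rule always_eventually, safe)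
      fix t :: real assume "t \<noteq> 0"
      then have "?a t /\<^sub>R t - X' u v = (?a t - t *\<^sub>R X' u v) /\<^sub>R t" by (simp add: scaleR_diff_right)
      then show "norm (?a t - t *\<^sub>R X' u v) / norm t = norm (?a t /\<^sub>R t - X' u v)"
        by (simp only: norm_scaleR) (simp add: divide_inverse mult.commute)
    qed
    ultimately have "((\<lambda>t. norm (?a t /\<^sub>R t - X' u v)) \<longlongrightarrow> 0) (at 0)"
      by (rule Lim_transform_eventually)
    then show ?thesis by (simp add: tendsto_norm_zero_iff LIM_zero_iff)
  qed
  moreover have "filterlim (\<lambda>k. inverse (real (Suc k))) (at 0) sequentially"
    using LIMSEQ_inverse_real_of_nat by (simp add: filterlim_at)
  ultimately have "(\<lambda>k. (X0 (u + inverse (real (Suc k)) *\<^sub>R v) - X0 (u + 0 *\<^sub>R v)) /\<^sub>R (inverse (real (Suc k)) - 0)) \<longlonglongrightarrow> X' u v"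
    by (rule filterlim_compose)
  then show ?thesis by simp
qed

lemma X'_measurable:
  "(\<lambda>u. if u = 0 then 0 else X' u v) \<in> borel_measurable borel"
proof (rule borel_measurable_LIMSEQ_metric)
  show "(\<lambda>u. if u = 0 then 0 else real (Suc k) *\<^sub>R (X0 (u + inverse (real (Suc k)) *\<^sub>R v) - X0 u)) \<in> borel_measurable borel" for k
    by measurable
  show "(\<lambda>k. if u = 0 then 0 else real (Suc k) *\<^sub>R (X0 (u + inverse (real (Suc k)) *\<^sub>R v) - X0 u)) \<longlonglongrightarrow> (if u = 0 then 0 else X' u v)" for u
    using X'_limit[of u v] by (cases "u = 0") auto
qed

text \<open>A total Borel function that agrees with \<open>curvature_function K\<close> on the unit
  sphere; the latter is defined through definite descriptions, which give no measurability off the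
  sphere.\<close>

definition curv :: "real^'n \<Rightarrow> real" where
  "curv u = det (matrix (\<lambda>v. (if u = 0 then 0 else X' u v) + (u \<bullet> v) *\<^sub>R u))"

lemma curv_measurable [measurable]: "curv \<in> borel_measurable borel"
proof -
  have [measurable]: "(\<lambda>u. ((if u = 0 then 0 else X' u v) + (u \<bullet> v) *\<^sub>R u) $ i) \<in> borel_measurable borel" for v i
  proof -
    have "(\<lambda>u. (if u = 0 then 0 else X' u v) + (u \<bullet> v) *\<^sub>R u) \<in> borel_measurable borel"
      using X'_measurable[of v] by measurable
    moreover have "(\<lambda>x::real^'n. x $ i) \<in> borel_measurable borel"
      by (intro borel_measurable_continuous_onI continuous_intros)
    ultimately show ?thesis by (rule measurable_compose)
  qed
  show ?thesis unfolding curv_def det_def matrix_def vec_lambda_beta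
    by (intro borel_measurable_sum borel_measurable_times borel_measurable_prod borel_measurable_const) measurable
qed

lemma
  assumes u: "norm u = 1"
  shows curv_eq: "curvature_function K u = curv u" and curv_pos: "curv u > 0"
proof -
  have "u \<noteq> 0" using u by auto
  then have "(\<lambda>v. (if u = 0 then 0 else X' u v) + (u \<bullet> v) *\<^sub>R u) = A u" by (simp add: A_def fun_eq_iff)
  then show "curvature_function K u = curv u" "curv u > 0"
    using curvature_function_eq[OF u] by (simp_all add: curv_def)
qed

lemma h_measurable [measurable]: "h \<in> borel_measurable borel"
  by (rule borel_measurable_support[OF body])

theorem nn_integral_support_curvature:
  "(\<integral>\<^sup>+u. ennreal (h u * curv u) \<partial>sphere_measure) = ennreal (real CARD('n) * vol K)"
proof -
  let ?S = "ball 0 1 - {0} :: (real^'n) set"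
  have "(\<integral>\<^sup>+u. ennreal (h u * curv u) \<partial>sphere_measure) =
     of_nat DIM(real^'n) * (\<integral>\<^sup>+y. ennreal (h (y /\<^sub>R norm y) * curv (y /\<^sub>R norm y)) * indicator ?S y \<partial>lborel)"
    by (rule nn_integral_sphere_measure) measurable
  also have "(\<integral>\<^sup>+y. ennreal (h (y /\<^sub>R norm y) * curv (y /\<^sub>R norm y)) * indicator ?S y \<partial>lborel) = emeasure lborel (interior K - {0})"
  proof (rule emeasure_differentiable_image[OF ball_remove_0_open(1) _ _ \<Phi>_image])
    show "(\<Phi> has_derivative \<Phi>' y) (at y)" if "y \<in> ?S" for y using that by (intro \<Phi>_der) auto
    show "inj_on \<Phi> ?S" by (rule inj_on_subset[OF inj_\<Phi>]) auto
    show "open (interior K - {0})" by (intro open_Diff) auto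
    show "emeasure lborel (interior K - {0}) < \<infinity>"
      by (simp add: emeasure_remove_0 emeasure_interior_body[OF body])
    show "(\<lambda>y. h (y /\<^sub>R norm y) * curv (y /\<^sub>R norm y)) \<in> borel_measurable borel" by measurable
    fix y assume "y \<in> ?S"
    then have y: "y \<noteq> 0" "norm (y /\<^sub>R norm y) = 1" by auto
    then show "h (y /\<^sub>R norm y) * curv (y /\<^sub>R norm y) = \<bar>det (matrix (\<Phi>' y))\<bar>"
      using h_pos[of "y /\<^sub>R norm y"] curv_pos[OF y(2)] by (simp add: det_\<Phi>' curv_eq abs_mult)
  qed
  also have "emeasure lborel (interior K - {0}) = ennreal (vol K)"
    by (simp add: emeasure_remove_0 emeasure_interior_body[OF body])
  finally show ?thesis using vol_pos[OF body] by (simp add: ennreal_of_nat_eq_real_of_nat ennreal_mult)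
qed

section \<open>The volume of the polar body as an integral over the sphere\<close>

text \<open>The radial map from the unit ball onto the polar body, scaled so that
  \<open>h (\<Theta> y) = norm y\<close>.\<close>

definition \<Theta> :: "real^'n \<Rightarrow> real^'n" where "\<Theta> y = (norm y / h y) *\<^sub>R y"

lemma \<Theta>_der:
  assumes y: "y \<noteq> 0"
  shows "(\<Theta> has_derivative (\<lambda>v. (norm y / h y) *\<^sub>R (v + ((y /\<^sub>R (norm y)\<^sup>2 - X y /\<^sub>R h y) \<bullet> v) *\<^sub>R y))) (at y)"
  unfolding \<Theta>_def
  by (rule derivative_eq_intros has_derivative_norm_at[OF y] h_has_derivative[OF y] refl | use y h_pos[OF y] in \<open>simp; fail\<close>)+
    (use y h_pos[OF y] in \<open>simp add: fun_eq_iff field_simps inner_diff_left power2_eq_square\<close>)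

text \<open>Up to the factor \<open>norm y / h y\<close> the derivative is a rank one update of the
  identity by vectors that are orthogonal, because \<open>X y \<bullet> y = h y\<close>; its
  determinant is 1.\<close>

lemma det_\<Theta>':
  assumes y: "y \<noteq> 0"
  shows "det (matrix (\<lambda>v. (norm y / h y) *\<^sub>R (v + ((y /\<^sub>R (norm y)\<^sup>2 - X y /\<^sub>R h y) \<bullet> v) *\<^sub>R y))) = (norm y / h y) ^ CARD('n)"
proof -
  let ?w = "y /\<^sub>R (norm y)\<^sup>2 - X y /\<^sub>R h y" and ?r = "norm y / h y"
  have wy: "?w \<bullet> y = 0"
    using y h_pos[OF y] X_nz(2)[OF y] by (simp add: inner_diff_left power2_norm_eq_inner)
  have lin: "linear (\<lambda>v. v + (?w \<bullet> v) *\<^sub>R y)"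
    by (intro linearI) (auto simp: inner_add_right algebra_simps)
  have "det (matrix (\<lambda>v. ?r *\<^sub>R (v + (?w \<bullet> v) *\<^sub>R y))) = det (matrix ((*\<^sub>R) ?r :: real^'n \<Rightarrow> real^'n)) * det (matrix (\<lambda>v. v + (?w \<bullet> v) *\<^sub>R y))"
    using det_compose[of "(*\<^sub>R) ?r :: real^'n \<Rightarrow> real^'n", OF _ lin] by (simp add: linear_scale_self)
  then show ?thesis by (simp add: det_matrix_scaleR det_rank_one_update wy)
qed

lemma \<Theta>_image: "\<Theta> ` (ball 0 1 - {0}) = interior (polar K) - {0}"
proof -
  have int: "x \<in> interior (polar K) \<longleftrightarrow> h x < 1" for x
    using interior_body_iff[OF polar_body] polar_polar[OF body] by auto
  have h\<Theta>: "h (\<Theta> y) = norm y" if "y \<noteq> 0" for y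
    using h_pos[OF that] by (simp add: \<Theta>_def h_scale)
  show ?thesis
  proof (intro equalityI subsetI)
    fix x assume "x \<in> \<Theta> ` (ball 0 1 - {0})"
    then obtain y where "y \<in> ball 0 1 - {0}" "x = \<Theta> y" by blast
    then show "x \<in> interior (polar K) - {0}"
      using h\<Theta>[of y] int[of x] h_pos[of y] by (auto simp: \<Theta>_def)
  next
    fix x assume x: "x \<in> interior (polar K) - {0}"
    let ?y = "(h x / norm x) *\<^sub>R x"
    have hx: "h x > 0" "h x < 1" using x h_pos int by auto
    have "norm ?y = h x" using x hx by simp
    moreover have "\<Theta> ?y = x"
      using x hx by (simp add: \<Theta>_def h_scale)
    ultimately show "x \<in> \<Theta> ` (ball 0 1 - {0})" using x hx by (intro image_eqI[of _ _ ?y]) auto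
  qed
qed

lemma inj_\<Theta>: "inj_on \<Theta> (- {0})"
proof (rule inj_on_inverseI[of _ "\<lambda>x. (h x / norm x) *\<^sub>R x"])
  fix y :: "real^'n" assume "y \<in> - {0}"
  then have y: "y \<noteq> 0" by simp
  then show "(h (\<Theta> y) / norm (\<Theta> y)) *\<^sub>R \<Theta> y = y"
    using h_pos[OF y] by (simp add: \<Theta>_def h_scale)
qed

theorem nn_integral_support_power:
  "(\<integral>\<^sup>+u. ennreal (1 / h u ^ CARD('n)) \<partial>sphere_measure) = ennreal (real CARD('n) * vol (polar K))"
proof -
  let ?S = "ball 0 1 - {0} :: (real^'n) set"
  have "(\<integral>\<^sup>+u. ennreal (1 / h u ^ CARD('n)) \<partial>sphere_measure) =
     of_nat DIM(real^'n) * (\<integral>\<^sup>+y. ennreal (1 / h (y /\<^sub>R norm y) ^ CARD('n)) * indicator ?S y \<partial>lborel)"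
    by (rule nn_integral_sphere_measure) measurable
  also have "(\<integral>\<^sup>+y. ennreal (1 / h (y /\<^sub>R norm y) ^ CARD('n)) * indicator ?S y \<partial>lborel) = emeasure lborel (interior (polar K) - {0})"
  proof (rule emeasure_differentiable_image[OF ball_remove_0_open(1) \<Theta>_der _ \<Theta>_image])
    show "inj_on \<Theta> ?S" by (rule inj_on_subset[OF inj_\<Theta>]) auto
    show "open (interior (polar K) - {0})" by (intro open_Diff) auto
    show "emeasure lborel (interior (polar K) - {0}) < \<infinity>"
      by (simp add: emeasure_remove_0 emeasure_interior_body[OF polar_body])
    show "(\<lambda>y. 1 / h (y /\<^sub>R norm y) ^ CARD('n)) \<in> borel_measurable borel" by measurable
    fix y assume "y \<in> ?S"
    then have y: "y \<noteq> 0" by auto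
    then show "1 / h (y /\<^sub>R norm y) ^ CARD('n) = \<bar>det (matrix (\<lambda>v. (norm y / h y) *\<^sub>R (v + ((y /\<^sub>R (norm y)\<^sup>2 - X y /\<^sub>R h y) \<bullet> v) *\<^sub>R y)))\<bar>"
      using h_pos[OF y] unfolding det_\<Theta>'[OF y] by (simp add: h_scale power_divide divide_simps power_mult_distrib)
  qed auto
  also have "emeasure lborel (interior (polar K) - {0}) = ennreal (vol (polar K))"
    by (simp add: emeasure_remove_0 emeasure_interior_body[OF polar_body])
  finally show ?thesis using vol_pos[OF polar_body] by (simp add: ennreal_of_nat_eq_real_of_nat ennreal_mult)
qed

end

section \<open>Polar bodies and bodies of class C2+\<close>

text \<open>That \<open>u\<close> is normal to \<open>K\<close> at \<open>x\<close> means equality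
  in \<open>inner_le_support_polar\<close>, a condition symmetric in \<open>K\<close> and
  \<open>polar K\<close>. So the normal of the polar body at \<xi> points to the boundary point of
  \<open>K\<close> with normal direction \<xi>, and conversely; only the normalisation
  changes.\<close>

lemma (in gauss_pair) gauss_pair_polar:
  "gauss_pair (polar K) (\<lambda>\<xi>. X \<xi> /\<^sub>R norm (X \<xi>)) (\<lambda>u. \<nu> u /\<^sub>R h (\<nu> u))"
proof
  show "origin_body (polar K)" by (rule polar_body)
  have hh: "support_function (polar (polar K)) = h" by (simp add: polar_polar[OF body])
  have Xnz: "X x \<noteq> 0" if "x \<noteq> 0" for x using X_nz(1)[OF that] frontier_nz by blast
  show "(\<lambda>\<xi>. X \<xi> /\<^sub>R norm (X \<xi>)) differentiable (at x)" if x: "x \<noteq> 0" for x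
  proof -
    have "(\<lambda>\<xi>. norm (X \<xi>)) differentiable (at x)"
      using has_derivative_compose[OF X_der[OF x] has_derivative_norm_at[OF Xnz[OF x]]] by (rule differentiableI)
    then have "(\<lambda>\<xi>. inverse (norm (X \<xi>))) differentiable (at x)"
      using Xnz[OF x] by (intro differentiable_inverse) auto
    then show ?thesis by (intro differentiable_scaleR X_diff x)
  qed
  show "(\<lambda>u. \<nu> u /\<^sub>R h (\<nu> u)) differentiable (at x)" if x: "x \<noteq> 0" for x
  proof -
    have "(\<lambda>u. h (\<nu> u)) differentiable (at x)"
      using has_derivative_compose[OF \<nu>_der[OF x] h_has_derivative[OF \<nu>_nz[OF x]]] by (rule differentiableI)
    then have "(\<lambda>u. inverse (h (\<nu> u))) differentiable (at x)"
      using h_pos[OF \<nu>_nz[OF x]] by (intro differentiable_inverse) auto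
    then show ?thesis by (intro differentiable_scaleR \<nu>_diff x)
  qed
  show "X (c *\<^sub>R x) /\<^sub>R norm (X (c *\<^sub>R x)) = X x /\<^sub>R norm (X x)" if "c > 0" for c x
    using X_scale[OF that] by simp
  show "\<nu> (c *\<^sub>R x) /\<^sub>R h (\<nu> (c *\<^sub>R x)) = \<nu> x /\<^sub>R h (\<nu> x)" if "c > 0" for c x
    using \<nu>_scale[OF that] by simp
  have fr: "\<xi> \<in> frontier (polar K) \<longleftrightarrow> h \<xi> = 1" for \<xi>
    using frontier_body_iff[OF polar_body] hh by simp
  have frP: "\<xi> \<in> polar K" if "h \<xi> = 1" for \<xi> using that mem_polar_iff[OF body] by simp
  have on: "outer_unit_normal (polar K) \<xi> u \<longleftrightarrow> norm u = 1 \<and> \<xi> \<bullet> u = g u" if "h \<xi> = 1" for \<xi> u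
    by (rule outer_unit_normal_iff[OF polar_body frP[OF that]])
  have nz: "\<xi> \<noteq> 0" if "h \<xi> = 1" for \<xi> using that support_0[OF body] by auto
  \<comment> \<open>The equality case read for \<open>K\<close>: a normal direction \<open>u\<close>
    of the polar body at \<xi> becomes, scaled by its gauge, the boundary point of \<open>K\<close>
    with normal direction \<xi>.\<close>
  have dual: "u /\<^sub>R g u \<in> frontier K \<and> outer_unit_normal K (u /\<^sub>R g u) (\<xi> /\<^sub>R norm \<xi>)"
    if \<xi>: "h \<xi> = 1" and u: "norm u = 1" "\<xi> \<bullet> u = g u" for \<xi> u
  proof
    have u0: "u \<noteq> 0" using u by auto
    show f: "u /\<^sub>R g u \<in> frontier K" by (rule radial_frontier[OF u0])
    show "outer_unit_normal K (u /\<^sub>R g u) (\<xi> /\<^sub>R norm \<xi>)"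
      unfolding outer_unit_normal_iff[OF body frontier_in[OF f]]
      using nz[OF \<xi>] \<xi> u g_pos[OF u0] by (simp add: h_scale inner_commute field_simps)
  qed
  show "outer_unit_normal (polar K) \<xi> u \<longleftrightarrow> u = X \<xi> /\<^sub>R norm (X \<xi>)" if "\<xi> \<in> frontier (polar K)" for \<xi> u
  proof -
    have \<xi>: "h \<xi> = 1" using that fr by simp
    note \<xi>0 = nz[OF \<xi>]
    have gX: "g (X \<xi>) = 1" using X_nz(1)[OF \<xi>0] frontier_iff by simp
    show ?thesis
    proof
      assume "u = X \<xi> /\<^sub>R norm (X \<xi>)"
      then show "outer_unit_normal (polar K) \<xi> u"
        unfolding on[OF \<xi>] using Xnz[OF \<xi>0] X_nz(2)[OF \<xi>0] \<xi> gX by (simp add: g_scale inner_commute)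
    next
      assume "outer_unit_normal (polar K) \<xi> u"
      then have u: "norm u = 1" "\<xi> \<bullet> u = g u" using on[OF \<xi>] by auto
      have u0: "u \<noteq> 0" using u by auto
      have "u /\<^sub>R g u = X (\<xi> /\<^sub>R norm \<xi>)"
        using point_iff[of "\<xi> /\<^sub>R norm \<xi>" "u /\<^sub>R g u"] dual[OF \<xi> u] \<xi>0 by simp
      also have "\<dots> = X \<xi>" using \<xi>0 by (intro X_scale) simp
      finally have "X \<xi> = u /\<^sub>R g u" ..
      then show "u = X \<xi> /\<^sub>R norm (X \<xi>)" using u g_pos[OF u0] by simp
    qed
  qed
  show "\<xi> \<in> frontier (polar K) \<and> outer_unit_normal (polar K) \<xi> u \<longleftrightarrow> \<xi> = \<nu> u /\<^sub>R h (\<nu> u)" if u: "norm u = 1" for \<xi> u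
  proof
    have u0: "u \<noteq> 0" using u by auto
    have hp: "h (\<nu> u) > 0" using h_pos[OF \<nu>_nz[OF u0]] .
    {
      assume \<xi>: "\<xi> = \<nu> u /\<^sub>R h (\<nu> u)"
      have h1: "h \<xi> = 1" using hp by (simp add: \<xi> h_scale)
      moreover have "\<xi> \<bullet> u = g u" using hp \<nu>_inner[OF u0] by (simp add: \<xi>)
      ultimately show "\<xi> \<in> frontier (polar K) \<and> outer_unit_normal (polar K) \<xi> u"
        using fr on[OF h1] u by simp
    }
    assume "\<xi> \<in> frontier (polar K) \<and> outer_unit_normal (polar K) \<xi> u"
    then have \<xi>: "h \<xi> = 1" "\<xi> \<bullet> u = g u" using fr on by auto
    have "\<xi> /\<^sub>R norm \<xi> = \<nu> (u /\<^sub>R g u)"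
      using dual[OF \<xi>(1) u \<xi>(2)] normal_iff by blast
    then have "\<xi> /\<^sub>R norm \<xi> = \<nu> u" using \<nu>_radial[OF u0] by simp
    then have eq: "\<xi> = norm \<xi> *\<^sub>R \<nu> u" using nz[OF \<xi>(1)] by (metis norm_eq_zero scaleR_right_imp_eq scaleR_scaleR right_inverse scaleR_one)
    then have "norm \<xi> * h (\<nu> u) = 1" using \<xi>(1) by (metis h_scale norm_ge_zero)
    then have "norm \<xi> = inverse (h (\<nu> u))" using hp by (simp add: field_simps)
    then show "\<xi> = \<nu> u /\<^sub>R h (\<nu> u)" using eq by simp
  qed
qed

section \<open>From the class C2+ to differentiable Gauss maps\<close>

text \<open>The gauge of \<open>x\<close> is the support function of the compact polar body, hence
  it is attained there, and a point attaining the value 1 is a supporting functional of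
  \<open>K\<close> at \<open>x\<close>.\<close>

lemma frontier_normal_exists:
  assumes K: "origin_body K" and x: "x \<in> frontier K"
  obtains u where "outer_unit_normal K x u"
proof -
  have xK: "x \<in> K" using x frontier_subset_closed[OF origin_body_D(6)[OF K]] by blast
  have gx: "support_function (polar K) x = 1" using frontier_body_iff[OF K] x by simp
  obtain y where y: "y \<in> polar K" "y \<bullet> x = 1"
    using support_attained[OF origin_body_polar[OF K], of x] gx by metis
  have y0: "y \<noteq> 0" using y by auto
  have "support_function K y = 1"
    using mem_polar_iff[OF K, of y] y inner_le_support[OF K xK, of y] by (simp add: inner_commute)
  then have "outer_unit_normal K x (y /\<^sub>R norm y)"
    unfolding outer_unit_normal_iff[OF K xK] using y y0 by (simp add: support_scale[OF K] inner_commute)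
  then show ?thesis by (rule that)
qed

text \<open>If \<open>u\<close> had a component \<open>\<tau> \<noteq> 0\<close> orthogonal to the gradient, then by the intermediate value theorem
  for \<open>\<phi>\<close> on a segment transversal to the hypersurface, it would contain a point
  \<open>x + t \<tau> + s G x\<close> with \<open>t > 0\<close> and \<open>s\<close> much smaller than \<open>t\<close>, beyond the supporting hyperplane.\<close>

lemma outer_normal_parallel_gradient:
  fixes K :: "'a::euclidean_space set"
  assumes K: "closed K" and x: "x \<in> frontier K" and U: "open U" "x \<in> U"
    and der: "\<And>y. y \<in> U \<Longrightarrow> (\<phi> has_derivative (\<lambda>v. G y \<bullet> v)) (at y)"
    and S: "frontier K \<inter> U = {y \<in> U. \<phi> y = 0}" and G: "G x \<noteq> 0"
    and u: "outer_unit_normal K x u"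
  shows "u = ((u \<bullet> G x) / (G x \<bullet> G x)) *\<^sub>R G x"
proof (rule ccontr)
  let ?G = "G x"
  define \<tau> where "\<tau> = u - ((u \<bullet> ?G) / (?G \<bullet> ?G)) *\<^sub>R ?G"
  assume "u \<noteq> ((u \<bullet> G x) / (G x \<bullet> G x)) *\<^sub>R G x"
  then have \<tau>0: "\<tau> \<noteq> 0" by (simp add: \<tau>_def)
  have G\<tau>: "?G \<bullet> \<tau> = 0" using G by (simp add: \<tau>_def inner_diff_right inner_commute)
  have "u = \<tau> + ((u \<bullet> ?G) / (?G \<bullet> ?G)) *\<^sub>R ?G" by (simp add: \<tau>_def)
  then have u\<tau>: "u \<bullet> \<tau> = \<tau> \<bullet> \<tau>" using G\<tau> by (metis add.right_neutral inner_add_left inner_scaleR_left mult_zero_right)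
  have tt: "\<tau> \<bullet> \<tau> > 0" using \<tau>0 by simp
  have GG: "?G \<bullet> ?G > 0" using G by simp
  \<comment> \<open>Chosen such that for \<open>\<bar>s\<bar> \<le> \<epsilon> * t\<close> the
    displacement along the gradient cannot compensate the gain
    \<open>t * (\<tau> \<bullet> \<tau>)\<close> in the direction \<open>u\<close>. The summand 1
    keeps the denominator positive.\<close>
  define \<epsilon> where "\<epsilon> = (\<tau> \<bullet> \<tau>) / (2 * (\<bar>u \<bullet> ?G\<bar> + 1))"
  have \<epsilon>: "\<epsilon> > 0" using tt by (simp add: \<epsilon>_def)
  have \<epsilon>2: "\<epsilon> * \<bar>u \<bullet> ?G\<bar> < \<tau> \<bullet> \<tau>"
  proof -
    have "\<epsilon> * \<bar>u \<bullet> ?G\<bar> < \<epsilon> * (2 * (\<bar>u \<bullet> ?G\<bar> + 1))" using \<epsilon> by (intro mult_strict_left_mono) auto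
    also have "\<dots> = \<tau> \<bullet> \<tau>" by (simp add: \<epsilon>_def)
    finally show ?thesis .
  qed
  define M where "M = norm \<tau> + \<epsilon> * norm ?G"
  have M: "M > 0" using \<tau>0 \<epsilon> by (simp add: M_def add_pos_nonneg)
  \<comment> \<open>\<open>M\<close> bounds the distance of the segment from \<open>x\<close> in
    units of \<open>t\<close>. With this \<delta> the error of the linear approximation is at most
    half of its value at the ends \<open>s = \<epsilon> * t\<close> and
    \<open>s = - (\<epsilon> * t)\<close>, so \<phi> has opposite signs there.\<close>
  define \<delta> where "\<delta> = \<epsilon> * (?G \<bullet> ?G) / (2 * M)"
  have \<delta>: "\<delta> > 0" using \<epsilon> GG M by (simp add: \<delta>_def)
  have \<phi>x: "\<phi> x = 0" using S x U by blast
  obtain d where d: "d > 0" "\<And>y. norm (y - x) < d \<Longrightarrow> \<bar>\<phi> y - ?G \<bullet> (y - x)\<bar> \<le> \<delta> * norm (y - x)"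
    using der[OF U(2)] \<delta> unfolding has_derivative_at_alt by (auto simp: \<phi>x)
  obtain r where r: "r > 0" "ball x r \<subseteq> U" using U openE by blast
  define t where "t = min d r / (2 * M)"
  have t: "t > 0" "t * M < d" "t * M < r" using d(1) r(1) M by (auto simp: t_def min_def field_simps)
  define p where "p s = x + t *\<^sub>R \<tau> + s *\<^sub>R ?G" for s
  have pn: "norm (p s - x) \<le> t * M" if "\<bar>s\<bar> \<le> \<epsilon> * t" for s
  proof -
    have "norm (p s - x) \<le> norm (t *\<^sub>R \<tau>) + norm (s *\<^sub>R ?G)" unfolding p_def by (metis add_diff_cancel_left' add.assoc norm_triangle_ineq)
    also have "\<dots> \<le> t * norm \<tau> + (\<epsilon> * t) * norm ?G"
      using t that by (auto intro!: mult_right_mono)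
    finally show ?thesis by (simp add: M_def algebra_simps)
  qed
  have pU: "p s \<in> U" if "\<bar>s\<bar> \<le> \<epsilon> * t" for s
    using pn[OF that] t r by (intro subsetD[OF r(2)]) (simp add: dist_norm norm_minus_commute)
  have cont: "isCont (\<lambda>s. \<phi> (p s)) s" if "\<bar>s\<bar> \<le> \<epsilon> * t" for s
  proof -
    have "isCont \<phi> (p s)" using der[OF pU[OF that]] by (rule has_derivative_continuous)
    moreover have "isCont p s" unfolding p_def by (intro continuous_intros)
    ultimately show ?thesis by (rule isCont_o2[rotated])
  qed
  have val: "\<bar>\<phi> (p s) - s * (?G \<bullet> ?G)\<bar> \<le> \<epsilon> * t * (?G \<bullet> ?G) / 2" if s: "\<bar>s\<bar> \<le> \<epsilon> * t" for s
  proof -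
    have "?G \<bullet> (p s - x) = s * (?G \<bullet> ?G)" using G\<tau> by (simp add: p_def inner_add_right)
    moreover have "\<bar>\<phi> (p s) - ?G \<bullet> (p s - x)\<bar> \<le> \<delta> * norm (p s - x)"
      using pn[OF s] t by (intro d) linarith
    moreover have "\<delta> * norm (p s - x) \<le> \<delta> * (t * M)" using pn[OF s] \<delta> by (intro mult_left_mono) auto
    moreover have "\<delta> * (t * M) = \<epsilon> * t * (?G \<bullet> ?G) / 2" using M by (simp add: \<delta>_def)
    ultimately show ?thesis by linarith
  qed
  have \<epsilon>t: "\<epsilon> * t > 0" using \<epsilon> t by simp
  have pos: "\<epsilon> * t * (?G \<bullet> ?G) > 0" using \<epsilon>t GG by simp
  define c where "c = \<epsilon> * t * (?G \<bullet> ?G)"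
  have c: "c > 0" using pos by (simp add: c_def)
  have "\<bar>\<phi> (p (- (\<epsilon> * t))) + c\<bar> \<le> c / 2" "\<bar>\<phi> (p (\<epsilon> * t)) - c\<bar> \<le> c / 2"
    using val[of "- (\<epsilon> * t)"] val[of "\<epsilon> * t"] \<epsilon>t by (simp_all add: c_def)
  then have le: "\<phi> (p (- (\<epsilon> * t))) \<le> 0" "0 \<le> \<phi> (p (\<epsilon> * t))"
    using c abs_le_D1[of "\<phi> (p (- (\<epsilon> * t))) + c" "c / 2"] abs_le_D2[of "\<phi> (p (\<epsilon> * t)) - c" "c / 2"] by linarith+
  have "\<exists>s\<ge>- (\<epsilon> * t). s \<le> \<epsilon> * t \<and> \<phi> (p s) = 0"
  proof (rule IVT[of "\<lambda>s. \<phi> (p s)" "- (\<epsilon> * t)" 0 "\<epsilon> * t", OF le])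
    show "\<forall>s. - (\<epsilon> * t) \<le> s \<and> s \<le> \<epsilon> * t \<longrightarrow> isCont (\<lambda>s. \<phi> (p s)) s" using cont by (simp add: abs_le_iff)
  qed (use \<epsilon>t in simp)
  then obtain s where s': "- (\<epsilon> * t) \<le> s" "s \<le> \<epsilon> * t" "\<phi> (p s) = 0" by blast
  then have s: "\<bar>s\<bar> \<le> \<epsilon> * t" "\<phi> (p s) = 0" by (auto simp: abs_le_iff)
  have "p s \<in> frontier K" using S s pU[OF s(1)] by blast
  then have "p s \<in> K" using frontier_subset_closed[OF K] by blast
  then have "(p s - x) \<bullet> u \<le> 0" using u by (simp add: outer_unit_normal_def)
  then have 1: "t * (\<tau> \<bullet> \<tau>) + s * (u \<bullet> ?G) \<le> 0"
    using u\<tau> by (simp add: p_def inner_add_right inner_commute[of _ u])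
  have "- (s * (u \<bullet> ?G)) \<le> \<bar>s\<bar> * \<bar>u \<bullet> ?G\<bar>" by (metis abs_ge_minus_self abs_mult)
  also have "\<dots> \<le> (\<epsilon> * t) * \<bar>u \<bullet> ?G\<bar>" using s by (intro mult_right_mono) auto
  also have "\<dots> = t * (\<epsilon> * \<bar>u \<bullet> ?G\<bar>)" by simp
  also have "\<dots> < t * (\<tau> \<bullet> \<tau>)" using \<epsilon>2 t by (intro mult_strict_left_mono)
  finally show False using 1 by linarith
qed


text \<open>The normal is parallel to the gradient, and its sign is that of
  \<open>G y \<bullet> y\<close>, because \<open>y \<bullet> u\<close> equals the positive number
  \<open>support_function K u\<close>. Near \<open>x\<close> this sign is constant, so on the
  boundary the Gauss map coincides with a function that is differentiable in the ambient
  space.\<close>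

lemma
  fixes K :: "(real^'n::finite) set"
  assumes K: "origin_body K" and C2: "C2_hypersurface (frontier K)" and x: "x \<in> frontier K"
  shows outer_unit_normal_gauss_map: "outer_unit_normal K x u \<longleftrightarrow> u = gauss_map K x"
    and gauss_map_differentiable: "gauss_map K differentiable (at x within frontier K)"
proof -
  obtain U \<phi> G and H :: "real^'n \<Rightarrow> real^'n^'n" where *: "open U \<and> x \<in> U \<and>
        (\<forall>y\<in>U. (\<phi> has_derivative (\<lambda>v. G y \<bullet> v)) (at y)) \<and>
        (\<forall>y\<in>U. (G has_derivative (\<lambda>v. H y *v v)) (at y)) \<and>
        continuous_on U H \<and> frontier K \<inter> U = {y \<in> U. \<phi> y = 0} \<and> (\<forall>y\<in>frontier K \<inter> U. G y \<noteq> 0)"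
    using bspec[OF C2[unfolded C2_hypersurface_def] x] by (elim exE)
  then have U: "open U" "x \<in> U"
    and d\<phi>: "\<And>y. y \<in> U \<Longrightarrow> (\<phi> has_derivative (\<lambda>v. G y \<bullet> v)) (at y)"
    and dG: "\<And>y. y \<in> U \<Longrightarrow> (G has_derivative (\<lambda>v. H y *v v)) (at y)"
    and S: "frontier K \<inter> U = {y \<in> U. \<phi> y = 0}" and G0: "\<And>y. y \<in> frontier K \<inter> U \<Longrightarrow> G y \<noteq> 0"
    by simp_all
  define n where "n y = (sgn (G y \<bullet> y) / norm (G y)) *\<^sub>R G y" for y
  have normal: "u = n y \<and> G y \<bullet> y \<noteq> 0" if y: "y \<in> frontier K" "y \<in> U" and u: "outer_unit_normal K y u" for y u
  proof -
    define c where "c = (u \<bullet> G y) / (G y \<bullet> G y)"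
    have yK: "y \<in> K" using y frontier_subset_closed[OF origin_body_D(6)[OF K]] by blast
    have uc: "u = c *\<^sub>R G y"
      unfolding c_def by (rule outer_normal_parallel_gradient[OF origin_body_D(6)[OF K] y(1) U(1) y(2) d\<phi> S _ u]) (use G0 y in auto)
    have nu: "norm u = 1" "y \<bullet> u = support_function K u" using u outer_unit_normal_iff[OF K yK] by auto
    then have pos: "y \<bullet> u > 0" using support_pos[OF K, of u] norm_eq_zero[of u] by auto
    have cG: "\<bar>c\<bar> * norm (G y) = 1" using nu(1) uc by (metis norm_scaleR)
    have cp: "c * (G y \<bullet> y) > 0" using pos uc by (metis inner_commute inner_scaleR_left)
    have "c = sgn (G y \<bullet> y) / norm (G y)"
    proof (cases "G y \<bullet> y > 0")
      case True
      then have "c > 0" using cp by (simp add: zero_less_mult_iff)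
      then show ?thesis using True cG G0[of y] y by (simp add: field_simps)
    next
      case False
      then have "c < 0" "G y \<bullet> y < 0" using cp by (auto simp: zero_less_mult_iff)
      then show ?thesis using cG G0[of y] y by (simp add: field_simps)
    qed
    then show ?thesis using uc cp by (auto simp: n_def)
  qed
  have gm: "gauss_map K y = n y \<and> G y \<bullet> y \<noteq> 0 \<and> (\<forall>u. outer_unit_normal K y u \<longleftrightarrow> u = n y)"
    if y: "y \<in> frontier K" "y \<in> U" for y
  proof -
    obtain v where v: "outer_unit_normal K y v" using frontier_normal_exists[OF K y(1)] .
    have iff: "outer_unit_normal K y u \<longleftrightarrow> u = n y" for u using normal[OF y] v by blast
    then show ?thesis using normal[OF y v] unfolding gauss_map_def by (auto intro!: the_equality)
  qed
  show "outer_unit_normal K x u \<longleftrightarrow> u = gauss_map K x" using gm[OF x U(2)] by auto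
  define s where "s = sgn (G x \<bullet> x)"
  have GD: "G differentiable (at y)" if "y \<in> U" for y using dG[OF that] by (rule differentiableI)
  have contG: "continuous_on U G"
    using GD by (intro differentiable_imp_continuous_on) (auto simp: differentiable_on_def intro: differentiable_at_withinI)
  have opn: "open {y \<in> U. s * (G y \<bullet> y) > 0}"
  proof -
    have "continuous_on U (\<lambda>y. s * (G y \<bullet> y))" using contG by (intro continuous_intros)
    from continuous_open_preimage[OF this U(1) open_greaterThan[of 0]]
    show ?thesis by (simp add: vimage_def Int_def)
  qed
  have xin: "x \<in> {y \<in> U. s * (G y \<bullet> y) > 0}" using gm[OF x U(2)] U by (auto simp: s_def sgn_if)
  then obtain e where e: "e > 0" "ball x e \<subseteq> {y \<in> U. s * (G y \<bullet> y) > 0}" using opn openE by blast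
  have "(\<lambda>y. s *\<^sub>R (G y /\<^sub>R norm (G y))) differentiable (at x)"
  proof -
    have G0x: "G x \<noteq> 0" using G0 x U by blast
    have "(\<lambda>y. norm (G y)) differentiable (at x)"
      using has_derivative_compose[OF dG[OF U(2)] has_derivative_norm_at[OF G0x]] by (rule differentiableI)
    then have "(\<lambda>y. inverse (norm (G y))) differentiable (at x)"
      using G0x by (intro differentiable_inverse) auto
    then show ?thesis by (intro differentiable_scaleR GD U(2) differentiable_const)
  qed
  then obtain W where "((\<lambda>y. s *\<^sub>R (G y /\<^sub>R norm (G y))) has_derivative W) (at x within frontier K)"
    unfolding differentiable_def using has_derivative_at_withinI by blast
  then have "(gauss_map K has_derivative W) (at x within frontier K)"
  proof (rule has_derivative_transform_within[OF _ e(1) x])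
    fix y assume y: "y \<in> frontier K" "dist y x < e"
    then have yU: "y \<in> U" "s * (G y \<bullet> y) > 0" using e(2) by (auto simp: dist_commute subset_iff)
    then have "sgn (G y \<bullet> y) = s" by (auto simp: s_def sgn_if split: if_splits)
    then show "s *\<^sub>R (G y /\<^sub>R norm (G y)) = gauss_map K y"
      using gm[OF y(1) yU(1)] by (simp add: n_def divide_inverse)
  qed
  then show "gauss_map K differentiable (at x within frontier K)" by (auto simp: differentiable_def)
qed

text \<open>The derivatives of the Gauss map \<open>\<nu>\<close> along the boundary and the positivity of the curvature give,
  through \<open>y \<mapsto> g y \<nu> y\<close> and its inverse, the differentiability of the inverse Gauss map.\<close>

lemma C2_plus_gauss_pair:
  fixes K :: "(real^'n::finite) set"
  assumes C2p: "C2_plus K" and int: "0 \<in> interior K"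
  obtains \<nu> X where "gauss_pair K \<nu> X"
proof -
  have K: "origin_body K" and C2: "C2_hypersurface (frontier K)" and curv: "\<And>x. x \<in> frontier K \<Longrightarrow> gauss_curvature K x > 0"
    using C2p int by (auto simp: C2_plus_def convex_body_def origin_body_def)
  note K' = origin_body_polar[OF K]
  let ?g = "support_function (polar K)" and ?h = "support_function K"
  have frK: "x \<in> K" if "x \<in> frontier K" for x
    using that frontier_subset_closed[OF origin_body_D(6)[OF K]] by blast
  have fr: "x \<in> frontier K \<longleftrightarrow> ?g x = 1" for x by (rule frontier_body_iff[OF K])
  have fr0: "x \<noteq> 0" if "x \<in> frontier K" for x using that fr support_0[OF K'] by auto
  have gpos: "?g x > 0" if "x \<noteq> 0" for x using support_pos[OF K' that] .
  have hpos: "?h x > 0" if "x \<noteq> 0" for x using support_pos[OF K that] .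
  have rad: "x /\<^sub>R ?g x \<in> frontier K" if "x \<noteq> 0" for x
    using gpos[OF that] by (simp add: fr support_scale[OF K'])
  define \<nu> where "\<nu> x = gauss_map K (x /\<^sub>R ?g x)" for x
  have \<nu>fr: "\<nu> x = gauss_map K x" if "x \<in> frontier K" for x using that by (simp add: \<nu>_def fr)
  have normal: "outer_unit_normal K x u \<longleftrightarrow> u = \<nu> x" if "x \<in> frontier K" for x u
    using outer_unit_normal_gauss_map[OF K C2 that] \<nu>fr[OF that] by simp
  have \<nu>D: "norm (\<nu> x) = 1" "x \<bullet> \<nu> x = ?h (\<nu> x)" if "x \<in> frontier K" for x
    using normal[OF that, of "\<nu> x"] outer_unit_normal_iff[OF K frK[OF that], of "\<nu> x"] by auto
  have \<nu>scale: "\<nu> (c *\<^sub>R x) = \<nu> x" if "c > 0" for c x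
  proof -
    have "inverse (c * ?g x) * c = inverse (?g x)" using that by (simp add: field_simps)
    then have "(c *\<^sub>R x) /\<^sub>R ?g (c *\<^sub>R x) = x /\<^sub>R ?g x" using that by (simp add: support_scale[OF K'])
    then show ?thesis by (simp only: \<nu>_def)
  qed
  have \<nu>rad: "\<nu> (x /\<^sub>R ?g x) = \<nu> x" if "x \<noteq> 0" for x using gpos[OF that] by (intro \<nu>scale) simp
  have \<nu>n: "norm (\<nu> x) = 1" if "x \<noteq> 0" for x using \<nu>D(1)[OF rad[OF that]] \<nu>rad[OF that] by simp
  have \<nu>0: "\<nu> x \<noteq> 0" if "x \<noteq> 0" for x using \<nu>n[OF that] by auto
  have \<nu>inner: "\<nu> x \<bullet> x = ?g x * ?h (\<nu> x)" if "x \<noteq> 0" for x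
  proof -
    have "inverse (?g x) * (\<nu> x \<bullet> x) = ?h (\<nu> x)"
      using \<nu>D(2)[OF rad[OF that]] unfolding \<nu>rad[OF that] by (simp add: inner_commute)
    then show ?thesis using gpos[OF that] by (simp add: field_simps)
  qed
  have gcont: "continuous_on T ?g" for T by (rule continuous_support[OF K'])
  have gmcont: "continuous_on (frontier K) (gauss_map K)"
    using gauss_map_differentiable[OF K C2] by (intro differentiable_imp_continuous_on) (auto simp: differentiable_on_def)
  have \<nu>cont: "continuous_on (- {0}) \<nu>"
    unfolding \<nu>_def
  proof (rule continuous_on_compose2[OF gmcont])
    show "continuous_on (- {0}) (\<lambda>x. x /\<^sub>R ?g x)"
      using gpos by (intro continuous_intros gcont) force
    show "(\<lambda>x. x /\<^sub>R ?g x) ` (- {0}) \<subseteq> frontier K" using rad by auto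
  qed
  have \<nu>isCont: "isCont \<nu> x" if "x \<noteq> 0" for x
    using \<nu>cont that by (simp add: continuous_on_eq_continuous_at open_Compl)
  have gder: "(?g has_derivative (\<lambda>v. (inverse (?h (\<nu> x)) *\<^sub>R \<nu> x) \<bullet> v)) (at x)" if x: "x \<noteq> 0" for x
  proof (rule support_has_derivative[OF K' _ _ x])
    fix y :: "real^'n" assume y: "y \<noteq> 0"
    show "inverse (?h (\<nu> y)) *\<^sub>R \<nu> y \<in> polar K \<and> (inverse (?h (\<nu> y)) *\<^sub>R \<nu> y) \<bullet> y = ?g y"
      using hpos[OF \<nu>0[OF y]] \<nu>inner[OF y] by (simp add: mem_polar_iff[OF K] support_scale[OF K])
  next
    have "isCont (\<lambda>x. ?h (\<nu> x)) x"
      using \<nu>isCont[OF x] continuous_support[OF K, of UNIV] by (simp add: continuous_on_eq_continuous_at isCont_o2)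
    then show "isCont (\<lambda>y. inverse (?h (\<nu> y)) *\<^sub>R \<nu> y) x"
      using hpos[OF \<nu>0[OF x]] \<nu>isCont[OF x] by (intro continuous_intros) auto
  qed
  \<comment> \<open>The radial projection maps the punctured space into the boundary, so the
    derivative of the Gauss map within the boundary composes with it to a derivative of \<nu> in all
    directions.\<close>
  have \<nu>diff: "\<nu> differentiable (at x)" if x: "x \<noteq> 0" for x
  proof -
    obtain W where W: "(gauss_map K has_derivative W) (at (x /\<^sub>R ?g x) within frontier K)"
      using gauss_map_differentiable[OF K C2 rad[OF x]] by (auto simp: differentiable_def)
    have "(\<lambda>x. inverse (?g x)) differentiable (at x)"
      using gpos[OF x] by (intro differentiable_inverse differentiableI[OF gder[OF x]]) auto
    then have "(\<lambda>x. x /\<^sub>R ?g x) differentiable (at x)"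
      by (intro differentiable_scaleR differentiable_ident)
    then obtain D where "((\<lambda>x. x /\<^sub>R ?g x) has_derivative D) (at x)" by (auto simp: differentiable_def)
    then have D: "((\<lambda>x. x /\<^sub>R ?g x) has_derivative D) (at x within - {0})" by (rule has_derivative_at_withinI)
    have "(gauss_map K has_derivative W) (at (x /\<^sub>R ?g x) within (\<lambda>x. x /\<^sub>R ?g x) ` (- {0}))"
      using rad by (intro has_derivative_subset[OF W]) auto
    from has_derivative_in_compose[OF D this]
    have "(\<nu> has_derivative (\<lambda>v. W (D v))) (at x within - {0})" unfolding \<nu>_def .
    then show ?thesis using x at_within_open[of x "- {0}"] by (auto simp: differentiable_def open_Compl)
  qed
  define \<nu>' where "\<nu>' x = frechet_derivative \<nu> (at x)" for x
  have \<nu>der: "(\<nu> has_derivative \<nu>' x) (at x)" if "x \<noteq> 0" for x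
    unfolding \<nu>'_def using \<nu>diff[OF that] frechet_derivative_works by blast
  have lin\<nu>': "linear (\<nu>' x)" if "x \<noteq> 0" for x using has_derivative_linear[OF \<nu>der[OF that]] .
  have \<nu>'orth: "\<nu>' x v \<bullet> \<nu> x = 0" if x: "x \<noteq> 0" for x v
  proof -
    have "((\<lambda>x. \<nu> x \<bullet> \<nu> x) has_derivative (\<lambda>v. \<nu> x \<bullet> \<nu>' x v + \<nu>' x v \<bullet> \<nu> x)) (at x)"
      by (rule has_derivative_inner[OF \<nu>der[OF x] \<nu>der[OF x]])
    moreover have "((\<lambda>x. \<nu> x \<bullet> \<nu> x) has_derivative (\<lambda>v. 0)) (at x)"
    proof (rule has_derivative_transform_within_open[OF has_derivative_const, where s="- {0}"])
      show "1 = \<nu> y \<bullet> \<nu> y" if "y \<in> - {0}" for y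
        using \<nu>n[of y] that by (simp add: power2_norm_eq_inner[symmetric])
    qed (use x in auto)
    ultimately have "(\<lambda>v. \<nu> x \<bullet> \<nu>' x v + \<nu>' x v \<bullet> \<nu> x) = (\<lambda>v. 0)" by (rule has_derivative_unique)
    then have "\<nu> x \<bullet> \<nu>' x v + \<nu>' x v \<bullet> \<nu> x = 0" by metis
    then show ?thesis by (simp add: inner_commute)
  qed
  \<comment> \<open>Positive curvature makes the determinant in \<open>gauss_curvature\<close>
    nonzero, so the Weingarten map annihilates no nonzero tangent vector.\<close>
  have \<nu>'inj: "v = 0" if x: "x \<in> frontier K" and v: "v \<bullet> \<nu> x = 0" "\<nu>' x v = 0" for x v
  proof -
    let ?L = "\<lambda>v. \<nu>' x (v - (v \<bullet> \<nu> x) *\<^sub>R \<nu> x) + (v \<bullet> \<nu> x) *\<^sub>R \<nu> x"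
    have lin: "linear ?L" using lin\<nu>'[OF fr0[OF x]]
      by (intro linearI) (auto simp: linear_add linear_diff linear_scale inner_add_left algebra_simps)
    have "(gauss_map K has_derivative \<nu>' x) (at x within frontier K)"
      by (rule has_derivative_transform[OF x \<nu>fr[symmetric] has_derivative_at_withinI[OF \<nu>der[OF fr0[OF x]]]])
    then have "gauss_curvature K x = det (matrix ?L)"
      by (intro gauss_curvature_eqI[OF K x \<nu>fr[OF x, symmetric] gder[OF fr0[OF x]] \<nu>D(1)[OF x]])
    then have "inj ?L" using curv[OF x] det_nz_iff_inj[OF lin] by simp
    moreover have "?L v = ?L 0" using v linear_0[OF lin\<nu>'[OF fr0[OF x]]] by simp
    ultimately show "v = 0" by (meson injD)
  qed
  \<comment> \<open>Strict convexity: if two boundary points shared a normal, the segment between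
    them would lie in the boundary with constant normal, and its direction would be a tangent vector
    annihilated by the derivative of \<nu>.\<close>
  have inj: "inj_on \<nu> (frontier K)"
  proof (rule inj_onI, rule ccontr)
    fix x y assume xy: "x \<in> frontier K" "y \<in> frontier K" "\<nu> x = \<nu> y" "x \<noteq> y"
    let ?u = "\<nu> x"
    have un: "norm ?u = 1" using \<nu>D(1)[OF xy(1)] .
    have in1: "x \<bullet> ?u = ?h ?u" "y \<bullet> ?u = ?h ?u" using \<nu>D(2)[OF xy(1)] \<nu>D(2)[OF xy(2)] xy(3) by auto
    have hu: "?h ?u > 0" using hpos \<nu>0[OF fr0[OF xy(1)]] by blast
    have const: "\<nu> (x + t *\<^sub>R (y - x)) = ?u" if t: "t \<in> {0..1}" for t
    proof -
      let ?z = "x + t *\<^sub>R (y - x)"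
      have "?z = (1 - t) *\<^sub>R x + t *\<^sub>R y" by (simp add: algebra_simps)
      then have zK: "?z \<in> K" using origin_body_D(2)[OF K] frK[OF xy(1)] frK[OF xy(2)] t by (simp add: convex_alt)
      have zu: "?z \<bullet> ?u = ?h ?u" using in1 by (simp add: inner_add_left inner_diff_left)
      have "?h ?u \<le> ?g ?z * ?h ?u" using inner_le_support_polar[OF K, of ?z ?u] zu by simp
      then have "?g ?z \<ge> 1" using hu by simp
      then have z: "?z \<in> frontier K" using zK mem_body_iff[OF K] fr by force
      show ?thesis using normal[OF z, of ?u] outer_unit_normal_iff[OF K zK, of ?u] zu un by simp
    qed
    have d: "((\<lambda>t. \<nu> (x + t *\<^sub>R (y - x))) has_vector_derivative \<nu>' x (y - x)) (at 0 within {0..1})"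
      by (rule has_vector_derivative_at_within[OF has_derivative_along_line[OF \<nu>der[OF fr0[OF xy(1)]]]])
    have d0: "((\<lambda>t. \<nu> (x + t *\<^sub>R (y - x))) has_vector_derivative 0) (at 0 within {0..1})"
      by (rule has_vector_derivative_transform[OF _ _ has_vector_derivative_const[of ?u]]) (use const in auto)
    have "\<nu>' x (y - x) = 0"
      by (rule vector_derivative_unique_within_closed_interval[of 0 1 0]) (use d d0 in auto)
    moreover have "(y - x) \<bullet> ?u = 0" using in1 by (simp add: inner_diff_left)
    ultimately have "y - x = 0" using \<nu>'inj[OF xy(1)] by blast
    then show False using xy(4) by simp
  qed
  \<comment> \<open>A point of \<open>K\<close> that attains the support function in the direction
    \<open>u\<close> lies on the boundary and has \<open>u\<close> as a normal.\<close>
  have surj: "\<exists>x\<in>frontier K. \<nu> x = u" if u: "norm u = 1" for u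
  proof -
    obtain x where x: "x \<in> K" "x \<bullet> u = ?h u" using support_attained[OF K] .
    have hu: "?h u > 0" using u hpos[of u] norm_eq_zero[of u] by linarith
    have "?h u \<le> ?g x * ?h u" using inner_le_support_polar[OF K, of x u] x by simp
    then have "?g x \<ge> 1" using hu by simp
    then have xf: "x \<in> frontier K" using x mem_body_iff[OF K] fr by force
    then show ?thesis using normal[OF xf, of u] outer_unit_normal_iff[OF K x(1), of u] x u by (intro bexI[of _ x]) auto
  qed
  define Y where "Y = inv_into (frontier K) \<nu>"
  have Y: "Y u \<in> frontier K" "\<nu> (Y u) = u" if "norm u = 1" for u
    using surj[OF that] unfolding Y_def by (auto intro!: inv_into_into f_inv_into_f)
  have Y\<nu>: "Y (\<nu> x) = x" if "x \<in> frontier K" for x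
    unfolding Y_def using inj that by (rule inv_into_f_f)
  define X where "X u = Y (u /\<^sub>R norm u)" for u
  have Xscale: "X (c *\<^sub>R u) = X u" if "c > 0" for c u
  proof -
    have "inverse c * inverse (norm u) * c = inverse (norm u)" using that by (simp add: field_simps)
    then have "(c *\<^sub>R u) /\<^sub>R norm (c *\<^sub>R u) = u /\<^sub>R norm u"
      using that by (metis abs_of_pos inverse_mult_distrib norm_scaleR scaleR_scaleR)
    then show ?thesis by (simp only: X_def)
  qed
  \<comment> \<open>The inverse of a continuous injection of a compact set is continuous; this is
    the continuity that the differentiation of the inverse map requires below.\<close>
  have "continuous_on (\<nu> ` frontier K) Y"
  proof (rule continuous_on_inv)
    show "continuous_on (frontier K) \<nu>" using \<nu>cont by (rule continuous_on_subset) (use fr0 in auto)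
    show "compact (frontier K)" using origin_body_D(1)[OF K] by (rule compact_frontier)
  qed (use Y\<nu> in auto)
  moreover have "\<nu> ` frontier K = sphere 0 1" using \<nu>D(1) surj by force
  ultimately have Ycont: "continuous_on (sphere 0 1) Y" by simp
  have Xcont: "continuous_on (- {0}) X"
    unfolding X_def
  proof (rule continuous_on_compose2[OF Ycont])
    show "continuous_on (- {0}) (\<lambda>u::real^'n. u /\<^sub>R norm u)" by (intro continuous_intros) auto
    show "(\<lambda>u::real^'n. u /\<^sub>R norm u) ` (- {0}) \<subseteq> sphere 0 1"
    proof
      fix v assume "v \<in> (\<lambda>u::real^'n. u /\<^sub>R norm u) ` (- {0})"
      then obtain u :: "real^'n" where "u \<noteq> 0" "v = u /\<^sub>R norm u" by auto
      then show "v \<in> sphere 0 1" by simp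
    qed
  qed
  \<comment> \<open>Radial extensions of degree 1 turn the Gauss map and its inverse into maps
    between open sets of full dimension, so that the rule for derivatives of inverse maps
    applies.\<close>
  define \<Psi> where "\<Psi> y = ?g y *\<^sub>R \<nu> y" for y
  define \<Phi> where "\<Phi> v = norm v *\<^sub>R X v" for v
  have \<Psi>\<Phi>: "\<Psi> (\<Phi> v) = v" if v: "v \<noteq> 0" for v
  proof -
    have n: "norm (v /\<^sub>R norm v) = 1" using v by simp
    have "?g (\<Phi> v) = norm v" using Y(1)[OF n] by (simp add: \<Phi>_def X_def support_scale[OF K'] fr)
    moreover have "\<nu> (\<Phi> v) = v /\<^sub>R norm v" using Y(2)[OF n] v by (simp add: \<Phi>_def X_def \<nu>scale)
    ultimately show ?thesis using v by (simp add: \<Psi>_def)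
  qed
  have Xdiff1: "X differentiable (at u)" if u: "norm u = 1" for u
  proof -
    let ?x = "X u"
    have u0: "u \<noteq> 0" using u by auto
    have x: "?x \<in> frontier K" "\<nu> ?x = u" "?g ?x = 1" using Y[of u] u fr by (auto simp: X_def)
    have \<Phi>u: "\<Phi> u = ?x" by (simp add: \<Phi>_def u)
    let ?\<Psi>' = "\<lambda>v. ?g ?x *\<^sub>R \<nu>' ?x v + ((inverse (?h (\<nu> ?x)) *\<^sub>R \<nu> ?x) \<bullet> v) *\<^sub>R \<nu> ?x"
    have d\<Psi>: "(\<Psi> has_derivative ?\<Psi>') (at (\<Phi> u))"
      unfolding \<Psi>_def \<Phi>u by (rule has_derivative_scaleR[OF gder[OF fr0[OF x(1)]] \<nu>der[OF fr0[OF x(1)]]])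
    have lin: "linear ?\<Psi>'" using has_derivative_linear[OF d\<Psi>] .
    \<comment> \<open>The component of the derivative along \<open>u\<close> is
      \<open>(u \<bullet> v) / ?h u\<close>. If it vanishes, \<open>v\<close> is tangent to the
      boundary, and what remains is the Weingarten map at \<open>v\<close>.\<close>
    have "inj ?\<Psi>'"
    proof (rule linear_injective_0[OF lin, THEN iffD2], intro allI impI)
      fix v assume v: "?\<Psi>' v = 0"
      have "?\<Psi>' v \<bullet> u = inverse (?h u) * (u \<bullet> v)"
        using \<nu>'orth[OF fr0[OF x(1)], of v] u by (simp add: x inner_add_left power2_norm_eq_inner[symmetric])
      then have "u \<bullet> v = 0" using v hpos[OF u0] by simp
      moreover from this have "\<nu>' ?x v = 0" using v by (simp add: x)
      ultimately show "v = 0" using \<nu>'inj[OF x(1), of v] by (simp add: x inner_commute)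
    qed
    then obtain D where D: "linear D" "D \<circ> ?\<Psi>' = id" using linear_injective_left_inverse[OF lin] by blast
    have "(\<Phi> has_derivative D) (at u)"
    proof (rule has_derivative_inverse_basic[where f=\<Psi> and g=\<Phi> and T="- {0}", OF d\<Psi> _ D(2)])
      show "bounded_linear D" using D(1) linear_conv_bounded_linear by blast
      have "continuous_on (- {0}) \<Phi>" unfolding \<Phi>_def by (intro continuous_intros Xcont)
      then show "continuous (at u) \<Phi>" using u0 by (simp add: continuous_on_eq_continuous_at open_Compl)
    qed (use u0 \<Psi>\<Phi> in \<open>auto simp: open_Compl\<close>)
    then have "\<Phi> differentiable (at u)" by (rule differentiableI)
    moreover have "(\<lambda>v. inverse (norm v)) differentiable (at u)"
      using u0 differentiableI[OF has_derivative_norm_at[OF u0]] by (intro differentiable_inverse) auto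
    ultimately have "(\<lambda>v. \<Phi> v /\<^sub>R norm v) differentiable (at u)" by (intro differentiable_scaleR)
    then obtain E where "((\<lambda>v. \<Phi> v /\<^sub>R norm v) has_derivative E) (at u)" by (auto simp: differentiable_def)
    then have "(X has_derivative E) (at u)"
      by (rule has_derivative_transform_within_open[where s="- {0}"]) (use u0 in \<open>auto simp: \<Phi>_def open_Compl\<close>)
    then show ?thesis by (rule differentiableI)
  qed
  have Xdiff: "X differentiable (at x)" if x: "x \<noteq> 0" for x
  proof -
    obtain E where E: "(X has_derivative E) (at (x /\<^sub>R norm x))"
      using Xdiff1[of "x /\<^sub>R norm x"] x by (auto simp: differentiable_def)
    have "((\<lambda>z. z /\<^sub>R norm x) has_derivative (\<lambda>v. v /\<^sub>R norm x)) (at x)"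
      by (auto intro!: derivative_eq_intros)
    from has_derivative_compose[OF this E]
    have "((\<lambda>z. X (z /\<^sub>R norm x)) has_derivative (\<lambda>v. E (v /\<^sub>R norm x))) (at x)" .
    then show ?thesis using x Xscale[of "inverse (norm x)"] by (auto simp: differentiable_def)
  qed
  have "gauss_pair K \<nu> X"
  proof
    show "x \<in> frontier K \<and> outer_unit_normal K x u \<longleftrightarrow> x = X u" if u: "norm u = 1" for x u
      using normal Y[OF u] Y\<nu> u by (auto simp: X_def)
  qed (use K \<nu>diff Xdiff \<nu>scale Xscale normal in auto)
  then show thesis by (rule that)
qed

section \<open>The centroid lies in the interior\<close>

text \<open>Otherwise a nonzero linear functional would be nonnegative on \<open>K\<close>. Its
  integral over \<open>K\<close> is 0 by the choice of the centroid, so it would vanish almost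
  everywhere on \<open>K\<close>; but its zero set is a hyperplane, a null set, while
  \<open>K\<close> has positive volume.\<close>

lemma interior_of_centroid_0:
  fixes K :: "'a::euclidean_space set"
  assumes K: "convex_body K" and cen: "centroid K = 0"
  shows "0 \<in> interior K"
proof (rule ccontr)
  assume n: "0 \<notin> interior K"
  have cK: "compact K" "convex K" "interior K \<noteq> {}" using K by (auto simp: convex_body_def)
  obtain a where a: "a \<noteq> 0" "\<And>x. x \<in> interior K \<Longrightarrow> 0 \<le> a \<bullet> x"
    using separating_hyperplane_set_0[OF convex_interior[OF cK(2)] n] by blast
  have "closure (interior K) = K" using convex_closure_interior[OF cK(2,3)] compact_imp_closed[OF cK(1)] by simp
  moreover have "closure (interior K) \<subseteq> {x. 0 \<le> a \<bullet> x}"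
    using a by (intro closure_minimal closed_halfspace_ge) auto
  ultimately have aK: "0 \<le> a \<bullet> x" if "x \<in> K" for x using that by blast
  have emK: "emeasure lborel (interior K) \<noteq> 0"
  proof
    assume "emeasure lborel (interior K) = 0"
    then have "interior K \<in> null_sets lebesgue"
      by (intro null_sets_completionI) (auto simp: null_sets_def)
    then show False using open_not_negligible[of "interior K"] cK by (simp add: negligible_iff_null_sets)
  qed
  have Kb: "K \<in> sets borel" using cK by (simp add: compact_imp_closed)
  have int: "integrable lborel (\<lambda>x. indicator K x *\<^sub>R x)"
    using cK by (intro borel_integrable_compact) auto
  have fin: "emeasure lborel K < \<infinity>" by (rule emeasure_compact_finite[OF cK(1)])
  have "emeasure lborel (interior K) \<le> emeasure lborel K" using Kb interior_subset by (intro emeasure_mono) auto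
  then have "emeasure lborel K \<noteq> 0" using emK by (metis le_zero_eq)
  then have "measure lborel K > 0" using fin by (simp add: measure_def enn2real_positive_iff zero_less_iff_neq_zero)
  then have "vol K > 0" using Kb by (simp add: vol_def measure_completion)
  moreover have "integral K (\<lambda>x. x) = (LINT x|lborel. indicator K x *\<^sub>R x)"
    using set_borel_integral_eq_integral(2)[of K "\<lambda>x. x"] int by (simp add: set_integrable_def set_lebesgue_integral_def)
  ultimately have "(LINT x|lborel. indicator K x *\<^sub>R x) = 0" using cen by (simp add: centroid_def)
  then have 0: "(LINT x|lborel. (indicator K x *\<^sub>R x) \<bullet> a) = 0"
    using integral_inner_left[of a lborel "\<lambda>x. indicator K x *\<^sub>R x"] int by auto
  have "AE x in lborel. (indicator K x *\<^sub>R x) \<bullet> a = 0"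
  proof -
    have "integrable lborel (\<lambda>x. (indicator K x *\<^sub>R x) \<bullet> a)"
      using int by (intro integrable_inner_left) auto
    moreover have "0 \<le> (indicator K x *\<^sub>R x) \<bullet> a" for x
      using aK[of x] by (simp add: indicator_def inner_commute)
    ultimately show ?thesis using 0 integral_nonneg_eq_0_iff_AE[of lborel "\<lambda>x. (indicator K x *\<^sub>R x) \<bullet> a"] by simp
  qed
  moreover have "AE x in lborel. x \<notin> {x. a \<bullet> x = 0}"
  proof (rule AE_not_in)
    have "{x. a \<bullet> x = 0} \<in> null_sets lebesgue"
      using negligible_hyperplane[of a 0] a by (simp add: negligible_iff_null_sets)
    moreover have "{x. a \<bullet> x = 0} \<in> sets borel" using closed_hyperplane[of a 0] by simp
    ultimately show "{x. a \<bullet> x = 0} \<in> null_sets lborel" by (simp add: null_sets_completion_iff)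
  qed
  ultimately have "AE x in lborel. x \<notin> K"
    by eventually_elim (auto simp: indicator_def inner_commute)
  then have "AE x in lborel. x \<notin> interior K" by (rule eventually_mono) (use interior_subset in blast)
  then have "emeasure lborel (interior K) = 0"
    by (subst (asm) AE_iff_measurable[of "interior K"]) auto
  then show False using emK by simp
qed

section \<open>Mixed affine surface areas\<close>

lemma weighted_arith_geo_mean:
  fixes a w :: "'i \<Rightarrow> real"
  assumes I: "finite I" and w: "\<And>i. i \<in> I \<Longrightarrow> 0 \<le> w i" "(\<Sum>i\<in>I. w i) = 1" and a: "\<And>i. i \<in> I \<Longrightarrow> 0 < a i"
  shows "(\<Prod>i\<in>I. a i powr w i) \<le> (\<Sum>i\<in>I. w i * a i)"
proof -
  have "(\<Prod>i\<in>I. a i powr w i) = exp (\<Sum>i\<in>I. w i * ln (a i))"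
    using I a by (simp add: exp_sum powr_def)  (intro prod.cong, auto simp: powr_def dest: a)
  also have "\<dots> \<le> (\<Sum>i\<in>I. w i * exp (ln (a i)))"
    using convex_on_sum[OF I _ exp_convex, of w "\<lambda>i. ln (a i)"] I w by (cases "I = {}") auto
  also have "\<dots> = (\<Sum>i\<in>I. w i * a i)" using a by (intro sum.cong) auto
  finally show ?thesis .
qed

text \<open>After division by their integrals \<open>a i\<close> and \<open>b i\<close>, all the
  functions \<open>f i\<close> and \<open>g i\<close> have integral 1. The weighted
  arithmetic-geometric mean inequality, applied pointwise, bounds the integrand by \<open>C\<close>
  times the convex combination \<open>G\<close>, and \<open>G\<close> has integral 1. This is
  Hoelder's inequality for \<open>2 * n\<close> functions.\<close>

lemma mixed_as_bound:
  fixes K :: "'n::finite \<Rightarrow> (real^'n) set" and p :: real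
  assumes gp: "\<And>i. gauss_pair (K i) (\<nu> i) (X i)" and p: "p \<ge> 0"
  shows "0 \<le> mixed_as p K"
    and "mixed_as p K ^ CARD('n) \<le>
      (\<Prod>i\<in>UNIV. (real CARD('n) * vol (K i)) powr (CARD('n) / (CARD('n) + p)) * (real CARD('n) * vol (polar (K i))) powr (p / (CARD('n) + p)))"
proof -
  define n where "n = real CARD('n)"
  have n: "n > 0" "n \<ge> 1" by (simp_all add: n_def Suc_le_eq)
  define a where "a i = n * vol (K i)" for i
  define b where "b i = n * vol (polar (K i))" for i
  have bd: "origin_body (K i)" "origin_body (polar (K i))" for i
    using gp[of i] gauss_pair.body origin_body_polar by blast+
  have a: "a i > 0" and b: "b i > 0" for i using n vol_pos[OF bd(1)] vol_pos[OF bd(2)] by (auto simp: a_def b_def)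
  define f where "f i u = support_function (K i) u * gauss_pair.curv (X i) u" for i u
  define g where "g i u = 1 / support_function (K i) u ^ CARD('n)" for i u
  \<comment> \<open>The exponents are determined by comparing powers: the curvature requires
    \<alpha>, and the support function requires
    \<open>\<alpha> - n * \<beta> = (1 - p) * \<alpha>\<close>. The sum of all \<open>2 * n\<close>
    exponents is then 1.\<close>
  define \<alpha> where "\<alpha> = 1 / (n + p)"
  define \<beta> where "\<beta> = p / (n * (n + p))"
  have ab0: "\<alpha> \<ge> 0" "\<beta> \<ge> 0" using n p by (auto simp: \<alpha>_def \<beta>_def)
  have ab1: "n * (\<alpha> + \<beta>) = 1" using n p by (simp add: \<alpha>_def \<beta>_def divide_simps) 
  have [measurable]: "f i \<in> borel_measurable borel" "g i \<in> borel_measurable borel" for i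
    unfolding f_def g_def using gauss_pair.h_measurable[OF gp[of i]] gauss_pair.curv_measurable[OF gp[of i]] by measurable
  have fpos: "f i u > 0" and gpos: "g i u > 0" and f_eq: "f i u = support_function (K i) u * curvature_function (K i) u"
    if u: "norm u = 1" for i u
  proof -
    have "u \<noteq> 0" using u by auto
    then have "support_function (K i) u > 0" by (rule support_pos[OF bd(1)])
    then show "f i u > 0" "g i u > 0" using gauss_pair.curv_pos[OF gp u, of i] by (auto simp: f_def g_def)
    show "f i u = support_function (K i) u * curvature_function (K i) u"
      using gauss_pair.curv_eq[OF gp u, of i] by (simp add: f_def)
  qed
  have sph: "(\<lambda>u::real^'n. F u) \<in> borel_measurable sphere_measure" if "F \<in> borel_measurable borel" for F :: "real^'n \<Rightarrow> real"
    using that by (simp add: measurable_cong_sets[OF sets_sphere_measure refl] measurable_restrict_space1)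
  have If: "integrable sphere_measure (f i)" "(LINT u|sphere_measure. f i u) = a i"
    and Ig: "integrable sphere_measure (g i)" "(LINT u|sphere_measure. g i u) = b i" for i
  proof -
    have nf: "(\<integral>\<^sup>+u. ennreal (f i u) \<partial>sphere_measure) = ennreal (a i)"
      unfolding f_def a_def n_def by (rule gauss_pair.nn_integral_support_curvature[OF gp])
    have ng: "(\<integral>\<^sup>+u. ennreal (g i u) \<partial>sphere_measure) = ennreal (b i)"
      unfolding g_def b_def n_def by (rule gauss_pair.nn_integral_support_power[OF gp])
    have AEf: "AE u in sphere_measure. 0 \<le> f i u" and AEg: "AE u in sphere_measure. 0 \<le> g i u"
      using fpos gpos by (auto intro!: AE_I2 less_imp_le)
    show "integrable sphere_measure (f i)" "integrable sphere_measure (g i)"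
      using nf ng AEf AEg by (auto intro!: integrableI_nonneg sph)
    show "(LINT u|sphere_measure. f i u) = a i" "(LINT u|sphere_measure. g i u) = b i"
      using nf ng AEf AEg a[of i] b[of i] by (auto simp: integral_eq_nn_integral sph)
  qed
  define F where "F u = (\<Prod>i\<in>UNIV. support_function (K i) u powr (1 - p) * curvature_function (K i) u) powr (1 / (real CARD('n) + p))" for u
  have mas: "mixed_as p K = (LINT u|sphere_measure. F u)" by (simp add: mixed_as_def F_def)
  show "0 \<le> mixed_as p K" unfolding mas by (intro Bochner_Integration.integral_nonneg_AE AE_I2) (simp add: F_def)
  define C where "C = (\<Prod>i\<in>(UNIV::'n set). a i powr \<alpha> * b i powr \<beta>)"
  have Cpos: "C > 0" unfolding C_def using a b by (intro prod_pos) (auto intro: mult_pos_pos simp: less_le)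
  have F_eq: "F u = (\<Prod>i\<in>UNIV. f i u powr \<alpha> * g i u powr \<beta>)" if u: "norm u = 1" for u
  proof -
    have "F u = (\<Prod>i\<in>UNIV. (support_function (K i) u powr (1 - p) * curvature_function (K i) u) powr \<alpha>)"
      unfolding F_def \<alpha>_def n_def by (rule prod_powr_distrib)
    also have "\<dots> = (\<Prod>i\<in>UNIV. f i u powr \<alpha> * g i u powr \<beta>)"
    proof (rule prod.cong)
      fix i
      let ?h = "support_function (K i) u" and ?k = "curvature_function (K i) u"
      have h: "?h > 0" using u by (intro support_pos[OF bd(1)]) auto
      have k: "?k > 0" using gauss_pair.curv_eq[OF gp u] gauss_pair.curv_pos[OF gp u] by simp
      have "g i u = ?h powr (- n)" using h by (simp add: g_def n_def powr_minus powr_realpow divide_inverse)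
      then have "g i u powr \<beta> = ?h powr (- n * \<beta>)" by (simp only: powr_powr)
      moreover have "f i u powr \<alpha> = ?h powr \<alpha> * ?k powr \<alpha>" using h k by (simp add: f_eq[OF u] powr_mult)
      ultimately have "f i u powr \<alpha> * g i u powr \<beta> = ?h powr (\<alpha> + - n * \<beta>) * ?k powr \<alpha>"
        by (simp only: powr_add mult_ac)
      moreover have "\<alpha> + - n * \<beta> = (1 - p) * \<alpha>"
      proof -
        have "n * \<beta> = p * \<alpha>" using n by (simp add: \<alpha>_def \<beta>_def)
        then show ?thesis by (simp add: algebra_simps)
      qed
      ultimately show "(?h powr (1 - p) * ?k) powr \<alpha> = f i u powr \<alpha> * g i u powr \<beta>"
        using h k by (simp add: powr_mult powr_powr)
    qed simp
    finally show ?thesis .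
  qed
  define G where "G u = (\<Sum>i\<in>(UNIV::'n set). \<alpha> * (f i u / a i) + \<beta> * (g i u / b i))" for u
  have Gint: "integrable sphere_measure G"
    unfolding G_def using If Ig by (intro Bochner_Integration.integrable_sum Bochner_Integration.integrable_add integrable_mult_right integrable_divide) auto
  have "(LINT u|sphere_measure. G u) = (\<Sum>i\<in>(UNIV::'n set). LINT u|sphere_measure. \<alpha> * (f i u / a i) + \<beta> * (g i u / b i))"
    unfolding G_def using If Ig
    by (intro Bochner_Integration.integral_sum Bochner_Integration.integrable_add integrable_mult_right integrable_divide) auto
  also have "\<dots> = (\<Sum>i\<in>(UNIV::'n set). \<alpha> + \<beta>)"
  proof (rule sum.cong)
    fix i
    have "a i \<noteq> 0" "b i \<noteq> 0" using a[of i] b[of i] by auto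
    then show "(LINT u|sphere_measure. \<alpha> * (f i u / a i) + \<beta> * (g i u / b i)) = \<alpha> + \<beta>"
      using If[of i] Ig[of i] by simp
  qed simp
  also have "\<dots> = 1" using ab1 by (simp add: n_def)
  finally have G1: "(LINT u|sphere_measure. G u) = 1" .
  have FG: "F u \<le> C * G u" if u: "norm u = 1" for u
  proof -
    \<comment> \<open>The \<open>2 * n\<close> weights are indexed by pairs: \<open>True\<close>
      stands for \<open>f i\<close>, \<open>False\<close> for \<open>g i\<close>.\<close>
    let ?I = "UNIV \<times> (UNIV :: bool set) :: ('n \<times> bool) set"
    let ?w = "\<lambda>(i, c). if c then \<alpha> else \<beta>" and ?a = "\<lambda>(i::'n, c). if c then f i u / a i else g i u / b i"
    have "(\<Prod>x\<in>?I. ?a x powr ?w x) \<le> (\<Sum>x\<in>?I. ?w x * ?a x)"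
    proof (rule weighted_arith_geo_mean)
      show "(\<Sum>x\<in>?I. ?w x) = 1" using ab1 by (simp add: sum.cartesian_product[symmetric] UNIV_bool n_def algebra_simps)
    qed (use ab0 fpos[OF u] gpos[OF u] a b in auto)
    also have "(\<Sum>x\<in>?I. ?w x * ?a x) = G u"
      by (simp add: sum.cartesian_product' UNIV_bool G_def add.commute)
    also have "(\<Prod>x\<in>?I. ?a x powr ?w x) = (\<Prod>i\<in>UNIV. (f i u / a i) powr \<alpha> * (g i u / b i) powr \<beta>)"
      by (simp add: prod.cartesian_product' UNIV_bool mult.commute)
    also have "\<dots> = (\<Prod>i\<in>UNIV. (f i u powr \<alpha> * g i u powr \<beta>) / (a i powr \<alpha> * b i powr \<beta>))"
      using fpos[OF u] gpos[OF u] a b by (intro prod.cong) (auto simp: powr_divide less_imp_le)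
    also have "\<dots> = F u / C" by (simp add: prod_dividef F_eq[OF u] C_def)
    finally show ?thesis using Cpos by (simp add: field_simps)
  qed
  \<comment> \<open>If \<open>F\<close> is not integrable, its integral is 0 by convention, which
    lies below the bound as well; so the integrability of \<open>F\<close> need not be
    settled.\<close>
  have "mixed_as p K \<le> (LINT u|sphere_measure. C * G u)"
  proof (cases "integrable sphere_measure F")
    case True
    then show ?thesis unfolding mas using Gint FG by (intro integral_mono) auto
  next
    case False
    have "mixed_as p K = 0" unfolding mas by (rule not_integrable_integral_eq[OF False])
    then show ?thesis using G1 Cpos by simp
  qed
  then have "mixed_as p K \<le> C" using G1 by simp
  then have "mixed_as p K ^ CARD('n) \<le> C ^ CARD('n)"
    using \<open>0 \<le> mixed_as p K\<close> by (rule power_mono)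
  also have "C ^ CARD('n) = (\<Prod>i\<in>UNIV. a i powr (n / (n + p)) * b i powr (p / (n + p)))"
  proof -
    have "C ^ CARD('n) = (\<Prod>i\<in>UNIV. (a i powr \<alpha> * b i powr \<beta>) ^ CARD('n))"
      unfolding C_def by (rule prod_power_distrib)
    also have "\<dots> = (\<Prod>i\<in>UNIV. a i powr (n / (n + p)) * b i powr (p / (n + p)))"
    proof (rule prod.cong)
      fix i
      have "(a i powr \<alpha> * b i powr \<beta>) ^ CARD('n) = (a i powr \<alpha> * b i powr \<beta>) powr n"
        using a[of i] b[of i] by (simp add: powr_realpow[symmetric] n_def)
      also have "\<dots> = a i powr (\<alpha> * n) * b i powr (\<beta> * n)"
        by (simp add: powr_mult powr_powr)
      also have "\<alpha> * n = n / (n + p)" by (simp add: \<alpha>_def)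
      also have "\<beta> * n = p / (n + p)" using n by (simp add: \<beta>_def)
      finally show "(a i powr \<alpha> * b i powr \<beta>) ^ CARD('n) = a i powr (n / (n + p)) * b i powr (p / (n + p))" .
    qed simp
    finally show ?thesis .
  qed
  finally show "mixed_as p K ^ CARD('n) \<le>
      (\<Prod>i\<in>UNIV. (real CARD('n) * vol (K i)) powr (CARD('n) / (CARD('n) + p)) * (real CARD('n) * vol (polar (K i))) powr (p / (CARD('n) + p)))"
    unfolding a_def b_def n_def .
qed

text \<open>\<open>mixed_as_bound\<close> is used for the bodies and for their polars. By the
  bipolar theorem the second use exchanges the two volumes, so the exponents
  \<open>n / (n + p)\<close> and \<open>p / (n + p)\<close> of each volume add up to 1.\<close>

lemma mixed_as_product_bound:
  fixes K :: "'n::finite \<Rightarrow> (real^'n) set" and p :: real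
  assumes gp: "\<And>i. gauss_pair (K i) (\<nu> i) (X i)" and p: "p \<ge> 0"
  shows "mixed_as p K ^ CARD('n) * mixed_as p (\<lambda>i. polar (K i)) ^ CARD('n)
           \<le> real CARD('n) ^ (2 * CARD('n)) * (\<Prod>i\<in>UNIV. vol (K i) * vol (polar (K i)))"
    and "0 \<le> mixed_as p K * mixed_as p (\<lambda>i. polar (K i))"
proof -
  define n where "n = real CARD('n)"
  have n: "n > 0" by (simp add: n_def)
  let ?a = "\<lambda>i. n * vol (K i)" and ?b = "\<lambda>i. n * vol (polar (K i))"
  have bd: "origin_body (K i)" "origin_body (polar (K i))" for i
    using gp[of i] gauss_pair.body origin_body_polar by blast+
  have ab: "?a i > 0" "?b i > 0" for i using n vol_pos[OF bd(1)] vol_pos[OF bd(2)] by auto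
  note gp' = gauss_pair.gauss_pair_polar[OF gp]
  note 1 = mixed_as_bound[OF gp p]
  note 2 = mixed_as_bound[OF gp' p]
  show "0 \<le> mixed_as p K * mixed_as p (\<lambda>i. polar (K i))" using 1(1) 2(1) by simp
  let ?s = "n / (n + p)" and ?t = "p / (n + p)"
  have st: "?s + ?t = 1" using n p by (simp add: add_divide_distrib[symmetric])
  have pp: "polar (polar (K i)) = K i" for i by (rule polar_polar[OF bd(1)])
  have "mixed_as p K ^ CARD('n) * mixed_as p (\<lambda>i. polar (K i)) ^ CARD('n)
     \<le> (\<Prod>i\<in>UNIV. ?a i powr ?s * ?b i powr ?t) * (\<Prod>i\<in>UNIV. ?b i powr ?s * ?a i powr ?t)"
    using 1(2) 2(2) 1(1) 2(1) unfolding pp n_def by (intro mult_mono zero_le_power prod_nonneg) auto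
  also have "\<dots> = (\<Prod>i\<in>UNIV. (?a i powr ?s * ?b i powr ?t) * (?b i powr ?s * ?a i powr ?t))"
    by (rule prod.distrib[symmetric])
  also have "\<dots> = (\<Prod>i\<in>(UNIV::'n set). n\<^sup>2 * (vol (K i) * vol (polar (K i))))"
  proof (rule prod.cong)
    fix i
    have "(?a i powr ?s * ?b i powr ?t) * (?b i powr ?s * ?a i powr ?t) = ?a i powr (?s + ?t) * ?b i powr (?s + ?t)"
      unfolding powr_add by (simp only: mult_ac)
    also have "\<dots> = n\<^sup>2 * (vol (K i) * vol (polar (K i)))"
      unfolding st using ab[of i] by (simp add: power2_eq_square)
    finally show "(?a i powr ?s * ?b i powr ?t) * (?b i powr ?s * ?a i powr ?t) = n\<^sup>2 * (vol (K i) * vol (polar (K i)))" .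
  qed simp
  also have "\<dots> = n ^ (2 * CARD('n)) * (\<Prod>i\<in>UNIV. vol (K i) * vol (polar (K i)))"
    by (simp add: prod.distrib power_mult)
  finally show "mixed_as p K ^ CARD('n) * mixed_as p (\<lambda>i. polar (K i)) ^ CARD('n)
           \<le> real CARD('n) ^ (2 * CARD('n)) * (\<Prod>i\<in>UNIV. vol (K i) * vol (polar (K i)))"
    unfolding n_def .
qed

section \<open>Ellipsoids\<close>

locale ellipsoid_map =
  fixes T :: "real^'n::finite \<Rightarrow> real^'n"
  assumes lin: "linear T" and bij: "bij T"
begin

definition E :: "(real^'n) set" where "E = T ` cball 0 1"
definition S :: "real^'n \<Rightarrow> real^'n" where "S = inv T"

lemma ST [simp]: "S (T x) = x" and TS [simp]: "T (S x) = x"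
  using bij by (simp_all add: S_def bij_is_inj bij_is_surj surj_f_inv_f)

lemma linear_S: "linear S"
proof (rule linearI)
  fix x y :: "real^'n" and c :: real
  have "T (S x + S y) = x + y" "T (c *\<^sub>R S x) = c *\<^sub>R x" by (simp_all add: linear_add[OF lin] linear_scale[OF lin])
  then show "S (x + y) = S x + S y" "S (c *\<^sub>R x) = c *\<^sub>R S x" using ST by metis+
qed

lemma adj_T: "T x \<bullet> y = x \<bullet> adjoint T y" and adj_S: "S x \<bullet> y = x \<bullet> adjoint S y"
  using adjoint_works[OF lin] adjoint_works[OF linear_S] by (simp_all add: inner_commute)

lemma linear_adj: "linear (adjoint T)" "linear (adjoint S)"
  using adjoint_linear lin linear_S by blast+

lemma adj_TS [simp]: "adjoint T (adjoint S x) = x" and adj_ST [simp]: "adjoint S (adjoint T x) = x"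
proof -
  show "adjoint T (adjoint S x) = x"
    by (rule vector_eq_ldot[THEN iffD1]) (simp add: adj_T[symmetric] adj_S[symmetric])
  show "adjoint S (adjoint T x) = x"
    by (rule vector_eq_ldot[THEN iffD1]) (simp add: adj_T[symmetric] adj_S[symmetric])
qed

lemma mem_E: "x \<in> E \<longleftrightarrow> norm (S x) \<le> 1"
  unfolding E_def by (auto simp: image_iff intro: bexI[of _ "S x"]) 

lemma T_0 [simp]: "T x = 0 \<longleftrightarrow> x = 0" and S_0 [simp]: "S x = 0 \<longleftrightarrow> x = 0"
  and adj_0 [simp]: "adjoint T x = 0 \<longleftrightarrow> x = 0" "adjoint S x = 0 \<longleftrightarrow> x = 0"
  using linear_0[OF lin] linear_0[OF linear_S] linear_0[OF linear_adj(1)] linear_0[OF linear_adj(2)]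
  by (metis ST TS adj_TS adj_ST)+

lemma body_E: "origin_body E"
  unfolding origin_body_def
proof (intro conjI)
  show "compact E" unfolding E_def
    using lin by (intro compact_continuous_image linear_continuous_on) (auto simp: linear_conv_bounded_linear)
  show "convex E" unfolding E_def by (rule convex_linear_image[OF lin convex_cball])
  have "open {x. norm (S x) < 1}"
  proof (intro open_Collect_less continuous_on_norm continuous_on_const)
    show "continuous_on UNIV S"
      by (rule linear_continuous_on) (simp add: linear_conv_bounded_linear[symmetric] linear_S)
  qed
  moreover have "{x. norm (S x) < 1} \<subseteq> E" by (simp add: subset_iff mem_E)
  moreover have "0 \<in> {x. norm (S x) < 1}" by (simp add: linear_0[OF linear_S])
  ultimately show "0 \<in> interior E" using interiorI by blast
qed

lemma support_E: "support_function E u = norm (adjoint T u)"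
proof (rule antisym)
  show "support_function E u \<le> norm (adjoint T u)"
  proof (rule support_le[OF body_E])
    fix x assume "x \<in> E"
    then have "norm (S x) \<le> 1" by (simp add: mem_E)
    have "x \<bullet> u = S x \<bullet> adjoint T u" using adj_T[of "S x" u] by simp
    also have "\<dots> \<le> norm (S x) * norm (adjoint T u)" by (rule norm_cauchy_schwarz)
    also have "\<dots> \<le> 1 * norm (adjoint T u)" using \<open>norm (S x) \<le> 1\<close> by (rule mult_right_mono) simp
    finally show "x \<bullet> u \<le> norm (adjoint T u)" by simp
  qed
  show "norm (adjoint T u) \<le> support_function E u"
  proof (cases "u = 0")
    case False
    let ?w = "adjoint T u /\<^sub>R norm (adjoint T u)"
    have "T ?w \<in> E" using False by (simp add: mem_E)
    from inner_le_support[OF body_E this, of u]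
    show ?thesis using False by (simp add: adj_T power2_norm_eq_inner[symmetric] power2_eq_square mult.assoc[symmetric])
  qed (simp add: body_E linear_0[OF linear_adj(1)])
qed

lemma polar_E: "polar E = adjoint S ` cball 0 1"
proof -
  have "y \<in> polar E \<longleftrightarrow> y \<in> adjoint S ` cball 0 1" for y
  proof -
    have "y \<in> polar E \<longleftrightarrow> norm (adjoint T y) \<le> 1" by (simp add: mem_polar_iff[OF body_E] support_E)
    also have "\<dots> \<longleftrightarrow> y \<in> adjoint S ` cball 0 1"
      by (auto simp: image_iff intro: bexI[of _ "adjoint T y"])
    finally show ?thesis .
  qed
  then show ?thesis by blast
qed

lemma polar_map: "ellipsoid_map (adjoint S)"
proof (rule ellipsoid_map.intro)
  show "linear (adjoint S)" by (rule linear_adj)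
  show "bij (adjoint S)" by (rule o_bij[of "adjoint T"]) (auto simp: fun_eq_iff)
qed

lemma support_polar_E: "support_function (polar E) x = norm (S x)"
proof -
  interpret P: ellipsoid_map "adjoint S" by (rule polar_map)
  have "support_function (polar E) x = norm (adjoint (adjoint S) x)"
    using P.support_E by (simp add: P.E_def polar_E)
  then show ?thesis by (simp add: adjoint_adjoint linear_S)
qed

lemma frontier_E: "x \<in> frontier E \<longleftrightarrow> norm (S x) = 1"
  using frontier_body_iff[OF body_E] support_polar_E by simp

text \<open>The gauge of \<open>E\<close> is \<open>norm (S y)\<close> and the support function is
  \<open>norm (adjoint T u)\<close>: this is the normalised gradient of the former, and
  \<open>X\<close> is the gradient of the latter.\<close>

definition \<nu> :: "real^'n \<Rightarrow> real^'n" where "\<nu> y = adjoint S (S y) /\<^sub>R norm (adjoint S (S y))"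
definition X :: "real^'n \<Rightarrow> real^'n" where "X u = T (adjoint T u) /\<^sub>R norm (adjoint T u)"

text \<open>Equality in the Cauchy--Schwarz inequality for \<open>S x\<close> and
  \<open>adjoint T u\<close>.\<close>

lemma normal_E:
  assumes x: "x \<in> frontier E"
  shows "outer_unit_normal E x u \<longleftrightarrow> norm u = 1 \<and> adjoint T u = norm (adjoint T u) *\<^sub>R S x"
proof -
  have xE: "x \<in> E" and Sx: "norm (S x) = 1" using x by (auto simp: frontier_E mem_E)
  have "x \<bullet> u = norm (adjoint T u) \<longleftrightarrow> S x \<bullet> adjoint T u = norm (S x) * norm (adjoint T u)"
    using adj_T[of "S x" u] Sx by simp
  also have "\<dots> \<longleftrightarrow> norm (S x) *\<^sub>R adjoint T u = norm (adjoint T u) *\<^sub>R S x"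
    by (rule norm_cauchy_schwarz_eq)
  finally show ?thesis using Sx outer_unit_normal_iff[OF body_E xE, of u] by (simp add: support_E)
qed

lemma gauss_pair_E: "gauss_pair E \<nu> X"
proof
  have diff: "(\<lambda>y. L y /\<^sub>R norm (M y)) differentiable (at x)"
    if "linear L" "linear M" "M x \<noteq> 0" for L M :: "real^'n \<Rightarrow> real^'n" and x
  proof -
    have bl: "bounded_linear L" "bounded_linear M" using that linear_conv_bounded_linear by auto
    have "(\<lambda>y. norm (M y)) differentiable (at x)"
      using has_derivative_compose[OF bounded_linear_imp_has_derivative[OF bl(2)] has_derivative_norm_at[OF that(3)]]
      by (rule differentiableI)
    then have "(\<lambda>y. inverse (norm (M y))) differentiable (at x)" using that by (intro differentiable_inverse) auto
    then show ?thesis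
      by (intro differentiable_scaleR differentiableI[OF bounded_linear_imp_has_derivative[OF bl(1)]])
  qed
  show "origin_body E" by (rule body_E)
  have l1: "linear (\<lambda>y. adjoint S (S y))" using linear_compose[OF linear_S linear_adj(2)] by (simp add: o_def)
  have l2: "linear (\<lambda>y. T (adjoint T y))" using linear_compose[OF linear_adj(1) lin] by (simp add: o_def)
  show "\<nu> differentiable (at x)" if "x \<noteq> 0" for x
    unfolding \<nu>_def using that by (intro diff l1) auto
  show "X differentiable (at x)" if "x \<noteq> 0" for x
    unfolding X_def using that by (intro diff l2 linear_adj) auto
  show "\<nu> (c *\<^sub>R x) = \<nu> x" if "c > 0" for c x
    unfolding \<nu>_def using linear_scale[OF l1, of c x] that by simp
  show "X (c *\<^sub>R x) = X x" if "c > 0" for c x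
    unfolding X_def using linear_scale[OF l2, of c x] linear_scale[OF linear_adj(1), of c x] that by simp
  show "outer_unit_normal E x u \<longleftrightarrow> u = \<nu> x" if x: "x \<in> frontier E" for x u
  proof -
    have Sx: "norm (S x) = 1" "x \<noteq> 0" using x by (auto simp: frontier_E linear_0[OF linear_S])
    let ?y = "adjoint S (S x)"
    have y: "?y \<noteq> 0" using Sx by simp
    show ?thesis unfolding normal_E[OF x]
    proof
      assume u: "norm u = 1 \<and> adjoint T u = norm (adjoint T u) *\<^sub>R S x"
      define c where "c = norm (adjoint T u)"
      have "u \<noteq> 0" using u by auto
      then have c: "c > 0" by (simp add: c_def)
      have "adjoint S (adjoint T u) = adjoint S (c *\<^sub>R S x)" using u by (simp add: c_def)
      then have uc: "u = c *\<^sub>R ?y" by (simp add: linear_scale[OF linear_adj(2)])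
      then have "c * norm ?y = 1" using u c by simp
      then have "c = inverse (norm ?y)" using y by (simp add: field_simps)
      then show "u = \<nu> x" using uc by (simp add: \<nu>_def)
    next
      assume u: "u = \<nu> x"
      have "adjoint T u = inverse (norm ?y) *\<^sub>R S x"
        unfolding u \<nu>_def by (simp add: linear_scale[OF linear_adj(1)])
      moreover have "norm u = 1" unfolding u \<nu>_def using y by simp
      ultimately show "norm u = 1 \<and> adjoint T u = norm (adjoint T u) *\<^sub>R S x" using Sx by simp
    qed
  qed
  show "x \<in> frontier E \<and> outer_unit_normal E x u \<longleftrightarrow> x = X u" if u: "norm u = 1" for x u
  proof
    have u0: "u \<noteq> 0" using u by auto
    {
      assume "x = X u"
      then have Sx: "S x = adjoint T u /\<^sub>R norm (adjoint T u)" by (simp add: X_def linear_scale[OF linear_S])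
      then have f: "x \<in> frontier E" using u0 by (simp add: frontier_E)
      show "x \<in> frontier E \<and> outer_unit_normal E x u"
        using f u u0 Sx by (simp add: normal_E[OF f])
    }
    assume x: "x \<in> frontier E \<and> outer_unit_normal E x u"
    then have "adjoint T u = norm (adjoint T u) *\<^sub>R S x" using normal_E by blast
    then have "T (adjoint T u) = norm (adjoint T u) *\<^sub>R x" by (metis TS lin linear_scale)
    then show "x = X u" using u0 by (simp add: X_def)
  qed
qed

lemma det_adjoint: "det (matrix (adjoint T)) = det (matrix T)"
  using matrix_adjoint[OF lin] by (simp add: det_transpose)

lemma det_nz: "det (matrix T) \<noteq> 0"
  using det_nz_iff_inj[OF lin] bij_is_inj[OF bij] by simp

text \<open>The parametrisation \<open>\<Phi>\<close> of the body is \<open>T\<close> composed with its adjoint, applied to the parametrisation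
  \<open>\<Theta>\<close> of the polar body.\<close>

lemma curvature_E:
  assumes u: "norm u = 1"
  shows "support_function E u * curvature_function E u = (det (matrix T))\<^sup>2 / support_function E u ^ CARD('n)"
proof -
  interpret G: gauss_pair E \<nu> X by (rule gauss_pair_E)
  have u0: "u \<noteq> 0" using u by auto
  let ?M = "\<lambda>v. T (adjoint T v)"
  let ?D = "\<lambda>v. (norm u / G.h u) *\<^sub>R (v + ((u /\<^sub>R (norm u)\<^sup>2 - X u /\<^sub>R G.h u) \<bullet> v) *\<^sub>R u)"
  have lM: "linear ?M" using linear_compose[OF linear_adj(1) lin] by (simp add: o_def)
  have eq: "G.\<Phi> = (\<lambda>y. ?M (G.\<Theta> y))"
    by (auto simp: G.\<Phi>_def G.\<Theta>_def X_def support_E linear_scale[OF lM] divide_inverse)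
  have "(G.\<Phi> has_derivative (\<lambda>v. ?M (?D v))) (at u)"
    unfolding eq
    by (rule has_derivative_compose[OF G.\<Theta>_der[OF u0] bounded_linear_imp_has_derivative])
      (use lM linear_conv_bounded_linear in blast)
  \<comment> \<open>The determinant of this derivative is computed twice: by
    \<open>G.det_\<Phi>'\<close> it is the support function times the curvature function, and by the
    factorisation it is the right-hand side.\<close>
  then have "G.\<Phi>' u = (\<lambda>v. ?M (?D v))" by (rule has_derivative_unique[OF G.\<Phi>_der[OF u0]])
  then have "det (matrix (G.\<Phi>' u)) = det (matrix ?M) * det (matrix ?D)"
    using det_compose[OF lM has_derivative_linear[OF G.\<Theta>_der[OF u0]]] by simp
  also have "det (matrix ?M) = (det (matrix T))\<^sup>2"
    unfolding det_compose[OF lin linear_adj(1)] det_adjoint power2_eq_square ..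
  also have "det (matrix ?D) = (norm u / G.h u) ^ CARD('n)" by (rule G.det_\<Theta>'[OF u0])
  finally show ?thesis using G.det_\<Phi>'[OF u0] u by (simp add: power_divide)
qed

lemma vol_E: "vol E = \<bar>det (matrix T)\<bar> * vol (cball 0 1 :: (real^'n) set)"
proof -
  have B: "origin_body (cball 0 1 :: (real^'n) set)" by (simp add: origin_body_def)
  have im: "T ` ball 0 1 = interior E"
  proof -
    have "x \<in> T ` ball 0 1 \<longleftrightarrow> norm (S x) < 1" for x
      by (auto simp: image_iff intro: bexI[of _ "S x"])
    then show ?thesis using interior_body_iff[OF body_E] support_polar_E by auto
  qed
  have "(\<integral>\<^sup>+x. ennreal \<bar>det (matrix T)\<bar> * indicator (ball (0::real^'n) 1) x \<partial>lborel) = emeasure lborel (interior E)"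
  proof (rule emeasure_differentiable_image[where f=T and f'="\<lambda>_. T" and D="\<lambda>_. \<bar>det (matrix T)\<bar>", OF _ _ _ im])
    show "(T has_derivative T) (at x)" for x
      using lin linear_conv_bounded_linear bounded_linear_imp_has_derivative by blast
    show "inj_on T (ball 0 1)" using bij_is_inj[OF bij] inj_on_subset by blast
    show "emeasure lborel (interior E) < \<infinity>" by (simp add: emeasure_interior_body[OF body_E])
  qed auto
  also have "(\<integral>\<^sup>+x. ennreal \<bar>det (matrix T)\<bar> * indicator (ball (0::real^'n) 1) x \<partial>lborel) = ennreal \<bar>det (matrix T)\<bar> * emeasure lborel (ball (0::real^'n) 1)"
    by (rule nn_integral_cmult_indicator) simp
  also have "emeasure lborel (ball (0::real^'n) 1) = ennreal (vol (cball 0 1 :: (real^'n) set))"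
    using emeasure_interior_body[OF B] by simp
  finally have "ennreal (\<bar>det (matrix T)\<bar> * vol (cball 0 1 :: (real^'n) set)) = ennreal (vol E)"
    unfolding emeasure_interior_body[OF body_E] using vol_pos[OF B] by (simp add: ennreal_mult)
  then show ?thesis using vol_pos[OF B] vol_pos[OF body_E] by (simp add: ennreal_inj)
qed

lemma scaled_map:
  assumes "c \<noteq> 0" shows "ellipsoid_map (\<lambda>x. c *\<^sub>R T x)"
proof (rule ellipsoid_map.intro)
  show "linear (\<lambda>x. c *\<^sub>R T x)" by (rule linear_compose_scale_right[OF lin])
  show "bij (\<lambda>x. c *\<^sub>R T x)"
    by (rule o_bij[of "\<lambda>y. S (y /\<^sub>R c)"]) (use assms in \<open>auto simp: fun_eq_iff\<close>)
qed

end

lemma det_scaled: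
  fixes T :: "real^'n::finite \<Rightarrow> real^'n"
  assumes "linear T" shows "det (matrix (\<lambda>x. c *\<^sub>R T x)) = c ^ CARD('n) * det (matrix T)"
  using det_compose[of "(*\<^sub>R) c :: real^'n \<Rightarrow> real^'n", OF _ assms] by (simp add: linear_scale_self det_matrix_scaleR)

text \<open>By \<open>curvature_E\<close> the factor of the body \<open>i\<close> is a constant
  times \<open>(c i * h) powr (- (n + p))\<close>, with \<open>h\<close> the support function of the
  undilated ellipsoid. The exponent \<open>1 / (n + p)\<close> thus leaves
  \<open>1 / (c i * h)\<close>, and the product over the \<open>n\<close> bodies is a multiple of
  \<open>1 / h ^ n\<close>, whose integral gives the volume of the polar ellipsoid.\<close>

lemma mixed_as_dilated_ellipsoids:
  fixes T :: "real^'n::finite \<Rightarrow> real^'n" and c :: "'n \<Rightarrow> real" and p :: real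
  assumes T: "ellipsoid_map T" and c: "\<And>i. c i > 0" and p: "p \<ge> 0"
  shows "mixed_as p (\<lambda>i. (\<lambda>x. c i *\<^sub>R T x) ` cball 0 1) =
    (\<Prod>i\<in>UNIV. (c i ^ CARD('n) * det (matrix T))\<^sup>2) powr (1 / (CARD('n) + p)) / (\<Prod>i\<in>UNIV. c i)
      * (CARD('n) * vol (polar (T ` cball 0 1)))"
proof -
  interpret ellipsoid_map T by (rule T)
  interpret G: gauss_pair E \<nu> X by (rule gauss_pair_E)
  define n where "n = real CARD('n)"
  have n: "n > 0" by (simp add: n_def)
  let ?K = "\<lambda>i. (\<lambda>x. c i *\<^sub>R T x) ` cball 0 1"
  let ?D = "\<lambda>i. (c i ^ CARD('n) * det (matrix T))\<^sup>2"
  define C where "C = (\<Prod>i\<in>UNIV. ?D i) powr (1 / (n + p)) / (\<Prod>i\<in>UNIV. c i)"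
  have "(LINT u|sphere_measure.
        (\<Prod>i\<in>UNIV. support_function (?K i) u powr (1 - p) * curvature_function (?K i) u)
          powr (1 / (n + p))) = (LINT u|sphere_measure. C * (1 / G.h u ^ CARD('n)))"
  proof (rule Bochner_Integration.integral_cong[OF refl])
    fix u :: "real^'n" assume "u \<in> space sphere_measure"
    then have u: "norm u = 1" by simp
    then have u0: "u \<noteq> 0" by auto
    have h: "G.h u > 0" by (rule G.h_pos[OF u0])
    have fac: "support_function (?K i) u powr (1 - p) * curvature_function (?K i) u = ?D i * (c i * G.h u) powr (- (n + p))" for i
    proof -
      interpret Ei: ellipsoid_map "\<lambda>x. c i *\<^sub>R T x" using c[of i] by (intro scaled_map) simp
      have K: "?K i = Ei.E" by (simp add: Ei.E_def)
      have s: "support_function (?K i) u = c i * G.h u"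
      proof -
        have "adjoint (\<lambda>x. c i *\<^sub>R T x) = (\<lambda>y. c i *\<^sub>R adjoint T y)"
          by (rule adjoint_unique) (simp add: adj_T)
        then show ?thesis unfolding K Ei.support_E support_E using c[of i] by simp
      qed
      let ?s = "c i * G.h u"
      have sp: "?s > 0" using c[of i] h by simp
      have "?s * curvature_function (?K i) u = ?D i / ?s ^ CARD('n)"
        using Ei.curvature_E[OF u] s det_scaled[OF lin, of "c i"] by (simp add: K)
      moreover have "k = d / s" if "s > 0" "s * k = d" for s k d :: real using that by (simp add: field_simps)
      ultimately have "curvature_function (?K i) u = ?D i / ?s ^ CARD('n) / ?s" using sp by blast
      also have "\<dots> = ?D i * ?s powr (- n) * ?s powr (- 1)"
        using sp by (simp add: powr_minus powr_realpow n_def divide_inverse)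
      finally have "?s powr (1 - p) * curvature_function (?K i) u = ?D i * (?s powr (1 - p) * ?s powr (- n) * ?s powr (- 1))"
        by (simp only: mult_ac)
      also have "?s powr (1 - p) * ?s powr (- n) * ?s powr (- 1) = ?s powr ((1 - p) + (- n) + (- 1))"
        by (simp only: powr_add)
      also have "(1 - p) + (- n) + (- 1) = - (n + p)" by simp
      finally show ?thesis unfolding s .
    qed
    have "(\<Prod>i\<in>UNIV. ?D i * (c i * G.h u) powr (- (n + p))) powr (1 / (n + p)) =
      (\<Prod>i\<in>UNIV. ?D i) powr (1 / (n + p)) * (\<Prod>i\<in>UNIV. (c i * G.h u) powr (- (n + p))) powr (1 / (n + p))"
      unfolding prod.distrib by (rule powr_mult)
    also have "(\<Prod>i\<in>UNIV. (c i * G.h u) powr (- (n + p))) powr (1 / (n + p)) = (\<Prod>i\<in>UNIV. ((c i * G.h u) powr (- (n + p))) powr (1 / (n + p)))"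
      by (rule prod_powr_distrib)
    also have "\<dots> = (\<Prod>i\<in>UNIV. inverse (c i * G.h u))"
    proof (rule prod.cong)
      fix i
      have "- (n + p) * (1 / (n + p)) = -1" using n p by (simp add: field_simps)
      then have "((c i * G.h u) powr (- (n + p))) powr (1 / (n + p)) = (c i * G.h u) powr (-1)"
        by (simp only: powr_powr)
      also have "\<dots> = inverse (c i * G.h u)" using c[of i] h by (simp add: powr_minus)
      finally show "((c i * G.h u) powr (- (n + p))) powr (1 / (n + p)) = inverse (c i * G.h u)" .
    qed simp
    also have "\<dots> = inverse (\<Prod>i\<in>UNIV. c i) * inverse (G.h u ^ CARD('n))"
      by (simp add: prod_inversef[symmetric] prod.distrib power_inverse)
    finally show "(\<Prod>i\<in>UNIV. support_function (?K i) u powr (1 - p) * curvature_function (?K i) u) powr (1 / (n + p)) = C * (1 / G.h u ^ CARD('n))"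
      unfolding fac C_def by (simp add: divide_inverse mult_ac)
  qed
  also have "\<dots> = C * (LINT u|sphere_measure. 1 / G.h u ^ CARD('n))" by (rule integral_mult_right_zero)
  also have "(LINT u|sphere_measure. 1 / G.h u ^ CARD('n)) = CARD('n) * vol (polar E)"
  proof -
    have "AE u in sphere_measure. 0 \<le> 1 / G.h u ^ CARD('n)"
      using support_nonneg[OF body_E] by (intro AE_I2) auto
    moreover have "(\<lambda>u. 1 / G.h u ^ CARD('n)) \<in> borel_measurable sphere_measure"
      by (simp add: measurable_cong_sets[OF sets_sphere_measure refl] measurable_restrict_space1)
    ultimately show ?thesis
      using G.nn_integral_support_power vol_pos[OF G.polar_body] by (simp add: integral_eq_nn_integral)
  qed
  finally show ?thesis unfolding mixed_as_def C_def n_def E_def .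
qed

section \<open>Centred ellipsoids and the equality case\<close>

text \<open>The reflection in \<open>c\<close> preserves \<open>K\<close> and Lebesgue measure, so
  the first moment of \<open>K\<close> equals the volume times \<open>2 *\<^sub>R c\<close> minus
  itself. As the moment is 0 and the volume positive, \<open>c\<close> is 0.\<close>

lemma centroid_symmetric:
  fixes K :: "'a::euclidean_space set"
  assumes K: "origin_body K" and cen: "centroid K = 0" and sym: "\<And>x. x \<in> K \<Longrightarrow> 2 *\<^sub>R c - x \<in> K"
  shows "c = 0"
proof -
  have Kb: "K \<in> sets borel" using origin_body_D(6)[OF K] by (rule borel_closed)
  have int: "integrable lborel (\<lambda>x. indicator K x *\<^sub>R x)"
    using origin_body_D(1)[OF K] by (intro borel_integrable_compact) auto
  have int1: "integrable lborel (indicator K :: 'a \<Rightarrow> real)"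
    using emeasure_compact_finite[OF origin_body_D(1)[OF K]] Kb by (intro integrable_real_indicator) auto
  have 0: "(LINT x|lborel. indicator K x *\<^sub>R x) = 0" using centroid_eq_0_iff[OF K] cen by simp
  have "lborel = distr lborel borel (\<lambda>x. 2 *\<^sub>R c - x)"
    using lborel_affine[of "-1" "2 *\<^sub>R c"] by (simp add: density_1)
  then have "(LINT x|lborel. indicator K x *\<^sub>R x) = (LINT x|distr lborel borel (\<lambda>x. 2 *\<^sub>R c - x). indicator K x *\<^sub>R x)"
    by simp
  also have "\<dots> = (LINT x|lborel. indicator K (2 *\<^sub>R c - x) *\<^sub>R (2 *\<^sub>R c - x))"
    using Kb by (intro integral_distr) auto
  also have "\<dots> = (LINT x|lborel. indicator K x *\<^sub>R (2 *\<^sub>R c) - indicator K x *\<^sub>R x)"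
  proof (rule Bochner_Integration.integral_cong[OF refl])
    fix x
    have "2 *\<^sub>R c - x \<in> K \<longleftrightarrow> x \<in> K" using sym[of x] sym[of "2 *\<^sub>R c - x"] by auto
    then show "indicator K (2 *\<^sub>R c - x) *\<^sub>R (2 *\<^sub>R c - x) = indicator K x *\<^sub>R (2 *\<^sub>R c) - indicator K x *\<^sub>R x"
      by (simp add: indicator_def)
  qed
  also have "\<dots> = measure lborel K *\<^sub>R (2 *\<^sub>R c)"
    using int int1 0 Kb by simp
  finally have "measure lborel K *\<^sub>R c = 0" using 0 by simp
  moreover have "measure lborel K > 0"
    using vol_pos[OF K] Kb by (simp add: vol_def measure_completion)
  ultimately show "c = 0" by simp
qed

lemma centred_ellipsoid:
  fixes K :: "(real^'n::finite) set"
  assumes K: "origin_body K" and cen: "centroid K = 0" and ell: "ellipsoid K"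
  obtains T where "ellipsoid_map T" "K = T ` cball 0 1"
proof -
  obtain T :: "real^'n \<Rightarrow> real^'n" and c where T: "linear T" "bij T" "K = (\<lambda>x. c + T x) ` cball 0 1"
    using ell unfolding ellipsoid_def by blast
  have "2 *\<^sub>R c - x \<in> K" if xK: "x \<in> K" for x
  proof -
    obtain y where "norm y \<le> 1" "x = c + T y" using xK T(3) by auto
    then show ?thesis
      unfolding T(3) by (intro image_eqI[of _ _ "- y"]) (auto simp: linear_neg[OF T(1)] scaleR_2)
  qed
  then have "c = 0" by (rule centroid_symmetric[OF K cen])
  then show ?thesis using T by (intro that[of T]) (auto intro: ellipsoid_map.intro)
qed

lemma polar_scale:
  fixes K :: "'a::euclidean_space set"
  assumes "c > 0"
  shows "polar ((\<lambda>x. c *\<^sub>R x) ` K) = (\<lambda>x. inverse c *\<^sub>R x) ` polar K"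
proof -
  have "y \<in> polar ((\<lambda>x. c *\<^sub>R x) ` K) \<longleftrightarrow> c *\<^sub>R y \<in> polar K" for y by (simp add: polar_def)
  moreover have "c *\<^sub>R y \<in> polar K \<longleftrightarrow> y \<in> (\<lambda>x. inverse c *\<^sub>R x) ` polar K" for y
    using assms by (auto simp: image_iff intro: bexI[of _ "c *\<^sub>R y"])
  ultimately show ?thesis by blast
qed

lemma affine_surface_area_ball:
  assumes "p \<ge> 0"
  shows "affine_surface_area p (cball 0 1 :: (real^'n::finite) set) = CARD('n) * vol (cball 0 1 :: (real^'n) set)"
proof -
  let ?id = "\<lambda>x::real^'n. x"
  interpret I: ellipsoid_map ?id
    by (rule ellipsoid_map.intro) (auto simp: linear_id[unfolded id_def] bij_id[unfolded id_def])
  have "I.S = ?id" using I.ST by auto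
  moreover have "adjoint ?id = ?id" by (rule adjoint_unique) simp
  ultimately have "polar (cball 0 1 :: (real^'n) set) = cball 0 1"
    using I.polar_E by (simp add: I.E_def)
  moreover have "matrix ?id = mat 1" using matrix_id_mat_1 by (simp add: id_def)
  ultimately show ?thesis
    using mixed_as_dilated_ellipsoids[OF I.ellipsoid_map_axioms, of "\<lambda>_. 1" p] assms
    by (simp add: affine_surface_area_def)
qed

text \<open>The polars are dilates of the image of the ball under \<open>adjoint T.S\<close>, with
  reciprocal factors and reciprocal determinant. So all constants of
  \<open>mixed_as_dilated_ellipsoids\<close> cancel in the product, and the volumes of an ellipsoid
  and of its polar multiply to the square of that of the ball.\<close>

lemma mixed_as_dilated_ellipsoids_product:
  fixes T :: "real^'n::finite \<Rightarrow> real^'n" and c :: "'n \<Rightarrow> real" and p :: real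
  assumes T: "ellipsoid_map T" and c: "\<And>i. c i > 0" and p: "p \<ge> 0"
    and K: "\<And>i. K i = (\<lambda>x. c i *\<^sub>R T x) ` cball 0 1"
  shows "mixed_as p K * mixed_as p (\<lambda>i. polar (K i)) = (CARD('n) * vol (cball 0 1 :: (real^'n) set))\<^sup>2"
proof -
  interpret T: ellipsoid_map T by (rule T)
  interpret P: ellipsoid_map "adjoint T.S" by (rule T.polar_map)
  interpret S: ellipsoid_map T.S
    by (rule ellipsoid_map.intro[OF T.linear_S o_bij[of T]]) (auto simp: fun_eq_iff)
  let ?d = "det (matrix T)" and ?N = "CARD('n)"
  have "det (matrix T) * det (matrix T.S) = 1"
  proof -
    have "matrix (\<lambda>x::real^'n. x) = mat 1" using matrix_id_mat_1 by (simp add: id_def)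
    then show ?thesis using det_compose[OF T.lin T.linear_S] by simp
  qed
  then have dP: "det (matrix (adjoint T.S)) = inverse ?d"
    using T.det_nz S.det_adjoint by (simp add: field_simps)
  have KE: "K i = (\<lambda>x. c i *\<^sub>R x) ` T.E" for i by (simp add: K T.E_def image_image)
  have K': "polar (K i) = (\<lambda>x. inverse (c i) *\<^sub>R adjoint T.S x) ` cball 0 1" for i
    unfolding KE polar_scale[OF c] T.polar_E by (simp add: image_image)
  have ppE: "polar (adjoint T.S ` cball 0 1) = T.E"
    using polar_polar[OF T.body_E] T.polar_E by simp
  let ?C = "(\<Prod>i\<in>UNIV. (c i ^ ?N * ?d)\<^sup>2)" and ?C' = "(\<Prod>i\<in>UNIV. (inverse (c i) ^ ?N * inverse ?d)\<^sup>2)"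
  let ?e = "1 / (real ?N + p)"
  have m1: "mixed_as p K = ?C powr ?e / (\<Prod>i\<in>UNIV. c i) * (?N * vol (polar T.E))"
    using mixed_as_dilated_ellipsoids[OF T c p] by (simp add: K[abs_def] T.E_def)
  have m2: "mixed_as p (\<lambda>i. polar (K i)) = ?C' powr ?e / (\<Prod>i\<in>UNIV. inverse (c i)) * (?N * vol T.E)"
    using mixed_as_dilated_ellipsoids[OF P.ellipsoid_map_axioms _ p, of "\<lambda>i. inverse (c i)"] c
    by (simp add: K' dP ppE)
  have cc: "?C powr ?e * ?C' powr ?e = 1"
  proof -
    have "?C powr ?e * ?C' powr ?e = (?C * ?C') powr ?e" by (rule powr_mult[symmetric])
    also have "?C * ?C' = (\<Prod>i\<in>UNIV. (c i ^ ?N * ?d)\<^sup>2 * (inverse (c i) ^ ?N * inverse ?d)\<^sup>2)"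
      by (rule prod.distrib[symmetric])
    also have "\<dots> = 1"
    proof (rule prod.neutral, rule ballI)
      fix i
      have "c i ^ ?N \<noteq> 0" using c[of i] by simp
      then have "(c i ^ ?N * ?d) * (inverse (c i) ^ ?N * inverse ?d) = 1"
        using T.det_nz by (simp add: power_inverse field_simps)
      then show "(c i ^ ?N * ?d)\<^sup>2 * (inverse (c i) ^ ?N * inverse ?d)\<^sup>2 = 1"
        by (metis power_mult_distrib power_one)
    qed
    finally show ?thesis by simp
  qed
  have vv: "vol (polar T.E) * vol T.E = (vol (cball 0 1 :: (real^'n) set))\<^sup>2"
    using T.vol_E P.vol_E T.det_nz by (simp add: P.E_def T.polar_E dP abs_inverse power2_eq_square field_simps)
  define Q where "Q = (\<Prod>i\<in>UNIV. c i)"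
  have Q: "Q \<noteq> 0" using c unfolding Q_def by (simp add: less_imp_neq[symmetric])
  have Q': "(\<Prod>i\<in>UNIV. inverse (c i)) = inverse Q"
    unfolding Q_def using prod_inversef[of c UNIV] by (simp add: o_def)
  have "mixed_as p K * mixed_as p (\<lambda>i. polar (K i)) = (?C powr ?e * ?C' powr ?e) * (real ?N)\<^sup>2 * (vol (polar T.E) * vol T.E)"
    unfolding m1 m2 Q_def[symmetric] Q' using Q by (simp add: power2_eq_square divide_inverse)
  then show ?thesis unfolding cc vv by (simp add: power_mult_distrib)
qed

theorem proposition2p4:
  fixes K :: "'n::finite \<Rightarrow> (real^'n) set" and p :: real
  assumes "\<And>i. C2_plus (K i)"
    and "\<And>i. centroid (K i) = 0"
    and "p \<ge> 0"
  shows "mixed_as p K ^ CARD('n) * mixed_as p (\<lambda>i. polar (K i)) ^ CARD('n)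
           \<le> real CARD('n) ^ (2 * CARD('n)) * (\<Prod>i\<in>UNIV. vol (K i) * vol (polar (K i)))
         \<and> mixed_as p K * mixed_as p (\<lambda>i. polar (K i))
           \<le> (affine_surface_area p (cball 0 1 :: (real^'n) set))\<^sup>2
         \<and> ((\<forall>i. ellipsoid (K i)) \<and> (\<forall>i j. dilates (K i) (K j))
             \<longrightarrow> mixed_as p K * mixed_as p (\<lambda>i. polar (K i))
                 = (affine_surface_area p (cball 0 1 :: (real^'n) set))\<^sup>2)"
proof -
  let ?B = "cball 0 1 :: (real^'n) set" and ?n = "real CARD('n)"
  let ?m = "mixed_as p K" and ?m' = "mixed_as p (\<lambda>i. polar (K i))"
  have int: "0 \<in> interior (K i)" for i
    using assms(1)[of i] assms(2)[of i] interior_of_centroid_0 by (auto simp: C2_plus_def)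
  have "\<exists>\<nu> X. gauss_pair (K i) \<nu> X" for i
    using C2_plus_gauss_pair[OF assms(1) int] by blast
  then obtain \<nu> X where gp: "\<And>i. gauss_pair (K i) (\<nu> i) (X i)" by metis
  have bd: "origin_body (K i)" "origin_body (polar (K i))" for i
    using gp[of i] gauss_pair.body origin_body_polar by blast+
  note 1 = mixed_as_product_bound[where K=K, OF gp assms(3)]
  have asB: "affine_surface_area p ?B = ?n * vol ?B" by (rule affine_surface_area_ball[OF assms(3)])
  have vB: "vol ?B > 0" by (rule vol_pos) (simp add: origin_body_def)
  have "(\<Prod>i\<in>UNIV. vol (K i) * vol (polar (K i))) \<le> (\<Prod>i\<in>(UNIV::'n set). (vol ?B)\<^sup>2)"
    using vol_pos[OF bd(1)] vol_pos[OF bd(2)] blaschke_santalo[OF bd(1) assms(2)]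
    by (intro prod_mono) (auto intro: mult_nonneg_nonneg less_imp_le)
  then have "?n ^ (2 * CARD('n)) * (\<Prod>i\<in>UNIV. vol (K i) * vol (polar (K i))) \<le> ?n ^ (2 * CARD('n)) * (\<Prod>i\<in>(UNIV::'n set). (vol ?B)\<^sup>2)"
    by (rule mult_left_mono) simp
  also have "\<dots> = ((?n * vol ?B)\<^sup>2) ^ CARD('n)"
    by (simp add: power_mult power_mult_distrib)
  finally have "(?m * ?m') ^ CARD('n) \<le> ((?n * vol ?B)\<^sup>2) ^ CARD('n)"
    using 1(1) by (simp add: power_mult_distrib)
  \<comment> \<open>The root of order \<open>CARD('n)\<close> is taken. The rule is stated for a
    successor as exponent, hence the \<open>- 1\<close>.\<close>
  then have 2: "?m * ?m' \<le> (?n * vol ?B)\<^sup>2"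
    by (rule power_le_imp_le_base[of _ "CARD('n) - 1", simplified]) simp
  have 3: "?m * ?m' = (?n * vol ?B)\<^sup>2" if ell: "\<forall>i. ellipsoid (K i)" and dil: "\<forall>i j. dilates (K i) (K j)"
  proof -
    \<comment> \<open>The index type is nonempty; one body serves as the reference of which all the
      others are dilates.\<close>
    obtain i0 :: 'n where True by simp
    obtain T where T: "ellipsoid_map T" "K i0 = T ` cball 0 1"
      using centred_ellipsoid[OF bd(1) assms(2)] ell by blast
    have "\<forall>i. \<exists>c. 0 < c \<and> K i = (\<lambda>x. c *\<^sub>R x) ` K i0" using dil unfolding dilates_def by blast
    from choice[OF this] obtain c where c': "\<forall>i. 0 < c i \<and> K i = (\<lambda>x. c i *\<^sub>R x) ` K i0" ..
    then have c: "\<And>i. c i > 0" "\<And>i. K i = (\<lambda>x. c i *\<^sub>R x) ` K i0" by blast+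
    show ?thesis
    proof (rule mixed_as_dilated_ellipsoids_product[OF T(1) c(1) assms(3)])
      show "K i = (\<lambda>x. c i *\<^sub>R T x) ` cball 0 1" for i
        using c(2)[of i] unfolding T(2) image_image .
    qed
  qed
  show ?thesis
    unfolding asB
  proof (intro conjI impI)
    show "?m * ?m' = (?n * vol ?B)\<^sup>2" if "(\<forall>i. ellipsoid (K i)) \<and> (\<forall>i j. dilates (K i) (K j))"
      using 3 that by simp
  qed (fact 1(1), fact 2)
qed

end
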